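(* Let $p$ be a prime and let $W$ be a residually algebraic torsion extension of $\mathbb{Z}_{(p)}$ to $\mathbb{Q}(X)$. Then there exists a pseudo-convergent sequence $E\subset\overline{\mathbb{Q}_p}$ of transcendental type over $\mathbb{Q}$ such that $W=\mathbb{Z}_{(p),E}$. More precisely, let $e,f$ be the ramification index and the residue field degree of $W$ over $\mathbb{Z}_{(p)}$, respectively, and let $\widehat{\mathbb{Q}(X)}$ be the completion of $\mathbb{Q}(X)$ with respect to the $W$-adic topology. Then the following conditions are equivalent: 1. $\widehat{\mathbb{Q}(X)}$ is a finite extension of $\mathbb{Q}_p$. 2. $X$ is algebraic over $\mathbb{Q}_p$. 3. $W=\mathbb{Z}_{(p),\alpha}$ for some $\alpha\in\overline{\mathbb{Q}_p}$ transcendental over $\mathbb{Q}$. 4. $ef<\infty$. If any one of these conditions holds, then the sequence $E$ above is Cauchy and converges to $\alpha$ (and $E$ is therefore of algebraic type over $\mathbb{Q}_p$). Moreover, $\Gamma_w=\Gamma_\alpha$ and $k_w=k_\alpha$, where $\Gamma_w,k_w$ are the value group and residue field of $W$, and $\Gamma_\alpha,k_\alpha$ those of $\mathbb{Q}_p(\alpha)$ with respect to $v_p$. If $ef=\infty$, then $E\subset\overline{\mathbb{Q}_p}$ is of transcendental type over $\mathbb{Q}_p$ and $\mathbb{Z}_{(p),E}\subset\mathbb{Z}_{p,E}$ is an immediate extension.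
   Context: $\overline{\mathbb{Q}_p}$ is a fixed algebraic closure of $\mathbb{Q}_p$, $v_p$ is the $p$-adic valuation extended uniquely to $\overline{\mathbb{Q}_p}$ (with $v_p(p)=1$), and $\overline{\mathbb{Z}_p}$ is its valuation ring. A valuation domain $W$ of $\mathbb{Q}(X)$ (i.e. with quotient field $\mathbb{Q}(X)$) is an extension of $\mathbb{Z}_{(p)}$ if $W\cap\mathbb{Q}=\mathbb{Z}_{(p)}$; it is residually algebraic if its residue field is algebraic over $\mathbb{F}_p$, and torsion if its value group is contained in the divisible hull $\mathbb{Q}$ of the value group $\mathbb{Z}$ of $v_p$. Here $w$ is the valuation associated to $W$, normalized to extend $v_p$. The ramification index is $e=[\Gamma_w:\mathbb{Z}]$ and the residue field degree is $f=[k_w:\mathbb{F}_p]$ (possibly infinite). For such $W$, the field $\mathbb{Q}_p$ is contained in $\widehat{\mathbb{Q}(X)}$ as the closure of $\mathbb{Q}$. A sequence $E=\{s_n\}_{n\in\mathbb{N}}\subset\overline{\mathbb{Q}_p}$ is pseudo-convergent if $v_p(s_n-s_m)<v_p(s_m-s_k)$ for all $n<m<k$. For a subfield $F$ of $\overline{\mathbb{Q}_p}$, $E$ is of transcendental type over $F$ if for every $g\in F[X]$ the sequence $v_p(g(s_n))$ is eventually constant, and of algebraic type over $F$ if $v_p(g(s_n))$ is eventually strictly increasing for some $g\in F[X]$. $\mathbb{Z}_{(p),E}=\{\phi\in\mathbb{Q}(X)\mid\phi(s_n)\in\overline{\mathbb{Z}_p}\text{ for all sufficiently large }n\}$, $\mathbb{Z}_{p,E}=\{\phi\in\mathbb{Q}_p(X)\mid\phi(s_n)\in\overline{\mathbb{Z}_p}\text{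 for all sufficiently large }n\}$, and for $\alpha\in\overline{\mathbb{Q}_p}$, $\mathbb{Z}_{(p),\alpha}=\{\phi\in\mathbb{Q}(X)\mid\phi(\alpha)\in\overline{\mathbb{Z}_p}\}$. An extension of valuation domains $V\subset V'$ (with $V=V'\cap\mathrm{Frac}(V)$) is immediate if the value groups coincide and the residue fields coincide. *)

theory Defs
  imports
    "HOL-Library.Extended_Real"
    "HOL-Computational_Algebra.Computational_Algebra"
    "HOL-Algebra.Algebraic_Closure_Type"
    "HOL-Algebra.Generated_Fields"
    "HOL-Algebra.Multiplicative_Group"
begin

text \<open>
  All fields below are subsets \<open>K\<close> of an ambient field type; the HOL-Algebra view of such a subset
  is \<open>ring_on K\<close>.
\<close>

abbreviation ring_on :: "'k::field set \<Rightarrow> 'k ring" where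
  "ring_on K \<equiv> ring_of_type_algebra\<lparr>carrier := K\<rparr>"


section \<open>Valuations and valuation domains\<close>

definition valuation_on :: "'k::field set \<Rightarrow> ('k \<Rightarrow> ereal) \<Rightarrow> bool" where
  "valuation_on K v \<longleftrightarrow>
     (\<forall>x\<in>K. v x \<noteq> -\<infinity> \<and> (v x = \<infinity> \<longleftrightarrow> x = 0)) \<and>
     (\<forall>x\<in>K. \<forall>y\<in>K. v (x * y) = v x + v y) \<and>
     (\<forall>x\<in>K. \<forall>y\<in>K. v (x + y) \<ge> min (v x) (v y))"

definition value_group :: "'k::field set \<Rightarrow> ('k \<Rightarrow> ereal) \<Rightarrow> real set" where
  "value_group K v = {r. \<exists>x\<in>K - {0}. v x = ereal r}"

text \<open>\<open>V\<close> is a valuation domain whose quotient field is (the subfield) \<open>K\<close>.\<close>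

definition valuation_domain :: "'k::field set \<Rightarrow> 'k set \<Rightarrow> bool" where
  "valuation_domain K V \<longleftrightarrow>
     subring V ring_of_type_algebra \<and> V \<subseteq> K \<and> (\<forall>x\<in>K - {0}. x \<in> V \<or> inverse x \<in> V)"

definition max_ideal :: "'k::field set \<Rightarrow> 'k set" where
  "max_ideal V = V - Units (ring_on V)"

definition residue_field :: "'k::field set \<Rightarrow> 'k set ring" where
  "residue_field V = ring_on V Quot max_ideal V"

definition residue_class :: "'k::field set \<Rightarrow> 'k \<Rightarrow> 'k set" where
  "residue_class V x = max_ideal V +>\<^bsub>ring_on V\<^esub> x"

text \<open>The value group of a valuation domain with no normalization chosen: \<open>K\<^sup>* / V\<^sup>*\<close>.\<close>

definition abstract_value_group :: "'k::field set \<Rightarrow> 'k set \<Rightarrow> 'k set monoid" where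
  "abstract_value_group K V = mult_of (ring_on K) Mod Units (ring_on V)"

definition abstract_value :: "'k::field set \<Rightarrow> 'k set \<Rightarrow> 'k \<Rightarrow> 'k set" where
  "abstract_value K V x = Units (ring_on V) #>\<^bsub>mult_of (ring_on K)\<^esub> x"

text \<open>
  \<open>V \<subseteq> V'\<close> is an immediate extension of valuation domains, with quotient fields \<open>K \<subseteq> L\<close>: the
  homomorphisms of value groups and of residue fields induced by the inclusion are isomorphisms.
\<close>

definition immediate_extension ::
    "'k::field set \<Rightarrow> 'k set \<Rightarrow> 'k set \<Rightarrow> 'k set \<Rightarrow> bool" where
  "immediate_extension K V L V' \<longleftrightarrow>
     valuation_domain K V \<and> valuation_domain L V' \<and> K \<subseteq> L \<and> V = V' \<inter> K \<and>
     (\<exists>h\<in>iso (abstract_value_group K V) (abstract_value_group L V').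
        \<forall>x\<in>K - {0}. h (abstract_value K V x) = abstract_value L V' x) \<and>
     (\<exists>h\<in>ring_iso (residue_field V) (residue_field V').
        \<forall>x\<in>V. h (residue_class V x) = residue_class V' x)"


section \<open>Completion for the topology of a valuation domain\<close>

text \<open>
  The \<open>V\<close>-adic topology on \<open>K\<close> has the sets \<open>a V\<close> with \<open>a \<in> K - {0}\<close> as a neighbourhood basis of 0.
  The completion is built from Cauchy sequences, which is correct when this topology is metrizable,
  in particular when \<open>V\<close> has rank one.
\<close>

definition adic_cauchy :: "'k::field set \<Rightarrow> 'k set \<Rightarrow> (nat \<Rightarrow> 'k) set" where
  "adic_cauchy K V = {s. range s \<subseteq> K \<and>
     (\<forall>a\<in>K - {0}. \<exists>N. \<forall>m\<ge>N. \<forall>n\<ge>N. s m - s n \<in> (\<lambda>x. a * x) ` V)}"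

definition adic_null :: "'k::field set \<Rightarrow> 'k set \<Rightarrow> (nat \<Rightarrow> 'k) set" where
  "adic_null K V = {s. range s \<subseteq> K \<and>
     (\<forall>a\<in>K - {0}. \<exists>N. \<forall>n\<ge>N. s n \<in> (\<lambda>x. a * x) ` V)}"

definition cauchy_ring :: "'k::field set \<Rightarrow> 'k set \<Rightarrow> (nat \<Rightarrow> 'k) ring" where
  "cauchy_ring K V =
     \<lparr>carrier = adic_cauchy K V, monoid.mult = (\<lambda>s t n. s n * t n), one = (\<lambda>_. 1),
      ring.zero = (\<lambda>_. 0), add = (\<lambda>s t n. s n + t n)\<rparr>"

definition completion :: "'k::field set \<Rightarrow> 'k set \<Rightarrow> (nat \<Rightarrow> 'k) set ring" where
  "completion K V = cauchy_ring K V Quot adic_null K V"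

definition completion_lim :: "'k::field set \<Rightarrow> 'k set \<Rightarrow> (nat \<Rightarrow> 'k) \<Rightarrow> (nat \<Rightarrow> 'k) set" where
  "completion_lim K V s = adic_null K V +>\<^bsub>cauchy_ring K V\<^esub> s"

text \<open>The closure in the completion of a subset \<open>A\<close> of \<open>K\<close>: all limits of sequences from \<open>A\<close>.\<close>

definition completion_closure :: "'k::field set \<Rightarrow> 'k set \<Rightarrow> 'k set \<Rightarrow> (nat \<Rightarrow> 'k) set set" where
  "completion_closure K V A = completion_lim K V ` {s \<in> adic_cauchy K V. range s \<subseteq> A}"

abbreviation completion_const :: "'k::field set \<Rightarrow> 'k set \<Rightarrow> 'k \<Rightarrow> (nat \<Rightarrow> 'k) set" where
  "completion_const K V x \<equiv> completion_lim K V (\<lambda>_. x)"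


section \<open>The p-adic valuation and the algebraic closure of the p-adic numbers\<close>

definition rat_val :: "nat \<Rightarrow> rat \<Rightarrow> ereal" where
  "rat_val p q = (if q = 0 then \<infinity> else
     ereal (real (multiplicity (int p) (fst (quotient_of q))) -
            real (multiplicity (int p) (snd (quotient_of q)))))"

definition Z_loc :: "nat \<Rightarrow> rat set" where
  "Z_loc p = {of_int a / of_int b | a b. \<not> int p dvd b}"

definition v_cauchy :: "('c::field \<Rightarrow> ereal) \<Rightarrow> (nat \<Rightarrow> 'c) \<Rightarrow> bool" where
  "v_cauchy v s \<longleftrightarrow> (\<forall>r::real. \<exists>N. \<forall>m\<ge>N. \<forall>n\<ge>N. v (s m - s n) > ereal r)"

definition v_converges :: "('c::field \<Rightarrow> ereal) \<Rightarrow> (nat \<Rightarrow> 'c) \<Rightarrow> 'c \<Rightarrow> bool" where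
  "v_converges v s a \<longleftrightarrow> (\<lambda>n. v (s n - a)) \<longlonglongrightarrow> \<infinity>"

definition Q_p :: "('c::field_char_0 \<Rightarrow> ereal) \<Rightarrow> 'c set" where
  "Q_p v = {x. \<forall>r::real. \<exists>q::rat. v (x - of_rat q) > ereal r}"

text \<open>
  The field \<open>'c\<close> with the valuation \<open>v\<close> is an algebraic closure of the field of p-adic numbers with
  its extended p-adic valuation: \<open>v\<close> extends the p-adic valuation of the rationals, the closure
  \<open>Q_p v\<close> of the rationals is complete (hence is the field of p-adic numbers), and the algebraically
  closed field \<open>'c\<close> is algebraic over it. This determines the pair \<open>'c\<close>, \<open>v\<close> up to isomorphism.
\<close>

definition padic_algebraic_closure ::
    "nat \<Rightarrow> ('c::{alg_closed_field,field_char_0} \<Rightarrow> ereal) \<Rightarrow> bool" where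
  "padic_algebraic_closure p v \<longleftrightarrow>
     valuation_on UNIV v \<and>
     (\<forall>q. v (of_rat q) = rat_val p q) \<and>
     (\<forall>s. range s \<subseteq> Q_p v \<and> v_cauchy v s \<longrightarrow> (\<exists>x. v_converges v s x)) \<and>
     (\<forall>x. \<exists>g. g \<noteq> 0 \<and> set (coeffs g) \<subseteq> Q_p v \<and> poly g x = 0)"

definition Q_p_adjoin :: "('c::field_char_0 \<Rightarrow> ereal) \<Rightarrow> 'c \<Rightarrow> 'c set" where
  "Q_p_adjoin v a = generate_field ring_of_type_algebra (insert a (Q_p v))"


section \<open>Rational functions\<close>

text \<open>
  For a subfield \<open>F\<close> of \<open>'c\<close>, the field \<open>F(X)\<close> is regarded as a subfield of \<open>'c(X)\<close>, so that
  \<open>rat_funs \<rat>\<close> and \<open>rat_funs (Q_p v)\<close> are the fields of rational functions over the rationals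
  and over the p-adic numbers.
\<close>

definition rat_funs :: "'c::field set \<Rightarrow> 'c poly fract set" where
  "rat_funs F = {Fract f g | f g. set (coeffs f) \<subseteq> F \<and> set (coeffs g) \<subseteq> F \<and> g \<noteq> 0}"

definition const_fun :: "'c::field \<Rightarrow> 'c poly fract" where
  "const_fun c = Fract [:c:] 1"

definition X_fun :: "'c::field poly fract" where
  "X_fun = Fract [:0, 1:] 1"

text \<open>\<open>\<phi>\<close> has no pole at \<open>a\<close> and takes the value \<open>y\<close> there.\<close>

definition has_value_at :: "'c::field poly fract \<Rightarrow> 'c \<Rightarrow> 'c \<Rightarrow> bool" where
  "has_value_at \<phi> a y \<longleftrightarrow> (\<exists>f g. \<phi> = Fract f g \<and> poly g a \<noteq> 0 \<and> y = poly f a / poly g a)"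

definition Z_at :: "('c::field \<Rightarrow> ereal) \<Rightarrow> 'c set \<Rightarrow> 'c \<Rightarrow> 'c poly fract set" where
  "Z_at v F a = {\<phi> \<in> rat_funs F. \<exists>y. has_value_at \<phi> a y \<and> v y \<ge> 0}"

definition Z_seq :: "('c::field \<Rightarrow> ereal) \<Rightarrow> 'c set \<Rightarrow> (nat \<Rightarrow> 'c) \<Rightarrow> 'c poly fract set" where
  "Z_seq v F s = {\<phi> \<in> rat_funs F. \<exists>N. \<forall>n\<ge>N. \<exists>y. has_value_at \<phi> (s n) y \<and> v y \<ge> 0}"


section \<open>Pseudo-convergent sequences\<close>

definition pseudo_convergent :: "('c::field \<Rightarrow> ereal) \<Rightarrow> (nat \<Rightarrow> 'c) \<Rightarrow> bool" where
  "pseudo_convergent v s \<longleftrightarrow>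
     (\<forall>n m k. n < m \<and> m < k \<longrightarrow> v (s n - s m) < v (s m - s k))"

definition transcendental_type ::
    "('c::field \<Rightarrow> ereal) \<Rightarrow> 'c set \<Rightarrow> (nat \<Rightarrow> 'c) \<Rightarrow> bool" where
  "transcendental_type v F s \<longleftrightarrow>
     (\<forall>g. set (coeffs g) \<subseteq> F \<longrightarrow> (\<exists>N. \<forall>n\<ge>N. v (poly g (s n)) = v (poly g (s N))))"

definition algebraic_type ::
    "('c::field \<Rightarrow> ereal) \<Rightarrow> 'c set \<Rightarrow> (nat \<Rightarrow> 'c) \<Rightarrow> bool" where
  "algebraic_type v F s \<longleftrightarrow>
     (\<exists>g. set (coeffs g) \<subseteq> F \<and>
        (\<exists>N. \<forall>m n. N \<le> m \<and> m < n \<longrightarrow> v (poly g (s m)) < v (poly g (s n))))"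


section \<open>Extensions of the localization at p to the rational function field\<close>

definition Z_loc_funs :: "nat \<Rightarrow> 'c::field_char_0 poly fract set" where
  "Z_loc_funs p = (\<lambda>q. const_fun (of_rat q)) ` Z_loc p"

definition valuation_domain_extension :: "nat \<Rightarrow> 'c::field_char_0 poly fract set \<Rightarrow> bool" where
  "valuation_domain_extension p W \<longleftrightarrow>
     valuation_domain (rat_funs \<rat>) W \<and> W \<inter> const_fun ` \<rat> = Z_loc_funs p"

text \<open>The field with \<open>p\<close> elements inside the residue field of \<open>W\<close>.\<close>

definition residue_prime_field :: "nat \<Rightarrow> 'c::field_char_0 poly fract set \<Rightarrow> 'c poly fract set set"
  where "residue_prime_field p W = residue_class W ` Z_loc_funs p"

definition residually_algebraic :: "nat \<Rightarrow> 'c::field_char_0 poly fract set \<Rightarrow> bool" where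
  "residually_algebraic p W \<longleftrightarrow>
     (\<forall>z\<in>carrier (residue_field W).
        ring.algebraic (residue_field W) (residue_prime_field p W) z)"

text \<open>
  \<open>w\<close> is a valuation with valuation domain \<open>W\<close>, normalized to extend the p-adic valuation; it is
  unique on \<open>rat_funs \<rat>\<close>. The extension is torsion iff such a \<open>w\<close> exists with values in the
  divisible hull \<open>\<rat>\<close> of \<open>\<int>\<close>.
\<close>

definition normalized_valuation ::
    "nat \<Rightarrow> 'c::field_char_0 poly fract set \<Rightarrow> ('c poly fract \<Rightarrow> ereal) \<Rightarrow> bool" where
  "normalized_valuation p W w \<longleftrightarrow>
     valuation_on (rat_funs \<rat>) w \<and>
     W = {\<phi> \<in> rat_funs \<rat>. w \<phi> \<ge> 0} \<and>
     (\<forall>q. w (const_fun (of_rat q)) = rat_val p q)"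

definition enat_card :: "'a set \<Rightarrow> enat" where
  "enat_card A = (if finite A then enat (card A) else \<infinity>)"

text \<open>The index of \<open>\<int>\<close> in the value group of \<open>w\<close>.\<close>

definition ramification_index :: "('c::field_char_0 poly fract \<Rightarrow> ereal) \<Rightarrow> enat" where
  "ramification_index w =
     enat_card (a_rcosets\<^bsub>ring_on (value_group (rat_funs \<rat>) w)\<^esub> \<int>)"

definition residue_degree :: "nat \<Rightarrow> 'c::field_char_0 poly fract set \<Rightarrow> enat" where
  "residue_degree p W =
     (let k = residue_field W; F = residue_prime_field p W in
      if ring.finite_dimension k F (carrier k) then enat (ring.dim k F (carrier k)) else \<infinity>)"

end

theory Submission
  imports Defs
begin

text \<open>
  Eliminating rational relations between coefficients shows that the maximal ideals of the valuation
  rings of \<open>v\<close> and \<open>w\<close> generate a proper ideal of the ring generated by the two; by Chevalley's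
  theorem some valuation ring \<open>R\<close> of the rational functions over \<open>'c\<close> dominates both.
  With respect to \<open>R\<close>, each \<open>X - \<beta>\<close> with \<open>\<beta>\<close> algebraic over the rationals has a real absolute value,
  and as the residue field of \<open>W\<close> is algebraic, these have no minimum. A sequence of \<open>\<beta>\<close> along which
  they decrease to their infimum is pseudo-convergent and computes \<open>w\<close>.

  If the sequence converges to \<open>\<alpha>\<close>, then \<open>W\<close> is given by evaluation at \<open>\<alpha>\<close>, and total boundedness of
  \<open>Q_p(\<alpha>)\<close> makes \<open>W/pW\<close> finite. Finiteness of \<open>W/pW\<close> amounts to that of \<open>ef\<close>, and by p-adic
  expansions it makes the completion finite over \<open>Q_p\<close>. Finally an equation of \<open>X\<close> over \<open>Q_p\<close> forces
  the sequence to converge to one of its roots. If there is no limit, polynomials over \<open>Q_p\<close> are bounded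
  below along the sequence, so that rational approximations to them have the same values, which gives
  transcendental type and immediacy.
\<close>

section \<open>Dominating valuation rings\<close>

text \<open>The field \<open>'c\<close> with \<open>v\<close> is given in advance, so no closure can
  be chosen to suit \<open>W\<close>: the fields \<open>'c\<close> and
  \<open>rat_funs \<rat>\<close> meet only in the rationals, and elements of \<open>'c\<close> must
  be found that imitate \<open>X\<close>. This is why a ring above both valuation rings is needed.
  Its value group need not embed in the reals, so it is never measured as a whole: only functions
  that are constants up to a unit of \<open>R\<close> receive an absolute value, and algebraicity
  over the rationals supplies enough of them. Valuations are replaced by real absolute values
  \<open>exp (- v)\<close>, for which the estimates are plain inequalities and zero is an ordinary
  argument. In these terms the theorem is about sequences along which, and points at which, every
  rational polynomial has the norm prescribed by \<open>w\<close>. By torsion, a power of any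
  nonzero function is a power of \<open>p\<close> times a unit of \<open>W\<close>, so
  \<open>W\<close> alone determines these norms. Hence the conclusions reach every sequence and
  every point that defines \<open>W\<close>, not only those constructed here.\<close>

lemma sum_mem:
  fixes J :: "'k::field set"
  assumes "0 \<in> J" and add: "\<And>x y. x \<in> J \<Longrightarrow> y \<in> J \<Longrightarrow> x + y \<in> J"
    and "finite S" and "\<And>i. i \<in> S \<Longrightarrow> f i \<in> J"
  shows "sum f S \<in> J"
  using assms(3,4) by (induction S rule: finite_induct) (auto simp: assms(1) add)

text \<open>A substitute for a proper ideal of an unspecified ring containing \<open>A\<close>:
  closure under products replaces that ring, which is recovered at the end as the set of multipliers
  of a maximal \<open>J\<close>.\<close>

definition mult_stable :: "'k::field set \<Rightarrow> 'k set \<Rightarrow> bool" where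
  "mult_stable A J \<longleftrightarrow> 0 \<in> J \<and> 1 \<notin> J \<and> (\<forall>x\<in>J. \<forall>y\<in>J. x + y \<in> J) \<and>
     (\<forall>x\<in>J. \<forall>y\<in>J. x * y \<in> J) \<and> (\<forall>x\<in>A. \<forall>y\<in>J. x * y \<in> J)"

lemma mult_stableD:
  assumes "mult_stable A J"
  shows "0 \<in> J" "1 \<notin> J" "\<And>x y. x \<in> J \<Longrightarrow> y \<in> J \<Longrightarrow> x + y \<in> J"
    "\<And>x y. x \<in> J \<Longrightarrow> y \<in> J \<Longrightarrow> x * y \<in> J" "\<And>x y. x \<in> A \<Longrightarrow> y \<in> J \<Longrightarrow> x * y \<in> J"
    "\<And>f S. finite S \<Longrightarrow> (\<And>i. i \<in> S \<Longrightarrow> f i \<in> J) \<Longrightarrow> sum f S \<in> J"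
  using assms unfolding mult_stable_def by (auto intro!: sum_mem)

text \<open>The coefficients of a product of polynomials are sums of products of coefficients, so
  adjoining \<open>x\<close> to \<open>J\<close> in this way preserves every closure property. Only
  \<open>1\<close> can go wrong, and this is what the second assumption excludes.\<close>

lemma mult_stable_adjoin:
  assumes J: "mult_stable A J"
    and x: "\<nexists>f. (\<forall>i. coeff f i \<in> J) \<and> poly f x = 1"
  shows "mult_stable A {poly f x | f. \<forall>i. coeff f i \<in> J}"
proof -
  note D = mult_stableD[OF J]
  let ?J' = "{poly f x | f. \<forall>i. coeff f i \<in> J}"
  have mem: "poly f x \<in> ?J'" if "\<And>i. coeff f i \<in> J" for f
    using that by blast
  show ?thesis
    unfolding mult_stable_def
  proof (intro conjI ballI)
    show "0 \<in> ?J'" using mem[of 0] D(1) by simp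
    show "1 \<notin> ?J'" using x by auto
  next
    fix y z assume "y \<in> ?J'" "z \<in> ?J'"
    then obtain f g where fg: "y = poly f x" "z = poly g x" "\<And>i. coeff f i \<in> J" "\<And>i. coeff g i \<in> J"
      by blast
    show "y + z \<in> ?J'" using mem[of "f + g"] fg D(3) by simp
    show "y * z \<in> ?J'"
      unfolding fg(1,2) poly_mult[symmetric]
      by (rule mem) (auto simp: coeff_mult intro!: D(4,6) fg)
  next
    fix a y assume "a \<in> A" "y \<in> ?J'"
    then obtain f where f: "y = poly f x" "\<And>i. coeff f i \<in> J"
      by blast
    show "a * y \<in> ?J'" using mem[of "smult a f"] f D(5) \<open>a \<in> A\<close> by simp
  qed
qed

text \<open>By maximality adjoining \<open>x\<close> adds nothing to \<open>J\<close>, and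
  \<open>x * j\<close> is the value of the polynomial \<open>[:0, j:]\<close>. Read backwards: an
  \<open>x\<close> that does not multiply \<open>J\<close> into itself satisfies an equation
  \<open>f(x) = 1\<close> with coefficients in \<open>J\<close>.\<close>

lemma maximal_mult_stable:
  assumes J: "mult_stable A J"
    and max: "\<And>J'. mult_stable A J' \<Longrightarrow> J \<subseteq> J' \<Longrightarrow> J' = J"
    and x: "\<nexists>f. (\<forall>i. coeff f i \<in> J) \<and> poly f x = 1"
  shows "\<forall>j\<in>J. x * j \<in> J"
proof -
  note D = mult_stableD[OF J]
  let ?J' = "{poly f x | f. \<forall>i. coeff f i \<in> J}"
  have 1: "J \<subseteq> ?J'"
  proof
    fix j assume "j \<in> J"
    then have "j = poly [:j:] x \<and> (\<forall>i. coeff [:j:] i \<in> J)"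
      using D(1) by (auto simp: coeff_pCons split: nat.splits)
    then show "j \<in> ?J'" by blast
  qed
  have 2: "?J' = J"
    using max[OF mult_stable_adjoin[OF J x] 1] .
  show ?thesis
  proof
    fix j assume "j \<in> J"
    then have "x * j = poly [:0, j:] x \<and> (\<forall>i. coeff [:0, j:] i \<in> J)"
      using D(1) by (auto simp: coeff_pCons split: nat.splits)
    then show "x * j \<in> J" using 2 by blast
  qed
qed

lemma one_minus_power_mem:
  fixes J :: "'k::field set"
  assumes J: "mult_stable A J" and m1: "-1 \<in> A" and j: "j \<in> J"
  shows "\<exists>i\<in>J. (1 - j) ^ n = 1 - i"
proof (induction n)
  case 0
  then show ?case using mult_stableD(1)[OF J] by (intro bexI[of _ 0]) auto
next
  case (Suc n)
  note D = mult_stableD[OF J]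
  from Suc obtain i where i: "i \<in> J" "(1 - j) ^ n = 1 - i" by blast
  have "(1 - j) ^ Suc n = 1 - (i + j + -1 * (i * j))"
    unfolding power_Suc i(2) by (simp add: algebra_simps)
  moreover have "i + j + -1 * (i * j) \<in> J"
    using i j m1 by (intro D(3) D(5)[OF m1] D(4))
  ultimately show ?case by blast
qed

text \<open>The maximal \<open>J\<close> behaves like a Jacobson radical. An equation with value 1
  for \<open>inverse (1 - j)\<close>, multiplied by a power of \<open>1 - j\<close>, puts that power
  into \<open>J\<close>; but the powers of \<open>1 - j\<close> are 1 up to elements of
  \<open>J\<close>.\<close>

lemma maximal_one_minus:
  assumes J: "mult_stable A J" and m1: "-1 \<in> A"
    and max: "\<And>J'. mult_stable A J' \<Longrightarrow> J \<subseteq> J' \<Longrightarrow> J' = J"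
    and j: "j \<in> J" "i \<in> J"
  shows "inverse (1 - j) * i \<in> J"
proof -
  note D = mult_stableD[OF J]
  have nz: "1 - j \<noteq> 0" using j D(2) by auto
  have "\<nexists>f. (\<forall>i. coeff f i \<in> J) \<and> poly f (inverse (1 - j)) = 1"
  proof
    assume "\<exists>f. (\<forall>i. coeff f i \<in> J) \<and> poly f (inverse (1 - j)) = 1"
    then obtain f where f: "\<And>i. coeff f i \<in> J" "poly f (inverse (1 - j)) = 1" by blast
    let ?n = "degree f"
    have "(1 - j) ^ ?n = (1 - j) ^ ?n * poly f (inverse (1 - j))" using f by simp
    also have "\<dots> = (\<Sum>i\<le>?n. coeff f i * (1 - j) ^ (?n - i))"
      unfolding poly_altdef sum_distrib_left
    proof (rule sum.cong)
      fix i assume "i \<in> {..?n}"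
      then have "(1 - j) ^ ?n = (1 - j) ^ (?n - i) * (1 - j) ^ i"
        by (metis atMost_iff le_add_diff_inverse2 power_add)
      then show "(1 - j) ^ ?n * (coeff f i * inverse (1 - j) ^ i) = coeff f i * (1 - j) ^ (?n - i)"
        using nz by (simp add: power_inverse)
    qed simp
    also have "\<dots> \<in> J"
    proof (rule D(6))
      fix i assume "i \<in> {..?n}"
      obtain k where k: "k \<in> J" "(1 - j) ^ (?n - i) = 1 - k"
        using one_minus_power_mem[OF J m1 j(1)] by blast
      have "coeff f i * (1 - j) ^ (?n - i) = coeff f i + -1 * (coeff f i * k)"
        unfolding k by (simp add: algebra_simps)
      then show "coeff f i * (1 - j) ^ (?n - i) \<in> J"
        using D(3)[OF f(1) D(5)[OF m1 D(4)[OF f(1) k(1)]]] by metis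
    qed simp
    finally have "(1 - j) ^ ?n \<in> J" .
    moreover obtain k where k: "k \<in> J" "(1 - j) ^ ?n = 1 - k"
      using one_minus_power_mem[OF J m1 j(1)] by blast
    ultimately have "1 - k + k \<in> J" using D(3) by metis
    then show False using D(2) by simp
  qed
  from maximal_mult_stable[OF J max this] j(2) show ?thesis by blast
qed

text \<open>The core of Chevalley's argument: the equation for \<open>inverse x\<close>, multiplied
  by \<open>x ^ n\<close>, expresses \<open>x ^ n\<close> by lower powers with coefficients in
  \<open>J\<close>, and this removes the leading term of \<open>f\<close>. Applied to equations of
  least degree it yields a contradiction.\<close>

lemma reduce_degree:
  fixes x :: "'k::field"
  assumes J: "mult_stable A J" and m1: "-1 \<in> A"
    and max: "\<And>J'. mult_stable A J' \<Longrightarrow> J \<subseteq> J' \<Longrightarrow> J' = J"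
    and f: "\<forall>i. coeff f i \<in> J" "poly f x = 1"
    and g: "\<forall>i. coeff g i \<in> J" "poly g (inverse x) = 1"
    and deg: "degree g \<le> degree f" and x: "x \<noteq> 0"
  shows "\<exists>h. (\<forall>i. coeff h i \<in> J) \<and> poly h x = 1 \<and> degree h < degree f"
proof -
  note D = mult_stableD[OF J]
  define n where "n = degree f"
  define m where "m = degree g"
  define u where "u = 1 - coeff g 0"
  have n0: "n > 0"
  proof (rule ccontr)
    assume "\<not> n > 0"
    then obtain c where "f = [:c:]" unfolding n_def using degree_eq_zeroE by blast
    then have "1 \<in> J" using f by (metis coeff_pCons_0 mult_zero_right poly_0 poly_pCons add_0_right)
    then show False using D(2) by simp
  qed
  have nz: "u \<noteq> 0" unfolding u_def using g(1) D(2) by (metis eq_iff_diff_eq_0)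
  have g1: "1 = coeff g 0 + (\<Sum>i=1..m. coeff g i * inverse x ^ i)"
  proof -
    have "1 = (\<Sum>i\<le>m. coeff g i * inverse x ^ i)" using g(2) unfolding poly_altdef m_def by simp
    also have "{..m} = insert 0 {1..m}" by auto
    finally show ?thesis by simp
  qed
  have "u * x ^ n = x ^ n * (\<Sum>i=1..m. coeff g i * inverse x ^ i)"
    using g1 unfolding u_def by (metis add_diff_cancel_left' mult.commute)
  also have "\<dots> = (\<Sum>i=1..m. coeff g i * x ^ (n - i))"
    unfolding sum_distrib_left using deg x
    by (intro sum.cong) (auto simp: power_diff field_simps n_def m_def)
  finally have "u * x ^ n = (\<Sum>i=1..m. coeff g i * x ^ (n - i))" .
  have xn: "x ^ n = (\<Sum>i=1..m. (inverse u * coeff g i) * x ^ (n - i))"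
  proof -
    have "x ^ n = inverse u * (u * x ^ n)" using nz by simp
    also note \<open>u * x ^ n = (\<Sum>i=1..m. coeff g i * x ^ (n - i))\<close>
    finally show ?thesis by (simp add: sum_distrib_left mult.assoc)
  qed
  define q where "q = (\<Sum>i=1..m. monom (inverse u * coeff g i) (n - i))"
  have q: "poly q x = x ^ n" unfolding q_def xn by (simp add: poly_sum poly_monom)
  \<comment> \<open>Dividing by \<open>u\<close> stays in \<open>J\<close> because \<open>u\<close>
    is 1 minus an element of \<open>J\<close>.\<close>
  have qJ: "coeff q i \<in> J" for i
    unfolding q_def coeff_sum
    using maximal_one_minus[OF J m1 max, of "coeff g 0"] g(1) D(1)
    by (intro D(6)) (auto simp: u_def)
  have qd: "degree q \<le> n - 1"
    unfolding q_def by (intro degree_sum_le) (auto intro!: order.trans[OF degree_monom_le])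
  define h where "h = f - monom (coeff f n) n + smult (coeff f n) q"
  have "poly h x = 1" unfolding h_def using f(2) q by (simp add: poly_monom)
  moreover have "coeff h i \<in> J" for i
    unfolding h_def using f(1) qJ D(1,3,4) by auto
  moreover have "degree h \<le> n - 1"
  proof (rule degree_le, intro allI impI)
    fix i assume i: "n - 1 < i"
    have "coeff q i = 0" using qd i by (intro coeff_eq_0) auto
    moreover have "i = n \<or> coeff f i = 0" using i n_def coeff_eq_0[of f i] by linarith
    ultimately show "coeff h i = 0" unfolding h_def by auto
  qed
  ultimately show ?thesis using n0 n_def by (intro exI[of _ h]) auto
qed

text \<open>
  Chevalley's extension theorem: a maximal \<open>J \<supseteq> J0\<close> not containing 1 is the maximal ideal of the
  valuation ring of all \<open>x\<close> with \<open>x J \<subseteq> J\<close>.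
\<close>

theorem exists_dominating_valuation_ring:
  fixes J0 :: "'k::field set"
  assumes J0: "mult_stable A J0" and m1: "-1 \<in> A"
  obtains R J where "J0 \<subseteq> J" "A \<subseteq> R" "J \<subseteq> R" "1 \<in> R"
    "\<And>x y. x \<in> R \<Longrightarrow> y \<in> R \<Longrightarrow> x + y \<in> R" "\<And>x y. x \<in> R \<Longrightarrow> y \<in> R \<Longrightarrow> x * y \<in> R"
    "\<And>x y. x \<in> J \<Longrightarrow> y \<in> J \<Longrightarrow> x + y \<in> J" "\<And>x y. x \<in> R \<Longrightarrow> y \<in> J \<Longrightarrow> x * y \<in> J" "1 \<notin> J"
    "\<And>x. x \<in> R \<or> inverse x \<in> R" "\<And>x. x \<in> R \<Longrightarrow> x \<notin> J \<Longrightarrow> inverse x \<in> R"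
proof -
  have "\<exists>M\<in>{J. J0 \<subseteq> J \<and> mult_stable A J}. \<forall>Y\<in>{J. J0 \<subseteq> J \<and> mult_stable A J}. M \<subseteq> Y \<longrightarrow> Y = M"
  proof (rule subset_Zorn_nonempty)
    show "{J. J0 \<subseteq> J \<and> mult_stable A J} \<noteq> {}" using J0 by blast
  next
    fix \<C> assume ne: "\<C> \<noteq> {}" and ch: "subset.chain {J. J0 \<subseteq> J \<and> mult_stable A J} \<C>"
    have el: "J0 \<subseteq> C" "mult_stable A C" if "C \<in> \<C>" for C
      using ch that by (auto simp: subset_chain_def)
    have two: "\<exists>C\<in>\<C>. x \<in> C \<and> y \<in> C" if "x \<in> \<Union>\<C>" "y \<in> \<Union>\<C>" for x y
      using that ch unfolding subset_chain_def by blast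
    have "mult_stable A (\<Union>\<C>)"
      unfolding mult_stable_def
    proof (intro conjI ballI)
      show "0 \<in> \<Union>\<C>" using ne el(2) mult_stableD(1) by blast
      show "1 \<notin> \<Union>\<C>" using el(2) mult_stableD(2) by blast
      fix x y assume "x \<in> \<Union>\<C>" "y \<in> \<Union>\<C>"
      then obtain C where C: "C \<in> \<C>" "x \<in> C" "y \<in> C" using two by blast
      show "x + y \<in> \<Union>\<C>" "x * y \<in> \<Union>\<C>"
        using C mult_stableD(3,4)[OF el(2)[OF C(1)]] by blast+
    next
      fix x y assume "x \<in> A" "y \<in> \<Union>\<C>"
      then show "x * y \<in> \<Union>\<C>" using mult_stableD(5)[OF el(2)] by blast
    qed
    then show "\<Union>\<C> \<in> {J. J0 \<subseteq> J \<and> mult_stable A J}" using ne el(1) by blast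
  qed
  then obtain J where sub: "J0 \<subseteq> J" and J: "mult_stable A J"
    and max0: "\<And>Y. J0 \<subseteq> Y \<Longrightarrow> mult_stable A Y \<Longrightarrow> J \<subseteq> Y \<Longrightarrow> Y = J" by auto
  note D = mult_stableD[OF J]
  have max: "\<And>Y. mult_stable A Y \<Longrightarrow> J \<subseteq> Y \<Longrightarrow> Y = J" using max0 sub by blast
  define R where "R = {x. \<forall>j\<in>J. x * j \<in> J}"
  have R: "x * j \<in> J" if "x \<in> R" "j \<in> J" for x j using that R_def by blast
  have AR: "A \<subseteq> R" using D(5) by (auto simp: R_def)
  have JR: "J \<subseteq> R" using D(4) by (auto simp: R_def)
  have Radd: "x + y \<in> R" if "x \<in> R" "y \<in> R" for x y
    using that D(3) by (auto simp: R_def distrib_right)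
  have Rmult: "x * y \<in> R" if "x \<in> R" "y \<in> R" for x y
    using that by (auto simp: R_def mult.assoc)
  have inv1: "inverse (1 - j) \<in> R" if "j \<in> J" for j
    using maximal_one_minus[OF J m1 max that] by (auto simp: R_def)
  have total: "x \<in> R \<or> inverse x \<in> R" for x
  proof (rule ccontr)
    assume c: "\<not> (x \<in> R \<or> inverse x \<in> R)"
    have x: "x \<noteq> 0" using c D(1) by (auto simp: R_def)
    let ?P = "\<lambda>f y. (\<forall>i. coeff f i \<in> J) \<and> poly f y = 1"
    have "\<exists>f. ?P f x" "\<exists>g. ?P g (inverse x)"
      using c maximal_mult_stable[OF J max] unfolding R_def by blast+
    then obtain f g where f: "?P f x" "\<And>h. ?P h x \<Longrightarrow> degree f \<le> degree h"
      and g: "?P g (inverse x)" "\<And>h. ?P h (inverse x) \<Longrightarrow> degree g \<le> degree h"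
      using ex_has_least_nat[of "\<lambda>f. ?P f x" _ degree]
        ex_has_least_nat[of "\<lambda>f. ?P f (inverse x)" _ degree] by metis
    show False
    proof (cases "degree g \<le> degree f")
      case True
      then show False
        using reduce_degree[OF J m1 max _ _ _ _ True x] f g by (metis linorder_not_less)
    next
      case False
      then show False
        using reduce_degree[OF J m1 max, of g "inverse x" f] f g x
        by (metis inverse_inverse_eq inverse_zero_imp_zero linorder_not_less nat_le_linear)
    qed
  qed
  have unit: "inverse x \<in> R" if x: "x \<in> R" "x \<notin> J" for x
  proof (rule ccontr)
    assume c: "inverse x \<notin> R"
    have x0: "x \<noteq> 0" using x D(1) by auto
    \<comment> \<open>The ideal of \<open>R\<close> generated by \<open>J\<close> and
      \<open>x\<close>. If it contains 1, then \<open>x * r\<close> is 1 minus an element of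
      \<open>J\<close> and \<open>x\<close> has an inverse in \<open>R\<close>; otherwise maximality
      puts \<open>x\<close> into \<open>J\<close>.\<close>
    let ?J' = "{j + x * r | j r. j \<in> J \<and> r \<in> R}"
    have "1 \<notin> ?J'"
    proof
      assume "1 \<in> ?J'"
      then obtain j r where jr: "1 = j + x * r" "j \<in> J" "r \<in> R" by blast
      then have xr: "x * r = 1 - j" by (simp add: algebra_simps)
      have "1 - j \<noteq> 0" using jr(2) D(2) by auto
      then have "inverse x = r * inverse (1 - j)"
        using xr x0 by (simp add: field_simps)
      then show False using c Rmult[OF jr(3) inv1[OF jr(2)]] by simp
    qed
    moreover have "(j + x * r) + (j' + x * r') \<in> ?J'"
      if "j \<in> J" "r \<in> R" "j' \<in> J" "r' \<in> R" for j r j' r'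
    proof -
      have "(j + x * r) + (j' + x * r') = (j + j') + x * (r + r')" by (simp add: algebra_simps)
      then show ?thesis using that D(3) Radd by blast
    qed
    moreover have m: "s * (j + x * r) \<in> ?J'" if "j \<in> J" "r \<in> R" "s \<in> R" for j r s
    proof -
      have "s * (j + x * r) = (s * j) + x * (s * r)" by (simp add: algebra_simps)
      then show ?thesis using that R Rmult by blast
    qed
    moreover have "?J' \<subseteq> R" using JR Radd Rmult x(1) by blast
    moreover have "0 \<in> ?J'" using D(1) JR by (intro CollectI exI[of _ 0]) auto
    ultimately have "mult_stable A ?J'"
      unfolding mult_stable_def using AR by (intro conjI ballI) blast+
    moreover have "J \<subseteq> ?J'"
    proof
      fix j assume "j \<in> J"
      then show "j \<in> ?J'" using D(1) JR by (intro CollectI exI[of _ j] exI[of _ 0]) auto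
    qed
    ultimately have eq: "?J' = J" using max by blast
    have "x \<in> ?J'" using D(1) by (intro CollectI exI[of _ 0] exI[of _ 1]) (auto simp: R_def)
    then show False using eq x(2) by simp
  qed
  have "1 \<in> R" by (simp add: R_def)
  from that[OF sub AR JR this Radd Rmult D(3) R D(2) total unit] show thesis .
qed

section \<open>Ultrametric absolute values\<close>

definition is_subfield :: "'k::field set \<Rightarrow> bool" where
  "is_subfield K \<longleftrightarrow> 0 \<in> K \<and> 1 \<in> K \<and> (\<forall>x\<in>K. \<forall>y\<in>K. x + y \<in> K \<and> x * y \<in> K) \<and>
     (\<forall>x\<in>K. - x \<in> K \<and> inverse x \<in> K)"

lemma is_subfieldI:
  assumes "0 \<in> K" "1 \<in> K" "\<And>x y. x \<in> K \<Longrightarrow> y \<in> K \<Longrightarrow> x + y \<in> K"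
    "\<And>x y. x \<in> K \<Longrightarrow> y \<in> K \<Longrightarrow> x * y \<in> K" "\<And>x. x \<in> K \<Longrightarrow> - x \<in> K"
    "\<And>x. x \<in> K \<Longrightarrow> x \<noteq> 0 \<Longrightarrow> inverse x \<in> K"
  shows "is_subfield K"
  unfolding is_subfield_def using assms by (metis inverse_zero)

lemma is_subfieldD:
  assumes "is_subfield K"
  shows "0 \<in> K" "1 \<in> K" "\<And>x y. x \<in> K \<Longrightarrow> y \<in> K \<Longrightarrow> x + y \<in> K"
    "\<And>x y. x \<in> K \<Longrightarrow> y \<in> K \<Longrightarrow> x * y \<in> K" "\<And>x. x \<in> K \<Longrightarrow> - x \<in> K"
    "\<And>x. x \<in> K \<Longrightarrow> inverse x \<in> K" "\<And>x y. x \<in> K \<Longrightarrow> y \<in> K \<Longrightarrow> x - y \<in> K"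
    "\<And>x y. x \<in> K \<Longrightarrow> y \<in> K \<Longrightarrow> x / y \<in> K" "\<And>x n. x \<in> K \<Longrightarrow> x ^ n \<in> K"
    "\<And>f S. (\<And>i. i \<in> S \<Longrightarrow> f i \<in> K) \<Longrightarrow> sum f S \<in> K"
    "\<And>f S. (\<And>i. i \<in> S \<Longrightarrow> f i \<in> K) \<Longrightarrow> prod f S \<in> K" "\<And>n. of_nat n \<in> K" "\<And>i. of_int i \<in> K"
proof -
  show *: "0 \<in> K" "1 \<in> K" "\<And>x y. x \<in> K \<Longrightarrow> y \<in> K \<Longrightarrow> x + y \<in> K"
    "\<And>x y. x \<in> K \<Longrightarrow> y \<in> K \<Longrightarrow> x * y \<in> K" "\<And>x. x \<in> K \<Longrightarrow> - x \<in> K"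
    "\<And>x. x \<in> K \<Longrightarrow> inverse x \<in> K"
    using assms unfolding is_subfield_def by blast+
  show "x - y \<in> K" if "x \<in> K" "y \<in> K" for x y
    using *(3)[OF that(1) *(5)[OF that(2)]] by simp
  show "x / y \<in> K" if "x \<in> K" "y \<in> K" for x y
    using *(4)[OF that(1) *(6)[OF that(2)]] by (simp add: divide_inverse)
  show "x ^ n \<in> K" if "x \<in> K" for x n
    by (induction n) (auto simp: * that)
  show "sum f S \<in> K" if "\<And>i. i \<in> S \<Longrightarrow> f i \<in> K" for f :: "'b \<Rightarrow> 'a" and S
    using that by (induction S rule: infinite_finite_induct) (auto simp: *)
  show "prod f S \<in> K" if "\<And>i. i \<in> S \<Longrightarrow> f i \<in> K" for f :: "'c \<Rightarrow> 'a" and S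
    using that by (induction S rule: infinite_finite_induct) (auto simp: *)
  show n: "of_nat n \<in> K" for n by (induction n) (auto simp: *)
  show "of_int i \<in> K" for i
    by (cases i rule: int_cases2) (auto simp: n *(5))
qed

lemma is_subfield_UNIV: "is_subfield UNIV" and is_subfield_Rats: "is_subfield \<rat>"
  by (auto intro!: is_subfieldI)

text \<open>Multiplicative form of a real valuation. Nothing is required of \<open>N\<close> outside
  \<open>K\<close>, so the same notion serves for the algebraic closure, for the rational functions
  over the rationals and for those over \<open>Q_p v\<close>.\<close>

locale ultranorm =
  fixes K :: "'k::field set" and N :: "'k \<Rightarrow> real"
  assumes K: "is_subfield K"
    and eq_0_iff: "x \<in> K \<Longrightarrow> N x = 0 \<longleftrightarrow> x = 0"
    and nonneg: "x \<in> K \<Longrightarrow> 0 \<le> N x"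
    and mult: "x \<in> K \<Longrightarrow> y \<in> K \<Longrightarrow> N (x * y) = N x * N y"
    and add: "x \<in> K \<Longrightarrow> y \<in> K \<Longrightarrow> N (x + y) \<le> max (N x) (N y)"
begin

lemmas KD = is_subfieldD[OF K]

lemma zero [simp]: "N 0 = 0"
  using eq_0_iff KD(1) by blast

lemma pos: "x \<in> K \<Longrightarrow> x \<noteq> 0 \<Longrightarrow> 0 < N x"
  using nonneg[of x] eq_0_iff[of x] by linarith

lemma one [simp]: "N 1 = 1"
  using mult[OF KD(2) KD(2)] pos[OF KD(2)] by simp

lemma minus [simp]:
  assumes "x \<in> K" shows "N (- x) = N x"
proof -
  have "N (-1) * N (-1) = 1" using mult[OF KD(5)[OF KD(2)] KD(5)[OF KD(2)]] by simp
  then have "(N (-1) - 1) * (N (-1) + 1) = 0" by (simp add: algebra_simps)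
  moreover have "N (-1) \<ge> 0" using nonneg KD(2,5) by blast
  ultimately have "N (-1) = 1" by simp
  then show ?thesis using mult[OF KD(5)[OF KD(2)] assms] by simp
qed

lemma diff: "x \<in> K \<Longrightarrow> y \<in> K \<Longrightarrow> N (x - y) \<le> max (N x) (N y)"
  using add[of x "- y"] KD(5)[of y] by simp

lemma diff_commute: "x \<in> K \<Longrightarrow> y \<in> K \<Longrightarrow> N (x - y) = N (y - x)"
  using minus[of "x - y"] KD(7)[of x y] by simp

lemma inverse: "x \<in> K \<Longrightarrow> N (inverse x) = inverse (N x)"
  using mult[of x "Fields.inverse x"] KD(6)[of x] pos[of x]
  by (cases "x = 0") (auto simp: field_simps)

lemma divide: "x \<in> K \<Longrightarrow> y \<in> K \<Longrightarrow> N (x / y) = N x / N y"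
  using mult[of x "Fields.inverse y"] KD(6)[of y] inverse[of y] by (simp add: divide_inverse)

lemma power: "x \<in> K \<Longrightarrow> N (x ^ n) = N x ^ n"
  by (induction n) (auto simp: mult KD(9))

lemma add_eq:
  assumes "x \<in> K" "y \<in> K" "N y < N x"
  shows "N (x + y) = N x"
proof -
  have "N ((x + y) - y) \<le> max (N (x + y)) (N y)" by (rule diff) (use assms KD(3) in auto)
  then have "N x \<le> N (x + y)" using assms(3) by (simp add: max_def split: if_splits)
  then show ?thesis using add[OF assms(1,2)] assms(3) by simp
qed

lemma diff_eq: "x \<in> K \<Longrightarrow> y \<in> K \<Longrightarrow> N y < N x \<Longrightarrow> N (x - y) = N x"
  using add_eq[of x "- y"] KD(5)[of y] by simp

text \<open>The isosceles principle. Nearly every transfer of a norm from an element to an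
  approximation of it rests on this.\<close>

lemma close_eq:
  assumes "x \<in> K" "y \<in> K" "N (x - y) < N x"
  shows "N y = N x"
  using diff_eq[of x "x - y"] assms KD(7) by simp

lemma close_eq':
  assumes "x \<in> K" "y \<in> K" "N (x - y) < N y"
  shows "N y = N x"
  using close_eq[of y x] assms diff_commute by simp

lemma sum_le:
  assumes "\<And>i. i \<in> S \<Longrightarrow> f i \<in> K" "\<And>i. i \<in> S \<Longrightarrow> N (f i) \<le> B" "0 \<le> B"
  shows "N (sum f S) \<le> B"
  using assms(1,2)
proof (induction S rule: infinite_finite_induct)
  case (insert x S)
  then have "N (f x + sum f S) \<le> max (N (f x)) (N (sum f S))"
    by (intro add KD(10)) auto
  also have "\<dots> \<le> B" using insert by auto
  finally show ?case using insert by simp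
qed (auto simp: assms(3))

lemma sum_less:
  assumes "\<And>i. i \<in> S \<Longrightarrow> f i \<in> K" "\<And>i. i \<in> S \<Longrightarrow> N (f i) < B" "0 < B"
  shows "N (sum f S) < B"
  using assms(1,2)
proof (induction S rule: infinite_finite_induct)
  case (insert x S)
  then have "N (f x + sum f S) \<le> max (N (f x)) (N (sum f S))"
    by (intro add KD(10)) auto
  also have "\<dots> < B" using insert by auto
  finally show ?case using insert by simp
qed (auto simp: assms(3))

lemma of_int_le_1: "N (of_int i) \<le> 1"
proof -
  have n: "N (of_nat n) \<le> 1" for n
  proof (induction n)
    case (Suc n)
    have "N (1 + of_nat n) \<le> max (N 1) (N (of_nat n))" by (rule add) (auto simp: KD)
    then show ?case using Suc by simp
  qed auto
  show ?thesis by (cases i rule: int_cases2) (auto simp: n KD)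
qed

end

text \<open>The case \<open>x = 0\<close> has to be separate: \<open>real_of_ereal\<close> sends
  \<infinity> to 0, which would give 0 the norm 1. With this base the prime \<open>p\<close> has
  norm \<open>exp (-1)\<close>.\<close>

definition nrm :: "('k::field \<Rightarrow> ereal) \<Rightarrow> 'k \<Rightarrow> real" where
  "nrm v x = (if x = 0 then 0 else exp (- real_of_ereal (v x)))"

lemma nrm_ultranorm:
  assumes K: "is_subfield K" and v: "valuation_on K v"
  shows "ultranorm K (nrm v)"
proof
  note D = is_subfieldD[OF K]
  have real: "\<exists>r. v x = ereal r" if "x \<in> K" "x \<noteq> 0" for x
    using v that unfolding valuation_on_def by (cases "v x") auto
  have vm: "v (x * y) = v x + v y" "v (x + y) \<ge> min (v x) (v y)" if "x \<in> K" "y \<in> K" for x y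
    using v that unfolding valuation_on_def by auto
  show "is_subfield K" by fact
  fix x assume x: "x \<in> K"
  show "nrm v x = 0 \<longleftrightarrow> x = 0" "0 \<le> nrm v x" by (auto simp: nrm_def)
  fix y assume y: "y \<in> K"
  show "nrm v (x * y) = nrm v x * nrm v y"
  proof (cases "x = 0 \<or> y = 0")
    case False
    then obtain a b where "v x = ereal a" "v y = ereal b" using real x y by blast
    then show ?thesis using False vm(1)[OF x y] by (simp add: nrm_def exp_add[symmetric])
  qed (auto simp: nrm_def)
  show "nrm v (x + y) \<le> max (nrm v x) (nrm v y)"
  proof (cases "x = 0 \<or> y = 0 \<or> x + y = 0")
    case False
    then obtain a b c where abc: "v x = ereal a" "v y = ereal b" "v (x + y) = ereal c"
      using real x y D(3) by meson
    then have "min a b \<le> c" using vm(2)[OF x y] by (simp add: min_def split: if_splits)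
    then show ?thesis using False abc by (auto simp: nrm_def min_def max_def split: if_splits)
  qed (auto simp: nrm_def le_max_iff_disj)
qed

lemma valuation_nrm:
  assumes v: "valuation_on K v" and x: "x \<in> K"
  shows "v x \<ge> ereal r \<longleftrightarrow> nrm v x \<le> exp (- r)" "v x > ereal r \<longleftrightarrow> nrm v x < exp (- r)"
    "v x = ereal r \<longleftrightarrow> nrm v x = exp (- r)"
    "v x \<ge> 0 \<longleftrightarrow> nrm v x \<le> 1"
proof -
  have inf: "v x \<noteq> - \<infinity>" "v x = \<infinity> \<longleftrightarrow> x = 0" using v x unfolding valuation_on_def by auto
  show *: "v x \<ge> ereal r \<longleftrightarrow> nrm v x \<le> exp (- r)" "v x > ereal r \<longleftrightarrow> nrm v x < exp (- r)"
    "v x = ereal r \<longleftrightarrow> nrm v x = exp (- r)" for r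
    using inf by (cases "v x"; auto simp: nrm_def)+
  show "v x \<ge> 0 \<longleftrightarrow> nrm v x \<le> 1" using *(1)[of 0] by (simp add: zero_ereal_def)
qed

lemma valuation_nrm2:
  assumes v: "valuation_on K v" and x: "x \<in> K" and y: "y \<in> K"
  shows "v x < v y \<longleftrightarrow> nrm v y < nrm v x" "v x = v y \<longleftrightarrow> nrm v x = nrm v y"
proof -
  have inf: "v x \<noteq> - \<infinity>" "v x = \<infinity> \<longleftrightarrow> x = 0" "v y \<noteq> - \<infinity>" "v y = \<infinity> \<longleftrightarrow> y = 0"
    using v x y unfolding valuation_on_def by auto
  show "v x < v y \<longleftrightarrow> nrm v y < nrm v x" "v x = v y \<longleftrightarrow> nrm v x = nrm v y"
    using inf by (cases "v x"; cases "v y"; auto simp: nrm_def)+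
qed

section \<open>Rational functions over a subfield\<close>

definition polys :: "'c::zero set \<Rightarrow> 'c poly set" where
  "polys F = {f. \<forall>i. coeff f i \<in> F}"

lemma polysI: "(\<And>i. coeff f i \<in> F) \<Longrightarrow> f \<in> polys F"
  and polysD: "f \<in> polys F \<Longrightarrow> coeff f i \<in> F"
  by (auto simp: polys_def)

lemma coeffs_subset_iff: "0 \<in> F \<Longrightarrow> set (coeffs f) \<subseteq> F \<longleftrightarrow> f \<in> polys F"
  using forall_coeffs_conv[of "\<lambda>x. x \<in> F" f] by (auto simp: polys_def)

lemma polys_closed:
  assumes F: "is_subfield F"
  shows "0 \<in> polys F" "1 \<in> polys F" "\<And>f g. f \<in> polys F \<Longrightarrow> g \<in> polys F \<Longrightarrow> f + g \<in> polys F"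
    "\<And>f g. f \<in> polys F \<Longrightarrow> g \<in> polys F \<Longrightarrow> f * g \<in> polys F" "\<And>f. f \<in> polys F \<Longrightarrow> - f \<in> polys F"
    "\<And>f g. f \<in> polys F \<Longrightarrow> g \<in> polys F \<Longrightarrow> f - g \<in> polys F"
    "\<And>c f. c \<in> F \<Longrightarrow> f \<in> polys F \<Longrightarrow> smult c f \<in> polys F" "\<And>c f. c \<in> F \<Longrightarrow> f \<in> polys F \<Longrightarrow> pCons c f \<in> polys F"
    "\<And>c n. c \<in> F \<Longrightarrow> monom c n \<in> polys F" "\<And>f n. f \<in> polys F \<Longrightarrow> f ^ n \<in> polys F"
    "\<And>f S. (\<And>i. i \<in> S \<Longrightarrow> f i \<in> polys F) \<Longrightarrow> sum f S \<in> polys F"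
    "\<And>f S. (\<And>i. i \<in> S \<Longrightarrow> f i \<in> polys F) \<Longrightarrow> prod f S \<in> polys F"
    "\<And>f g. f \<in> polys F \<Longrightarrow> g \<in> polys F \<Longrightarrow> pcompose f g \<in> polys F"
    "\<And>f x. f \<in> polys F \<Longrightarrow> x \<in> F \<Longrightarrow> poly f x \<in> F"
proof -
  note D = is_subfieldD[OF F]
  show *: "0 \<in> polys F" "1 \<in> polys F" "\<And>f g. f \<in> polys F \<Longrightarrow> g \<in> polys F \<Longrightarrow> f + g \<in> polys F"
    "\<And>f. f \<in> polys F \<Longrightarrow> - f \<in> polys F" "\<And>f g. f \<in> polys F \<Longrightarrow> g \<in> polys F \<Longrightarrow> f - g \<in> polys F"
    "\<And>c f. c \<in> F \<Longrightarrow> f \<in> polys F \<Longrightarrow> smult c f \<in> polys F" "\<And>c f. c \<in> F \<Longrightarrow> f \<in> polys F \<Longrightarrow> pCons c f \<in> polys F"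
    "\<And>c n. c \<in> F \<Longrightarrow> monom c n \<in> polys F"
    unfolding polys_def using D by (auto simp: coeff_pCons split: nat.splits)
  show m: "f * g \<in> polys F" if "f \<in> polys F" "g \<in> polys F" for f g
    by (rule polysI) (auto simp: coeff_mult intro!: D(10) D(4) polysD that)
  show "f ^ n \<in> polys F" if "f \<in> polys F" for f n
    by (induction n) (auto simp: * m that)
  show "sum f S \<in> polys F" if "\<And>i. i \<in> S \<Longrightarrow> f i \<in> polys F" for f :: "'b \<Rightarrow> 'a poly" and S
    using that by (induction S rule: infinite_finite_induct) (auto simp: *)
  show "prod f S \<in> polys F" if "\<And>i. i \<in> S \<Longrightarrow> f i \<in> polys F" for f :: "'c \<Rightarrow> 'a poly" and S
    using that by (induction S rule: infinite_finite_induct) (auto simp: * m)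
  have pc: "a \<in> F \<and> q \<in> polys F" if "pCons a q \<in> polys F" for a q
    using polysD[OF that, of 0] polysD[OF that, of "Suc i" for i] by (auto intro: polysI)
  show "pcompose f g \<in> polys F" if "f \<in> polys F" "g \<in> polys F" for f g
    using that(1)
  proof (induction f)
    case (pCons a f)
    then show ?case using pc[OF pCons.prems] by (auto simp: pcompose_pCons intro!: * m that)
  qed (auto simp: *)
  show "poly f x \<in> F" if "f \<in> polys F" "x \<in> F" for f x
    using that(1)
  proof (induction f)
    case (pCons a f)
    then show ?case using pc[OF pCons.prems] by (auto intro!: D that)
  qed (auto simp: D)
qed

lemma Fract_to_fract: "Fract f g = to_fract f / to_fract g"
  by (simp add: to_fract_def)

lemma const_fun_to_fract: "const_fun c = to_fract [:c:]"
  by (simp add: const_fun_def to_fract_def)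

lemma const_fun_simps [simp]:
  "const_fun 0 = 0" "const_fun 1 = 1" "const_fun (a + b) = const_fun a + const_fun b"
  "const_fun (a - b) = const_fun a - const_fun b" "const_fun (- a) = - const_fun a"
  "const_fun (a * b) = const_fun a * const_fun b" "const_fun a = const_fun b \<longleftrightarrow> a = b"
  "const_fun a = 0 \<longleftrightarrow> a = 0"
  unfolding const_fun_to_fract
  by (simp_all flip: to_fract_add to_fract_diff to_fract_mult to_fract_uminus one_pCons)

lemma const_fun_power: "const_fun (a ^ n) = const_fun a ^ n"
  by (induction n) auto

lemma const_fun_inverse: "const_fun (inverse a) = inverse (const_fun a)"
proof (cases "a = 0")
  case False
  then have "const_fun (inverse a) * const_fun a = 1"
    by (simp flip: const_fun_simps(6))
  then show ?thesis by (metis inverse_unique inverse_inverse_eq)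
qed auto

lemma const_fun_divide: "const_fun (a / b) = const_fun a / const_fun b"
  by (simp add: divide_inverse const_fun_inverse)

lemma to_fract_power: "to_fract (a ^ n) = to_fract a ^ n"
  by (induction n) auto

lemma to_fract_sum: "to_fract (sum f S) = (\<Sum>i\<in>S. to_fract (f i))"
  by (induction S rule: infinite_finite_induct) auto

lemma to_fract_smult: "to_fract (smult c f) = const_fun c * to_fract f"
  by (simp add: const_fun_to_fract flip: to_fract_mult)

lemma rat_funs_iff:
  assumes "is_subfield F"
  shows "\<phi> \<in> rat_funs F \<longleftrightarrow> (\<exists>f\<in>polys F. \<exists>g\<in>polys F. g \<noteq> 0 \<and> \<phi> = to_fract f / to_fract g)"
  using is_subfieldD(1)[OF assms]
  by (auto simp: rat_funs_def coeffs_subset_iff Fract_to_fract)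

lemma rat_funs_subfield:
  assumes F: "is_subfield F"
  shows "is_subfield (rat_funs F)"
proof -
  note P = polys_closed[OF F] and iff = rat_funs_iff[OF F]
  show ?thesis
  proof (rule is_subfieldI)
    show "0 \<in> rat_funs F" unfolding iff using P(1,2) by (intro bexI[of _ 0] bexI[of _ 1]) auto
    show "1 \<in> rat_funs F" unfolding iff using P(2) by (intro bexI[of _ 1]) auto
    fix x assume "x \<in> rat_funs F"
    then obtain f g where x: "f \<in> polys F" "g \<in> polys F" "g \<noteq> 0" "x = to_fract f / to_fract g"
      using iff by blast
    show "- x \<in> rat_funs F" unfolding iff
      using x P(5) by (intro bexI[of _ "- f"] bexI[of _ g]) auto
    show "inverse x \<in> rat_funs F" if "x \<noteq> 0" unfolding iff
      using x that by (intro bexI[of _ g] bexI[of _ f]) auto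
    fix y assume "y \<in> rat_funs F"
    then obtain h k where y: "h \<in> polys F" "k \<in> polys F" "k \<noteq> 0" "y = to_fract h / to_fract k"
      using iff by blast
    show "x + y \<in> rat_funs F" unfolding iff
      using x y P(3,4) by (intro bexI[of _ "f * k + h * g"] bexI[of _ "g * k"]) (auto simp: field_simps)
    show "x * y \<in> rat_funs F" unfolding iff
      using x y P(3,4) by (intro bexI[of _ "f * h"] bexI[of _ "g * k"]) auto
  qed
qed

lemma to_fract_in_rat_funs: "is_subfield F \<Longrightarrow> f \<in> polys F \<Longrightarrow> to_fract f \<in> rat_funs F"
  unfolding rat_funs_iff using polys_closed(2) by (intro bexI[of _ f] bexI[of _ 1]) auto

lemma const_fun_in_rat_funs: "is_subfield F \<Longrightarrow> c \<in> F \<Longrightarrow> const_fun c \<in> rat_funs F"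
  unfolding const_fun_to_fract
  by (intro to_fract_in_rat_funs) (auto intro: polys_closed)

lemma const_QX: "c \<in> \<rat> \<Longrightarrow> const_fun c \<in> rat_funs \<rat>"
  by (rule const_fun_in_rat_funs[OF is_subfield_Rats])

lemma to_fract_QX: "f \<in> polys \<rat> \<Longrightarrow> to_fract f \<in> rat_funs \<rat>"
  by (rule to_fract_in_rat_funs[OF is_subfield_Rats])

lemma common_denominator:
  assumes F: "is_subfield F" and S: "finite S" and b: "\<And>i. i \<in> S \<Longrightarrow> b i \<in> rat_funs F"
  shows "\<exists>g\<in>polys F. \<exists>h. g \<noteq> 0 \<and> (\<forall>i\<in>S. h i \<in> polys F \<and> b i * to_fract g = to_fract (h i))"
  using S b
proof (induction S rule: finite_induct)
  case empty
  then show ?case using polys_closed(2)[OF F] by (intro bexI[of _ 1]) auto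
next
  case (insert x S)
  then obtain g h where gh: "g \<in> polys F" "g \<noteq> 0" "\<And>i. i \<in> S \<Longrightarrow> h i \<in> polys F"
    "\<And>i. i \<in> S \<Longrightarrow> b i * to_fract g = to_fract (h i)" by auto
  obtain k l where kl: "k \<in> polys F" "l \<in> polys F" "l \<noteq> 0" "b x = to_fract k / to_fract l"
    using insert.prems[of x] rat_funs_iff[OF F] by auto
  have "b i * to_fract (g * l) = to_fract (if i = x then k * g else h i * l)" if "i \<in> insert x S" for i
  proof (cases "i = x")
    case True
    then show ?thesis using kl by simp
  next
    case False
    then show ?thesis using gh(4)[of i] that by (simp flip: mult.assoc)
  qed
  moreover have "g * l \<in> polys F" "g * l \<noteq> 0"
    "\<And>i. i \<in> insert x S \<Longrightarrow> (if i = x then k * g else h i * l) \<in> polys F"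
    using gh kl by (auto intro: polys_closed[OF F])
  ultimately show ?case
    by (intro bexI[of _ "g * l"] exI[of _ "\<lambda>i. if i = x then k * g else h i * l"]) auto
qed

lemma coeff_of_sum_smult: "coeff (\<Sum>i\<in>S. smult (a i) (h i)) k = (\<Sum>i\<in>S. a i * coeff (h i) k)"
  by (simp add: coeff_sum)

text \<open>The fields \<open>'c\<close> and \<open>rat_funs \<rat>\<close> are linearly disjoint
  over the rationals: after clearing denominators, comparing the coefficients of a fixed power of
  \<open>X\<close> turns the relation into a rational relation between the
  \<open>a i\<close>.\<close>

lemma linearly_disjoint:
  fixes a :: "'i \<Rightarrow> 'c::field_char_0"
  assumes S: "finite S" and b: "\<And>i. i \<in> S \<Longrightarrow> b i \<in> rat_funs \<rat>"
    and indep: "\<And>q :: 'i \<Rightarrow> rat. (\<Sum>i\<in>S. of_rat (q i) * a i) = 0 \<Longrightarrow> \<forall>i\<in>S. q i = 0"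
    and sum: "(\<Sum>i\<in>S. const_fun (a i) * b i) = 0" and i: "i \<in> S"
  shows "b i = 0"
proof -
  obtain g h where gh: "g \<noteq> 0" "\<And>i. i \<in> S \<Longrightarrow> h i \<in> polys \<rat>"
    "\<And>i. i \<in> S \<Longrightarrow> b i * to_fract g = to_fract (h i)"
    using common_denominator[OF is_subfield_Rats S, of b] b by metis
  have "to_fract (\<Sum>i\<in>S. smult (a i) (h i)) = (\<Sum>i\<in>S. const_fun (a i) * to_fract (h i))"
    by (simp add: to_fract_sum to_fract_smult)
  also have "\<dots> = (\<Sum>i\<in>S. const_fun (a i) * b i * to_fract g)"
    using gh(3) by (intro sum.cong) (auto simp: mult.assoc)
  also have "\<dots> = 0" using sum by (simp flip: sum_distrib_right)
  finally have 0: "(\<Sum>i\<in>S. smult (a i) (h i)) = 0" by (simp only: to_fract_eq_0_iff)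
  have "coeff (h i) k = 0" for k
  proof -
    have "\<exists>q. of_rat q = coeff (h i) k" if "i \<in> S" for i
      using polysD[OF gh(2)[OF that], of k] by (auto elim: Rats_cases)
    then obtain q where q: "\<And>i. i \<in> S \<Longrightarrow> of_rat (q i) = coeff (h i) k" by metis
    have "(\<Sum>i\<in>S. of_rat (q i) * a i) = coeff (\<Sum>i\<in>S. smult (a i) (h i)) k"
      unfolding coeff_of_sum_smult by (intro sum.cong) (auto simp: q)
    then show ?thesis using indep 0 q i by (metis coeff_0 of_rat_0)
  qed
  then have "h i = 0" by (simp add: poly_eqI)
  then show ?thesis using gh i by (metis mult_eq_0_iff to_fract_eq_0_iff)
qed

section \<open>Approximation by points of the algebraic closure\<close>

text \<open>All that the construction of the sequence uses of \<open>W\<close>. The assumption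
  \<open>resid_alg\<close> expresses algebraicity of the residue of \<psi>. A constant coefficient
  of norm one can be had because this residue is nonzero, and it keeps the equation from holding
  where \<psi> vanishes.\<close>

locale rat_ext = N: ultranorm UNIV N + w: ultranorm "rat_funs \<rat>" w
  for N :: "'c::{alg_closed_field,field_char_0} \<Rightarrow> real" and w :: "'c poly fract \<Rightarrow> real" +
  fixes p :: nat
  assumes w_const: "w (const_fun (of_rat q)) = N (of_rat q)"
    and p: "0 < N (of_nat p)" "N (of_nat p) < 1"
    and torsion: "\<phi> \<in> rat_funs \<rat> \<Longrightarrow> \<phi> \<noteq> 0 \<Longrightarrow> \<exists>n>0. \<exists>k. w \<phi> ^ n = N (of_nat p) powi k"
    and resid_alg: "\<psi> \<in> polys \<rat> \<Longrightarrow> w (to_fract \<psi>) = 1 \<Longrightarrow>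
      \<exists>h\<in>polys \<rat>. N (coeff h 0) = 1 \<and> w (to_fract (pcompose h \<psi>)) < 1"
begin

lemma w_Rats: "c \<in> \<rat> \<Longrightarrow> w (const_fun c) = N c"
  using w_const by (auto elim: Rats_cases)

text \<open>
  The tensor product of the two valuation rings over the rationals has a proper ideal containing
  both maximal ideals: a rational relation between the \<open>a i\<close> always allows to eliminate a term
  without losing the term of norm one.
\<close>

lemma sum_nonzero:
  fixes a :: "'i \<Rightarrow> 'c"
  assumes "finite S" "i0 \<in> S" "N (a i0) = 1" "w (b i0) = 1"
    and "\<And>i. i \<in> S \<Longrightarrow> b i \<in> rat_funs \<rat>"
    and "\<And>i. i \<in> S \<Longrightarrow> i \<noteq> i0 \<Longrightarrow> N (a i) \<le> 1 \<and> w (b i) \<le> 1 \<and> (N (a i) < 1 \<or> w (b i) < 1)"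
  shows "(\<Sum>i\<in>S. const_fun (a i) * b i) \<noteq> 0"
  using assms
proof (induction "card S" arbitrary: S b rule: less_induct)
  case less
  note S = less.prems
  show ?case
  proof
    assume sum0: "(\<Sum>i\<in>S. const_fun (a i) * b i) = 0"
    show False
    proof (cases "\<forall>q :: 'i \<Rightarrow> rat. (\<Sum>i\<in>S. of_rat (q i) * a i) = 0 \<longrightarrow> (\<forall>i\<in>S. q i = 0)")
      case True
      then have "b i0 = 0"
        using linearly_disjoint[OF S(1), of b a i0] S(2,5) sum0 by blast
      then show False using S(4) by simp
    next
      case False
      then obtain q0 :: "'i \<Rightarrow> rat" and i1 where q0: "(\<Sum>i\<in>S. of_rat (q0 i) * a i) = 0" "i1 \<in> S" "q0 i1 \<noteq> 0"
        by blast
      \<comment> \<open>Dividing the relation by a coefficient of largest norm makes all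
        coefficients integral and one of them 1.\<close>
      define nq where "nq = (\<lambda>i. N (of_rat (q0 i)))"
      have "Max (nq ` S) \<in> nq ` S" using S(1) q0(2) by (intro Max_in) auto
      then obtain m where m: "m \<in> S" "nq m = Max (nq ` S)" by force
      have m: "m \<in> S" "\<And>i. i \<in> S \<Longrightarrow> nq i \<le> nq m"
        using m S(1) by auto
      have nq0: "nq m > 0"
        using m(2)[OF q0(2)] N.pos[of "of_rat (q0 i1)"] q0(3) by (simp add: nq_def)
      then have qm: "q0 m \<noteq> 0" unfolding nq_def by auto
      define q :: "'i \<Rightarrow> 'c" where "q = (\<lambda>i. of_rat (q0 i / q0 m))"
      have qR: "q i \<in> \<rat>" for i by (simp add: q_def)
      have qN: "N (q i) = nq i / nq m" for i
        by (simp add: q_def nq_def of_rat_divide N.divide)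
      have q1: "N (q i) \<le> 1" if "i \<in> S" for i
        unfolding qN using m(2)[OF that] nq0 by simp
      have qm1: "q m = 1" using qm by (simp add: q_def)
      have qsum: "(\<Sum>i\<in>S. q i * a i) = 0"
      proof -
        have "(\<Sum>i\<in>S. q i * a i) = (\<Sum>i\<in>S. of_rat (q0 i) * a i) / of_rat (q0 m)"
          unfolding q_def by (simp add: sum_divide_distrib of_rat_divide)
        then show ?thesis using q0 by simp
      qed
      have a1: "N (a i) \<le> 1" if "i \<in> S" for i
        using S(3) S(6)[OF that] by (cases "i = i0") auto
      have b1: "w (b i) \<le> 1" if "i \<in> S" for i
        using S(4) S(6)[OF that] by (cases "i = i0") auto
      \<comment> \<open>The term to eliminate. Its coefficient must have norm one, it must not be
        \<open>i0\<close>, and subtracting multiples of \<open>b j\<close> must not spoil a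
        \<open>b i\<close> whose \<open>a i\<close> has norm one; \<open>small\<close> records the
        last demand. If some other \<open>a j\<close> and its coefficient both have norm one, then
        \<open>w (b j) < 1\<close> by hypothesis. Otherwise all other terms of the relation are
        small, which makes the coefficient of \<open>i0\<close> small as well, and the term with
        coefficient 1 will do.\<close>
      obtain j where j: "j \<in> S" "j \<noteq> i0" "N (q j) = 1"
        and small: "\<And>i. i \<in> S \<Longrightarrow> N (a i) = 1 \<Longrightarrow> N (q i) < 1 \<or> w (b j) < 1"
      proof (cases "\<exists>j\<in>S - {i0}. N (q j) = 1 \<and> N (a j) = 1")
        case True
        then show thesis using that S(6) by force
      next
        case no: False
        have le: "N (q i * a i) < 1" if "i \<in> S - {i0}" for i
        proof -
          have "N (q i) < 1 \<or> N (a i) < 1" using no that q1[of i] a1[of i] by force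
          then have "N (q i) * N (a i) < 1"
            using q1[of i] a1[of i] that N.nonneg[of "q i"] N.nonneg[of "a i"]
            by (metis DiffD1 UNIV_I less_eq_real_def mult_le_one mult_less_cancel_left2
                mult_less_cancel_right2 mult_zero_left mult_zero_right not_less zero_less_one)
          then show ?thesis by (simp add: N.mult)
        qed
        have "q i0 * a i0 = - (\<Sum>i\<in>S - {i0}. q i * a i)"
          using qsum S(1,2) by (simp add: sum.remove[of S i0] eq_neg_iff_add_eq_0)
        then have "N (q i0 * a i0) = N (\<Sum>i\<in>S - {i0}. q i * a i)" by simp
        also have "\<dots> < 1" by (rule N.sum_less) (use le in auto)
        finally have i0: "N (q i0) < 1" using S(3) by (simp add: N.mult)
        then have "m \<noteq> i0" using qm1 by auto
        moreover have "N (q i) < 1" if "i \<in> S" "N (a i) = 1" for i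
          using that no q1[of i] i0 by force
        ultimately show thesis using that[of m] m qm1 by auto
      qed
      define c where "c = (\<lambda>i. q i / q j)"
      have qj: "q j \<noteq> 0" using j(3) by auto
      have cR: "c i \<in> \<rat>" for i unfolding c_def using qR by auto
      have cN: "N (c i) = N (q i)" for i unfolding c_def using j(3) by (simp add: N.divide)
      have cN1: "N (c i) \<le> 1" if "i \<in> S" for i using cN q1 that by simp
      \<comment> \<open>These are the coefficients that appear when \<open>a j\<close>, expressed by
        the other \<open>a i\<close>, is substituted into the sum.\<close>
      define b' where "b' = (\<lambda>i. b i - const_fun (c i) * b j)"
      have cb: "const_fun (c i) * b j \<in> rat_funs \<rat>" for i
        using w.KD(4) const_QX[OF cR] S(5)[OF j(1)] by blast
      have b'QX: "b' i \<in> rat_funs \<rat>" if "i \<in> S" for i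
        unfolding b'_def using w.KD(7) S(5)[OF that] cb by blast
      have cbw: "w (const_fun (c i) * b j) = N (c i) * w (b j)" for i
        using w.mult[OF const_QX[OF cR] S(5)[OF j(1)]] w_Rats[OF cR] by simp
      have cb1: "w (const_fun (c i) * b j) \<le> 1" if "i \<in> S" for i
        unfolding cbw using cN1[OF that] b1[OF j(1)] w.nonneg[OF S(5)[OF j(1)]] N.nonneg
        by (intro mult_le_one) auto
      have cb2: "w (const_fun (c i) * b j) < 1" if "i \<in> S" "N (a i) = 1" for i
      proof -
        have "N (c i) < 1 \<or> w (b j) < 1" using small[OF that] cN by simp
        then show ?thesis
          unfolding cbw
          using cN1[OF that(1)] b1[OF j(1)] w.nonneg[OF S(5)[OF j(1)]] N.nonneg[of "c i"]
          by (metis UNIV_I less_eq_real_def mult_le_one mult_less_cancel_left2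
              mult_less_cancel_right2 mult_zero_left mult_zero_right not_less zero_less_one)
      qed
      have "(\<Sum>i\<in>S - {j}. const_fun (a i) * b' i) \<noteq> 0"
      proof (rule less.hyps)
        show "card (S - {j}) < card S" using S(1) j(1) by (rule card_Diff1_less)
        show "finite (S - {j})" "i0 \<in> S - {j}" "N (a i0) = 1" using S j by auto
        show "w (b' i0) = 1"
          unfolding b'_def
          using w.diff_eq[OF S(5)[OF S(2)] cb[of i0]] cb2[OF S(2,3)] S(4) by simp
        show "b' i \<in> rat_funs \<rat>" if "i \<in> S - {j}" for i using b'QX that by auto
        show "N (a i) \<le> 1 \<and> w (b' i) \<le> 1 \<and> (N (a i) < 1 \<or> w (b' i) < 1)"
          if "i \<in> S - {j}" "i \<noteq> i0" for i
        proof -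
          have i: "i \<in> S" using that by auto
          have d: "w (b' i) \<le> max (w (b i)) (w (const_fun (c i) * b j))"
            unfolding b'_def by (rule w.diff[OF S(5)[OF i] cb])
          show ?thesis
            using d a1[OF i] b1[OF i] cb1[OF i] cb2[OF i] S(6)[OF i that(2)] by force
        qed
      qed
      moreover have "(\<Sum>i\<in>S - {j}. const_fun (a i) * b' i) = 0"
      proof -
        have aj: "a j = - (\<Sum>i\<in>S - {j}. c i * a i)"
        proof -
          have "q j * a j = - (\<Sum>i\<in>S - {j}. q i * a i)"
            using qsum S(1) j(1) by (simp add: sum.remove[of S j] eq_neg_iff_add_eq_0)
          then have "a j = - (\<Sum>i\<in>S - {j}. q i * a i) / q j" using qj by (simp add: field_simps)
          then show ?thesis unfolding c_def by (simp add: sum_divide_distrib)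
        qed
        have c_sum: "const_fun (sum f T) = (\<Sum>i\<in>T. const_fun (f i))" for f :: "'i \<Rightarrow> 'c" and T
          by (induction T rule: infinite_finite_induct) auto
        have "(\<Sum>i\<in>S - {j}. const_fun (a i) * b' i) =
            (\<Sum>i\<in>S - {j}. const_fun (a i) * b i) - (\<Sum>i\<in>S - {j}. const_fun (c i * a i)) * b j"
          unfolding b'_def by (simp add: algebra_simps sum_subtractf sum_distrib_left)
        also have "(\<Sum>i\<in>S - {j}. const_fun (c i * a i)) = - const_fun (a j)"
          unfolding aj const_fun_simps(5) c_sum by simp
        finally show ?thesis
          using sum0 S(1) j(1) by (simp add: sum.remove[of S j] add.commute)
      qed
      ultimately show False by simp
    qed
  qed
qed

text \<open>The ideal generated by both maximal ideals in the ring generated by the two valuation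
  rings. Adding one product at a time turns the closure properties into inductions.\<close>

inductive_set pos_ideal :: "'c poly fract set" where
  zero: "0 \<in> pos_ideal"
| add: "x \<in> pos_ideal \<Longrightarrow> N a \<le> 1 \<Longrightarrow> b \<in> rat_funs \<rat> \<Longrightarrow> w b \<le> 1 \<Longrightarrow> N a < 1 \<or> w b < 1 \<Longrightarrow>
    const_fun a * b + x \<in> pos_ideal"

lemma pos_ideal_sum:
  assumes "x \<in> pos_ideal"
  shows "\<exists>(n::nat) a b. x = (\<Sum>i<n. const_fun (a i) * b i) \<and>
    (\<forall>i<n. N (a i) \<le> 1 \<and> b i \<in> rat_funs \<rat> \<and> w (b i) \<le> 1 \<and> (N (a i) < 1 \<or> w (b i) < 1))"
  using assms
proof induction
  case zero
  then show ?case by (intro exI[of _ 0]) auto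
next
  case (add x a b)
  then obtain n :: nat and a' b' where x: "x = (\<Sum>i<n. const_fun (a' i) * b' i)"
    "\<And>i. i < n \<Longrightarrow> N (a' i) \<le> 1 \<and> b' i \<in> rat_funs \<rat> \<and> w (b' i) \<le> 1 \<and> (N (a' i) < 1 \<or> w (b' i) < 1)"
    by auto
  have "const_fun a * b + x = (\<Sum>i<Suc n. const_fun ((a'(n := a)) i) * (b'(n := b)) i)"
    unfolding x(1) by (simp add: add.commute)
  then show ?case
    using x(2) add by (intro exI[of _ "Suc n"] exI[of _ "a'(n := a)"] exI[of _ "b'(n := b)"])
      (auto simp: less_Suc_eq)
qed

lemma pos_ideal_stable:
  "mult_stable ({const_fun a | a. N a \<le> 1} \<union> {\<phi> \<in> rat_funs \<rat>. w \<phi> \<le> 1}) pos_ideal"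
  unfolding mult_stable_def
proof (intro conjI ballI)
  show "0 \<in> pos_ideal" by (rule pos_ideal.zero)
  show add: "x + y \<in> pos_ideal" if "x \<in> pos_ideal" "y \<in> pos_ideal" for x y
    using that(1)
  proof induction
    case (add x a b)
    then show ?case using pos_ideal.add[of "x + y" a b] by (simp add: add.assoc)
  qed (simp add: that)
  have trm: "const_fun a * b \<in> pos_ideal"
    if "N a \<le> 1" "b \<in> rat_funs \<rat>" "w b \<le> 1" "N a < 1 \<or> w b < 1" for a b
    using pos_ideal.add[OF pos_ideal.zero that] by simp
  have lt1: "x * y < 1" if "0 \<le> x" "0 \<le> y" "x \<le> 1" "y \<le> 1" "x < 1 \<or> y < 1" for x y :: real
    using that by (metis less_eq_real_def mult_le_one mult_less_cancel_left2
        mult_less_cancel_right2 mult_zero_left mult_zero_right not_less zero_less_one)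
  have scale: "const_fun c * d * x \<in> pos_ideal"
    if "x \<in> pos_ideal" "N c \<le> 1" "d \<in> rat_funs \<rat>" "w d \<le> 1" for c d x
    using that(1)
  proof induction
    case (add x a b)
    have "const_fun (c * a) * (d * b) \<in> pos_ideal"
    proof (rule trm)
      show "N (c * a) \<le> 1" "w (d * b) \<le> 1" "d * b \<in> rat_funs \<rat>"
        using add that N.nonneg w.nonneg
        by (auto simp: N.mult w.mult mult_le_one intro: w.KD)
      show "N (c * a) < 1 \<or> w (d * b) < 1"
        using add that N.nonneg[of a] N.nonneg[of c] w.nonneg[of d] w.nonneg[of b]
          lt1[of "N c" "N a"] lt1[of "w d" "w b"] by (auto simp: N.mult w.mult)
    qed
    then show ?case
      using that(1) add(6) \<open>\<And>x y. x \<in> pos_ideal \<Longrightarrow> y \<in> pos_ideal \<Longrightarrow> x + y \<in> pos_ideal\<close>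
      by (simp add: algebra_simps)
  qed (simp add: pos_ideal.zero)
  show "x * y \<in> pos_ideal" if "x \<in> pos_ideal" "y \<in> pos_ideal" for x y
    using that(1)
  proof induction
    case (add x a b)
    then show ?case
      using scale[OF that(2), of a b] \<open>\<And>x y. x \<in> pos_ideal \<Longrightarrow> y \<in> pos_ideal \<Longrightarrow> x + y \<in> pos_ideal\<close>
      by (simp add: distrib_right)
  qed (simp add: pos_ideal.zero)
  show "x * y \<in> pos_ideal"
    if "x \<in> {const_fun a | a. N a \<le> 1} \<union> {\<phi> \<in> rat_funs \<rat>. w \<phi> \<le> 1}" "y \<in> pos_ideal" for x y
    using that(1) scale[OF that(2), of _ 1] scale[OF that(2), of 1] w.KD(2) by auto
  show "1 \<notin> pos_ideal"
  proof
    assume "1 \<in> pos_ideal"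
    from pos_ideal_sum[OF this] obtain n :: nat and a b where x: "1 = (\<Sum>i<n. const_fun (a i) * b i)"
      "\<And>i. i < n \<Longrightarrow> N (a i) \<le> 1 \<and> b i \<in> rat_funs \<rat> \<and> w (b i) \<le> 1 \<and> (N (a i) < 1 \<or> w (b i) < 1)"
      by auto
    \<comment> \<open>Moving 1 to the other side appends the term \<open>1 * (-1)\<close>, which is
      the term of norm one that \<open>sum_nonzero\<close> requires.\<close>
    have "(\<Sum>i<Suc n. const_fun ((a(n := 1)) i) * (b(n := -1)) i) \<noteq> 0"
      by (rule sum_nonzero[of "{..<Suc n}" n]) (use x(2) w.KD(2,5) in auto)
    then show False using x(1) by simp
  qed
qed

end

text \<open>In two variables \<open>G\<close> is \<open>f(X - Y)\<close>: its part free of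
  \<open>Y\<close> is \<open>f\<close>, and it becomes \<open>f(\<beta>)\<close> at
  \<open>Y = X - \<beta>\<close>. For a root \<beta> of a nonzero \<open>f\<close> this is an
  equation of \<open>X - \<beta>\<close> over the rational functions with nonzero constant
  term.\<close>

lemma taylor_relation:
  fixes \<beta> :: "'c::field_char_0"
  assumes "f \<in> polys \<rat>"
  shows "\<exists>G :: 'c poly poly. (\<forall>k. coeff G k \<in> polys \<rat>) \<and> coeff G 0 = f \<and>
    poly G [:-\<beta>, 1:] = [:poly f \<beta>:]"
  using assms
proof (induction f)
  case 0
  then show ?case by (intro exI[of _ 0]) (auto intro: polys_closed[OF is_subfield_Rats])
next
  case (pCons a f)
  note P = polys_closed[OF is_subfield_Rats]
  have a: "a \<in> \<rat>" using polysD[OF pCons.prems, of 0] by simp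
  have "f \<in> polys \<rat>" using polysD[OF pCons.prems, of "Suc i" for i] by (auto intro: polysI)
  from pCons.IH[OF this] obtain G where G: "\<And>k. coeff G k \<in> polys \<rat>" "coeff G 0 = f"
    "poly G [:-\<beta>, 1:] = [:poly f \<beta>:]" by blast
  \<comment> \<open>Horner's rule for \<open>f(X - Y)\<close>.\<close>
  define H where "H = [:[:a:]:] + smult [:0, 1:] G - pCons 0 G"
  have "coeff H k \<in> polys \<rat>" for k
    unfolding H_def using G(1) a
    by (auto simp: coeff_pCons intro!: P(1,3,4,6,8) split: nat.splits)
  moreover have "coeff H 0 = pCons a f" unfolding H_def by (simp add: G(2))
  moreover have "poly H [:-\<beta>, 1:] = [:poly (pCons a f) \<beta>:]"
    unfolding H_def by (simp add: G(3) algebra_simps)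
  ultimately show ?case by blast
qed

lemma exists_max_preorder:
  assumes "finite S" "S \<noteq> {}" and total: "\<And>x y. x \<in> S \<Longrightarrow> y \<in> S \<Longrightarrow> r x y \<or> r y x"
    and trans: "\<And>x y z. x \<in> S \<Longrightarrow> y \<in> S \<Longrightarrow> z \<in> S \<Longrightarrow> r x y \<Longrightarrow> r y z \<Longrightarrow> r x z"
  shows "\<exists>m\<in>S. \<forall>x\<in>S. r x m"
  using assms
proof (induction S rule: finite_ne_induct)
  case (singleton x)
  show ?case using singleton.prems(1)[of x x] by simp
next
  case (insert x S)
  have "\<exists>m\<in>S. \<forall>x\<in>S. r x m"
  proof (rule insert.IH)
    show "r y z \<or> r z y" if "y \<in> S" "z \<in> S" for y z
      by (rule insert.prems(1)) (rule insertI2, rule that)+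
    show "r a c" if "a \<in> S" "b \<in> S" "c \<in> S" "r a b" "r b c" for a b c
      by (rule insert.prems(2)[OF insertI2 insertI2 insertI2]) (rule that)+
  qed
  then obtain m where m: "m \<in> S" "\<And>y. y \<in> S \<Longrightarrow> r y m" by blast
  show ?case
  proof (cases "r x m")
    case True
    then show ?thesis using m by auto
  next
    case False
    then have "r m x" "r x x" using insert.prems(1)[of x m] insert.prems(1)[of x x] m(1) by auto
    then show ?thesis using m insert.prems(2)[of _ m x] by blast
  qed
qed

section \<open>Absolute values read off a dominating valuation ring\<close>

locale dominating_ring = rat_ext N w p
  for N :: "'c::{alg_closed_field,field_char_0} \<Rightarrow> real" and w :: "'c poly fract \<Rightarrow> real" and p +
  fixes R J :: "'c poly fract set"
  assumes R1: "1 \<in> R" and JR: "J \<subseteq> R"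
    and Radd: "\<And>x y. x \<in> R \<Longrightarrow> y \<in> R \<Longrightarrow> x + y \<in> R"
    and Rmult: "\<And>x y. x \<in> R \<Longrightarrow> y \<in> R \<Longrightarrow> x * y \<in> R"
    and Jadd: "\<And>x y. x \<in> J \<Longrightarrow> y \<in> J \<Longrightarrow> x + y \<in> J"
    and RJ: "\<And>x y. x \<in> R \<Longrightarrow> y \<in> J \<Longrightarrow> x * y \<in> J" and J0: "0 \<in> J" and J1: "1 \<notin> J"
    and Rtotal: "\<And>x. x \<in> R \<or> inverse x \<in> R"
    and Runit: "\<And>x. x \<in> R \<Longrightarrow> x \<notin> J \<Longrightarrow> inverse x \<in> R"
    and cR: "N a \<le> 1 \<Longrightarrow> const_fun a \<in> R" and cJ: "N a < 1 \<Longrightarrow> const_fun a \<in> J"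
    and wR: "\<phi> \<in> rat_funs \<rat> \<Longrightarrow> w \<phi> \<le> 1 \<Longrightarrow> \<phi> \<in> R"
begin

lemma Rm1: "-1 \<in> R"
proof -
  have "const_fun (-1 :: 'c) \<in> R" using N.minus[of 1] by (intro cR) simp
  then show ?thesis by simp
qed

lemma Rdiff: "x - y \<in> R" if "x \<in> R" "y \<in> R" for x y
  using Radd[OF that(1) Rmult[OF Rm1 that(2)]] by simp

text \<open>Valuation rings are integrally closed; this is what allows roots to be taken in
  \<open>eqv_root\<close>.\<close>

lemma pow_R: "z \<in> R" if "z ^ n \<in> R" "n > 0" for z n
proof (rule ccontr)
  assume c: "z \<notin> R"
  then have z: "inverse z \<in> J" using Rtotal[of z] Runit[of "inverse z"] by auto
  have z0: "z \<noteq> 0" using c J0 JR by auto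
  have "inverse z ^ Suc k \<in> J" for k
    by (induction k) (use z RJ JR in auto)
  then have "inverse z ^ n \<in> J" using that(2) by (cases n) auto
  then have "z ^ n * inverse z ^ n \<in> J" using RJ that(1) by blast
  then show False using J1 z0 by (simp flip: power_mult_distrib)
qed

text \<open>Equality of the values of \<open>x\<close> and of the constant \<open>a\<close> for
  \<open>R\<close>. In this way \<open>x\<close> obtains the real absolute value \<open>N a\<close>
  even if \<open>R\<close> itself has no real valuation.\<close>

definition eqv :: "'c poly fract \<Rightarrow> 'c \<Rightarrow> bool" where
  "eqv x a \<longleftrightarrow> x \<noteq> 0 \<and> a \<noteq> 0 \<and> x / const_fun a \<in> R \<and> const_fun a / x \<in> R"

text \<open>Multiplying the three quotients puts \<open>a / b\<close> into \<open>R\<close>; if its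
  norm exceeded 1, its inverse would lie in \<open>J\<close>. So \<open>R\<close> induces on the
  constants the order given by \<open>N\<close>, which makes the norm of an equivalent constant
  independent of its choice.\<close>

lemma eqv_le: "N a \<le> N b" if "eqv x a" "eqv y b" "x / y \<in> R" for x y a b
proof (rule ccontr)
  assume c: "\<not> N a \<le> N b"
  note e = that(1,2)[unfolded eqv_def]
  have "(const_fun a / x) * (x / y) * (y / const_fun b) \<in> R"
    by (intro Rmult) (use e that(3) in auto)
  moreover have "(const_fun a / x) * (x / y) * (y / const_fun b) = const_fun (a / b)"
    using e by (simp add: const_fun_divide)
  ultimately have 1: "const_fun (a / b) \<in> R" by simp
  have "N (b / a) < 1" using c e N.pos[of a] by (simp add: N.divide)
  then have "const_fun (b / a) \<in> J" by (rule cJ)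
  then have "const_fun (a / b) * const_fun (b / a) \<in> J" using RJ 1 by blast
  then show False using J1 e by (simp flip: const_fun_simps(6))
qed

lemma eqv_unique: "N a = N b" if "eqv x a" "eqv x b" for x a b
proof -
  have "x / x \<in> R" using that R1 unfolding eqv_def by simp
  then show ?thesis using eqv_le[OF that] eqv_le[OF that(2,1)] by simp
qed

lemma eqv_mult: "eqv (x * y) (a * b)" if "eqv x a" "eqv y b" for x y a b
proof -
  have "x * y / const_fun (a * b) = (x / const_fun a) * (y / const_fun b)"
    "const_fun (a * b) / (x * y) = (const_fun a / x) * (const_fun b / y)" by simp_all
  then show ?thesis using that Rmult unfolding eqv_def by (metis mult_eq_0_iff)
qed

lemma eqv_diff: "N c \<le> max (N a) (N b)" if "eqv x a" "eqv y b" "eqv (x - y) c" for x y a b c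
proof -
  have nz: "x \<noteq> 0" "y \<noteq> 0" using that by (auto simp: eqv_def)
  show ?thesis
  proof (cases "y / x \<in> R")
    case True
    have "(x - y) / x \<in> R" using Rdiff[OF R1 True] nz by (simp add: diff_divide_distrib)
    then show ?thesis using eqv_le[OF that(3,1)] by simp
  next
    case False
    then have "x / y \<in> R" using Rtotal[of "y / x"] by simp
    then have "(x - y) / y \<in> R" using Rdiff[OF _ R1] nz by (simp add: diff_divide_distrib)
    then show ?thesis using eqv_le[OF that(3,2)] by simp
  qed
qed

lemma eqv_const: "eqv (const_fun c) c" if "c \<noteq> 0" for c
  using that R1 by (simp add: eqv_def)

lemma eqv_root: "\<exists>d. d ^ n = c \<and> eqv x d" if "x \<noteq> 0" "n > 0" "eqv (x ^ n) c" for x n c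
proof -
  obtain d where d: "d ^ n = c" using nth_root_exists[OF \<open>n > 0\<close>] by blast
  have d0: "d \<noteq> 0" using d that by (auto simp: eqv_def)
  have "(x / const_fun d) ^ n \<in> R" "(const_fun d / x) ^ n \<in> R"
    using that(3) d by (auto simp: eqv_def power_divide simp flip: const_fun_power)
  then show ?thesis using pow_R[OF _ that(2)] d d0 that(1) by (auto simp: eqv_def)
qed

text \<open>By torsion a power of \<phi> is a power of \<open>p\<close> times a unit of
  \<open>W\<close>, and units of \<open>W\<close> are units of \<open>R\<close>. A root in
  \<open>'c\<close> of that power of \<open>p\<close> then matches \<phi>.\<close>

lemma eqv_rat_fun: "\<exists>c. eqv \<phi> c \<and> N c = w \<phi>" if \<phi>: "\<phi> \<in> rat_funs \<rat>" "\<phi> \<noteq> 0" for \<phi>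
proof -
  obtain n k where nk: "n > 0" "w \<phi> ^ n = N (of_nat p) powi k" using torsion[OF \<phi>] by blast
  define r where "r = (of_nat p :: 'c) powi k"
  have rR: "r \<in> \<rat>" unfolding r_def by (auto simp: power_int_def)
  have p0: "(of_nat p :: 'c) \<noteq> 0" using p by (cases "p = 0") auto
  then have r0: "r \<noteq> 0" unfolding r_def by simp
  have rN: "N r = N (of_nat p) powi k"
    unfolding r_def by (auto simp: power_int_def N.power N.inverse)
  have "w (\<phi> ^ n / const_fun r) = 1" "w (const_fun r / \<phi> ^ n) = 1"
    using \<phi> nk rN w.pos[OF \<phi>] w_Rats[OF rR] const_QX[OF rR] N.pos[of r] r0 p(1)
    by (auto simp: w.divide w.power w.KD)
  moreover have "\<phi> ^ n / const_fun r \<in> rat_funs \<rat>" "const_fun r / \<phi> ^ n \<in> rat_funs \<rat>"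
    using \<phi>(1) const_QX[OF rR] by (auto intro: w.KD)
  ultimately have "eqv (\<phi> ^ n) r" using r0 \<phi>(2) wR by (simp add: eqv_def)
  then obtain d where d: "d ^ n = r" "eqv \<phi> d" using eqv_root[OF \<phi>(2) nk(1)] by blast
  have "N d ^ n = w \<phi> ^ n" using d(1) rN nk(2) N.power[of d n] by simp
  then have "N d = w \<phi>"
    using power_eq_imp_eq_base[OF _ _ _ nk(1)] N.nonneg w.nonneg[OF \<phi>(1)] by blast
  then show ?thesis using d(2) by blast
qed

text \<open>A Newton polygon argument: in an equation of \<open>X - \<beta>\<close> over the
  rational functions two terms must share the largest value, and their quotient shows that a power
  of \<open>X - \<beta>\<close> is a rational function over the rationals up to a unit of
  \<open>R\<close>.\<close>

lemma eqv_linear: "\<exists>d. eqv (to_fract [:-\<beta>, 1:]) d" if \<beta>: "algebraic \<beta>" for \<beta>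
proof -
  define y where "y = to_fract [:-\<beta>, 1:]"
  have y0: "y \<noteq> 0" by (simp add: y_def)
  obtain f where f: "\<And>i. coeff f i \<in> \<rat>" "f \<noteq> 0" "poly f \<beta> = 0"
    using \<beta> unfolding algebraic_altdef by blast
  obtain G where G: "\<And>k. coeff G k \<in> polys \<rat>" "coeff G 0 = f" "poly G [:-\<beta>, 1:] = 0"
    using taylor_relation[of f \<beta>] f by (auto simp: polys_def)
  define t where "t = (\<lambda>k. to_fract (coeff G k) * y ^ k)"
  have t0: "(\<Sum>k\<le>degree G. t k) = 0"
  proof -
    have "to_fract (poly G [:-\<beta>, 1:]) = (\<Sum>k\<le>degree G. t k)"
      unfolding poly_altdef t_def y_def by (simp add: to_fract_sum to_fract_power)
    then show ?thesis using G(3) by simp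
  qed
  define S where "S = {k. k \<le> degree G \<and> t k \<noteq> 0}"
  have S: "finite S" "0 \<in> S" using f(2) G(2) by (auto simp: S_def t_def)
  have "\<exists>m\<in>S. \<forall>x\<in>S. t x / t m \<in> R"
  proof (rule exists_max_preorder)
    show "finite S" "S \<noteq> {}" using S by auto
    show "t x / t y \<in> R \<or> t y / t x \<in> R" for x y using Rtotal[of "t x / t y"] by simp
    show "t x / t z \<in> R" if "x \<in> S" "y \<in> S" "z \<in> S" "t x / t y \<in> R" "t y / t z \<in> R" for x y z
      using Rmult[OF that(4,5)] that(2) by (simp add: S_def)
  qed
  then obtain k where k: "k \<in> S" "\<And>i. i \<in> S \<Longrightarrow> t i / t k \<in> R" by blast
  \<comment> \<open>A single dominant term could not be cancelled: the other quotients would add up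
    to -1 inside \<open>J\<close>.\<close>
  have "\<exists>l\<in>S - {k}. t l / t k \<notin> J"
  proof (rule ccontr)
    assume "\<not> ?thesis"
    then have "(\<Sum>i\<in>S - {k}. t i / t k) \<in> J"
      using J0 Jadd S(1) by (intro sum_mem) auto
    moreover have "(\<Sum>i\<in>S - {k}. t i / t k) = -1"
    proof -
      have "(\<Sum>i\<in>S. t i) = 0"
        using t0 by (subst sum.mono_neutral_left[of "{..degree G}"]) (auto simp: S_def)
      then have "(\<Sum>i\<in>S - {k}. t i) = - t k"
        using k(1) S(1) by (simp add: sum.remove[of S k] eq_neg_iff_add_eq_0 add.commute)
      then show ?thesis using k(1) by (simp add: S_def flip: sum_divide_distrib)
    qed
    ultimately have "-1 * -1 \<in> J" using RJ[OF Rm1] by metis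
    then show False using J1 by simp
  qed
  then obtain l where l: "l \<in> S" "l \<noteq> k" "t l / t k \<notin> J" by blast
  have lk: "t l / t k \<in> R" "t k / t l \<in> R"
    using k(2)[OF l(1)] Runit[OF k(2)[OF l(1)] l(3)] by auto
  have main: "\<exists>d. eqv y d" if "i < j" "i \<in> S" "j \<in> S" "t i / t j \<in> R" "t j / t i \<in> R" for i j
  proof -
    define \<phi> where "\<phi> = to_fract (coeff G i) / to_fract (coeff G j)"
    have nz: "coeff G i \<noteq> 0" "coeff G j \<noteq> 0" using that(2,3) by (auto simp: S_def t_def)
    have \<phi>: "\<phi> \<in> rat_funs \<rat>" "\<phi> \<noteq> 0"
      unfolding \<phi>_def using nz to_fract_QX[OF G(1)] by (auto intro: w.KD)
    obtain c where c: "eqv \<phi> c" using eqv_rat_fun[OF \<phi>] by blast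
    have yj: "y ^ j = y ^ (j - i) * y ^ i" using that(1) by (simp flip: power_add)
    have eq: "y ^ (j - i) = \<phi> * (t j / t i)"
      unfolding \<phi>_def t_def yj using nz y0 by simp
    have "y ^ (j - i) / const_fun c = (\<phi> / const_fun c) * (t j / t i)"
      "const_fun c / y ^ (j - i) = (const_fun c / \<phi>) * (t i / t j)"
      unfolding eq by simp_all
    then have "eqv (y ^ (j - i)) c"
      using c y0 Rmult that(4,5) unfolding eqv_def by (metis power_not_zero)
    then show ?thesis using eqv_root[OF y0, of "j - i"] that(1) by auto
  qed
  show ?thesis
    using main[of k l] main[of l k] k(1) l(1,2) lk unfolding y_def by (metis nat_neq_iff)
qed

text \<open>
  Up to a unit of \<open>R\<close>, the function \<open>X - \<beta>\<close> is a constant, whose absolute value serves as that of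
  \<open>X - \<beta>\<close>. The choice is only meaningful for algebraic \<open>\<beta>\<close>.
\<close>

definition xdist_elem :: "'c \<Rightarrow> 'c" where
  "xdist_elem \<beta> = (SOME d. eqv (to_fract [:-\<beta>, 1:]) d)"

lemma xdist_elem: "algebraic \<beta> \<Longrightarrow> eqv (to_fract [:-\<beta>, 1:]) (xdist_elem \<beta>)"
  unfolding xdist_elem_def using eqv_linear by (rule someI_ex)

definition xdist :: "'c \<Rightarrow> real" where
  "xdist \<beta> = N (xdist_elem \<beta>)"

lemma xdist_pos: "xdist \<beta> > 0" if "algebraic \<beta>" for \<beta>
  using xdist_elem[OF that] N.pos unfolding xdist_def eqv_def by blast

text \<open>Together with \<open>xdist_ultra2\<close> this treats \<open>X\<close> as one more point
  of the ultrametric space, at distance \<open>xdist \<beta>\<close> from \<beta>. It works because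
  the difference of \<open>X - \<gamma>\<close> and \<open>X - \<beta>\<close> is a
  constant.\<close>

lemma xdist_ultra1: "N (\<beta> - \<gamma>) \<le> max (xdist \<beta>) (xdist \<gamma>)" if "algebraic \<beta>" "algebraic \<gamma>" for \<beta> \<gamma>
proof (cases "\<beta> = \<gamma>")
  case False
  have "to_fract [:-\<gamma>, 1:] - to_fract [:-\<beta>, 1:] = const_fun (\<beta> - \<gamma>)"
    by (simp add: const_fun_to_fract flip: to_fract_diff)
  then show ?thesis
    using eqv_diff[OF xdist_elem[OF that(2)] xdist_elem[OF that(1)], of "\<beta> - \<gamma>"] eqv_const[of "\<beta> - \<gamma>"] False
    unfolding xdist_def by (simp add: max.commute)
qed (use xdist_pos[OF that(1)] in auto)

lemma xdist_ultra2: "xdist \<gamma> \<le> max (xdist \<beta>) (N (\<beta> - \<gamma>))" if "algebraic \<beta>" "algebraic \<gamma>" for \<beta> \<gamma>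
proof (cases "\<beta> = \<gamma>")
  case False
  have "to_fract [:-\<beta>, 1:] - const_fun (\<gamma> - \<beta>) = to_fract [:-\<gamma>, 1:]"
    by (simp add: const_fun_to_fract flip: to_fract_diff)
  then show ?thesis
    using eqv_diff[OF xdist_elem[OF that(1)] eqv_const[of "\<gamma> - \<beta>"], of "xdist_elem \<gamma>"] xdist_elem[OF that(2)] False
      N.diff_commute[of \<gamma> \<beta>] unfolding xdist_def by simp
qed auto

text \<open>One factorization computes both norms: for the value at \<open>a\<close> it uses the
  distances of \<open>a\<close> to the roots, for \<open>w\<close> those of \<open>X\<close>. For
  the latter, the product of the constants attached to the linear factors is compared, by
  \<open>eqv_unique\<close>, with the constant from \<open>eqv_rat_fun\<close>.\<close>

lemma rat_poly_factor: "\<exists>c A. c \<noteq> 0 \<and> (\<forall>x\<in>#A. algebraic x) \<and> f = smult c (\<Prod>x\<in>#A. [:-x, 1:]) \<and>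
    w (to_fract f) = N c * (\<Prod>x\<in>#A. xdist x) \<and> (\<forall>a. N (poly f a) = N c * (\<Prod>x\<in>#A. N (a - x)))"
  if f: "f \<in> polys \<rat>" "f \<noteq> 0" for f
proof -
  obtain A where A: "f = smult (lead_coeff f) (\<Prod>x\<in>#A. [:-x, 1:])"
    using alg_closed_imp_factorization[OF f(2)] by blast
  define c where "c = lead_coeff f"
  have fc: "f = smult c (\<Prod>x\<in>#A. [:-x, 1:])" using A c_def by simp
  have c0: "c \<noteq> 0" using f(2) c_def by simp
  have alg: "algebraic x" if "x \<in># A" for x
  proof -
    have "poly f x = 0"
      unfolding fc using that by (auto simp: poly_prod_mset prod_mset_zero_iff)
    then show ?thesis using f unfolding algebraic_altdef polys_def by blast
  qed
  have prod: "eqv (to_fract (\<Prod>x\<in>#A. [:-x, 1:])) (\<Prod>x\<in>#A. xdist_elem x) \<and> N (\<Prod>x\<in>#A. xdist_elem x) = (\<Prod>x\<in>#A. xdist x)"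
    using alg
  proof (induction A)
    case empty
    then show ?case using eqv_const[of 1] by simp
  next
    case (add x A)
    then have "eqv (to_fract [:-x, 1:] * to_fract (\<Prod>x\<in>#A. [:-x, 1:])) (xdist_elem x * (\<Prod>x\<in>#A. xdist_elem x))"
      using eqv_mult[OF xdist_elem[of x]] by simp
    moreover have "to_fract (\<Prod>x\<in>#add_mset x A. [:-x, 1:]) = to_fract [:-x, 1:] * to_fract (\<Prod>x\<in>#A. [:-x, 1:])"
      by (simp only: image_mset_add_mset prod_mset.add_mset to_fract_mult)
    ultimately show ?case using add by (simp add: N.mult xdist_def)
  qed
  then have "eqv (to_fract f) (c * (\<Prod>x\<in>#A. xdist_elem x))"
    using eqv_mult[OF eqv_const[OF c0]] unfolding fc to_fract_smult by blast
  moreover obtain c' where "eqv (to_fract f) c'" "N c' = w (to_fract f)"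
    using eqv_rat_fun[of "to_fract f"] f to_fract_QX by auto
  ultimately have 1: "w (to_fract f) = N c * (\<Prod>x\<in>#A. xdist x)"
    using eqv_unique prod by (metis N.mult UNIV_I)
  have 2: "N (\<Prod>x\<in>#A. a - x) = (\<Prod>x\<in>#A. N (a - x))" for a
    by (induction A) (auto simp: N.mult)
  have "poly f a = c * (\<Prod>x\<in>#A. a - x)" for a
    unfolding fc by (simp add: poly_prod_mset image_mset.compositionality o_def)
  then have 3: "N (poly f a) = N c * (\<Prod>x\<in>#A. N (a - x))" for a
    using 2 by (simp add: N.mult)
  show ?thesis using c0 alg fc 1 3 by blast
qed

lemma prod_mset_mono: "(\<Prod>x\<in>#A. g x) \<le> (\<Prod>x\<in>#A. h x)"
  if "\<And>x. x \<in># A \<Longrightarrow> 0 \<le> g x \<and> g x \<le> h x" for A and g h :: "'c \<Rightarrow> real"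
proof -
  have "(\<Prod>x\<in>#A. g x) \<le> (\<Prod>x\<in>#A. h x) \<and> 0 \<le> (\<Prod>x\<in>#A. g x)"
    using that by (induction A) (auto intro!: mult_mono order.trans[of 0 "g _" "h _"])
  then show ?thesis by blast
qed

text \<open>
  At a minimum \<open>\<beta>\<close> of \<open>xdist\<close>, the residue of \<open>f^n / p^k\<close>, with \<open>f\<close> vanishing at \<open>\<beta>\<close>, would be
  transcendental.
\<close>

lemma xdist_no_min: "\<exists>\<gamma>. algebraic \<gamma> \<and> xdist \<gamma> < xdist \<beta>" if \<beta>: "algebraic \<beta>" for \<beta>
proof (rule ccontr)
  assume "\<not> ?thesis"
  then have min: "xdist \<beta> \<le> xdist \<gamma>" if "algebraic \<gamma>" for \<gamma> using that by force
  \<comment> \<open>At a minimum the ultrametric inequality bounds each \<open>\<beta> - x\<close>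
    by \<open>xdist x\<close>, so evaluation at \<beta> is bounded by \<open>w\<close>.\<close>
  have N_le_w: "N (poly F \<beta>) \<le> w (to_fract F)" if F: "F \<in> polys \<rat>" for F
  proof (cases "F = 0")
    case False
    obtain c A where cA: "\<And>x. x \<in># A \<Longrightarrow> algebraic x" "w (to_fract F) = N c * (\<Prod>x\<in>#A. xdist x)"
      "\<And>a. N (poly F a) = N c * (\<Prod>x\<in>#A. N (a - x))" using rat_poly_factor[OF F False] by blast
    have "(\<Prod>x\<in>#A. N (\<beta> - x)) \<le> (\<Prod>x\<in>#A. xdist x)"
      using xdist_ultra1[OF \<beta> cA(1)] min[OF cA(1)] N.nonneg by (intro prod_mset_mono) (auto simp: max_def)
    then show ?thesis unfolding cA(2,3) using N.nonneg by (intro mult_left_mono) auto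
  qed simp
  obtain f where f: "f \<in> polys \<rat>" "f \<noteq> 0" "poly f \<beta> = 0"
    using \<beta> unfolding algebraic_altdef polys_def by blast
  obtain n k where nk: "n > 0" "w (to_fract f) ^ n = N (of_nat p) powi k"
    using torsion[of "to_fract f"] f to_fract_QX by auto
  define r where "r = (of_nat p :: 'c) powi k"
  have rR: "r \<in> \<rat>" "inverse r \<in> \<rat>" unfolding r_def by (auto simp: power_int_def)
  have p0: "(of_nat p :: 'c) \<noteq> 0" using p by (cases "p = 0") auto
  then have r0: "r \<noteq> 0" unfolding r_def by simp
  have rN: "N r = N (of_nat p) powi k"
    unfolding r_def by (auto simp: power_int_def N.power N.inverse)
  define \<psi> where "\<psi> = smult (inverse r) (f ^ n)"
  have \<psi>: "\<psi> \<in> polys \<rat>" unfolding \<psi>_def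
    using rR f(1) by (intro polys_closed[OF is_subfield_Rats])
  have "w (to_fract \<psi>) = 1"
    unfolding \<psi>_def to_fract_smult to_fract_power
    using to_fract_QX[OF f(1)] const_QX[OF rR(2)] w_Rats[OF rR(2)] nk(2) rN N.pos[OF _ r0] p(1)
    by (simp add: w.mult w.power w.KD N.inverse)
  from resid_alg[OF \<psi> this] obtain h where h: "h \<in> polys \<rat>" "N (coeff h 0) = 1"
    "w (to_fract (pcompose h \<psi>)) < 1" by blast
  \<comment> \<open>Since \<psi> vanishes at \<beta>, the composite takes there the value of the
    constant coefficient of \<open>h\<close>, which has norm one, while \<open>w\<close> of the
    composite is less than one.\<close>
  have "poly \<psi> \<beta> = 0" unfolding \<psi>_def using f(3) nk(1) by (simp add: poly_power)
  then have "N (poly (pcompose h \<psi>) \<beta>) = 1" using h(2) by (simp add: poly_pcompose poly_0_coeff_0)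
  moreover have "N (poly (pcompose h \<psi>) \<beta>) \<le> w (to_fract (pcompose h \<psi>))"
    by (rule N_le_w) (rule polys_closed(13)[OF is_subfield_Rats h(1) \<psi>])
  ultimately show False using h(3) by simp
qed

text \<open>The infimum \<open>I\<close> may well be positive; what matters is that no
  \<open>xdist\<close> attains it. Hence the terms are eventually nearer to \<open>X\<close> than
  any prescribed algebraic \<gamma>, and their distance to \<gamma> becomes the distance from
  \<gamma> to \<open>X\<close>.\<close>

lemma xdist_sequence:
  "\<exists>E :: nat \<Rightarrow> 'c. (\<forall>n m k. n < m \<longrightarrow> m < k \<longrightarrow> N (E m - E k) < N (E n - E m)) \<and>
    (\<forall>f\<in>polys \<rat>. \<exists>n0. \<forall>n\<ge>n0. N (poly f (E n)) = w (to_fract f))"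
proof -
  define I where "I = (INF \<beta>\<in>{\<beta>. algebraic \<beta>}. xdist \<beta>)"
  have bdd: "bdd_below (xdist ` {\<beta>. algebraic \<beta>})"
  proof (rule bdd_belowI2)
    show "0 \<le> xdist \<beta>" if "\<beta> \<in> {\<beta>. algebraic \<beta>}" for \<beta>
      using xdist_pos[of \<beta>] that by simp
  qed
  have I_less: "I < xdist \<beta>" if \<beta>: "algebraic \<beta>" for \<beta>
  proof -
    obtain \<gamma> where "algebraic \<gamma>" "xdist \<gamma> < xdist \<beta>" using xdist_no_min[OF \<beta>] by blast
    then show ?thesis unfolding I_def using cINF_lower[OF bdd, of \<gamma>] by auto
  qed
  have step: "\<exists>\<gamma>. algebraic \<gamma> \<and> xdist \<gamma> < xdist \<beta> \<and> xdist \<gamma> < I + \<epsilon>" if \<beta>: "algebraic \<beta>" and \<epsilon>: "\<epsilon> > 0" for \<beta> \<epsilon>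
  proof -
    have "\<exists>\<gamma>\<in>{\<beta>. algebraic \<beta>}. xdist \<gamma> < I + \<epsilon>"
    proof (rule ccontr)
      assume "\<not> ?thesis"
      then have "I + \<epsilon> \<le> (INF \<beta>\<in>{\<beta>. algebraic \<beta>}. xdist \<beta>)"
        using \<beta> by (intro cINF_greatest) force+
      then have "I + \<epsilon> \<le> I" by (simp add: I_def)
      then show False using \<epsilon> by simp
    qed
    then obtain \<gamma> where \<gamma>: "algebraic \<gamma>" "xdist \<gamma> < I + \<epsilon>" by blast
    \<comment> \<open>Whichever of \<gamma> and \<delta> lies nearer to \<open>X\<close> meets both
      demands.\<close>
    obtain \<delta> where "algebraic \<delta>" "xdist \<delta> < xdist \<beta>" using xdist_no_min[OF \<beta>] by blast
    then show ?thesis using \<gamma> by (cases "xdist \<gamma> < xdist \<delta>") force+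
  qed
  have "\<exists>E. \<forall>n. algebraic (E n) \<and> (xdist (E (Suc n)) < xdist (E n) \<and> xdist (E (Suc n)) < I + 1 / real (Suc n))"
    by (rule dependent_nat_choice) (use algebraic_0 step in auto)
  then obtain E where E: "\<And>n. algebraic (E n)" "\<And>n. xdist (E (Suc n)) < xdist (E n)"
    "\<And>n. xdist (E (Suc n)) < I + 1 / real (Suc n)" by blast
  have dec: "xdist (E m) < xdist (E n)" if "n < m" for n m
    using lift_Suc_mono_less[of "\<lambda>n. - xdist (E n)" n m] E(2) that by simp
  have dist: "N (E n - E m) = xdist (E n)" if "n < m" for n m
    using xdist_ultra1[OF E(1) E(1), of n m] xdist_ultra2[OF E(1) E(1), of n m] xdist_ultra2[OF E(1) E(1), of m n] dec[OF that]
      N.diff_commute[of "E n" "E m"] by auto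
  have ev: "\<exists>n0. \<forall>n\<ge>n0. N (E n - \<gamma>) = xdist \<gamma>" if \<gamma>: "algebraic \<gamma>" for \<gamma>
  proof -
    obtain n0 where n0: "1 / real (Suc n0) < xdist \<gamma> - I"
      using I_less[OF \<gamma>] nat_approx_posE[of "xdist \<gamma> - I"] by auto
    have "N (E n - \<gamma>) = xdist \<gamma>" if "n \<ge> Suc n0" for n
    proof -
      have "xdist (E n) \<le> xdist (E (Suc n0))" using dec[of "Suc n0" n] that by (cases "n = Suc n0") auto
      also have "\<dots> < xdist \<gamma>" using E(3)[of n0] n0 by linarith
      finally show ?thesis using xdist_ultra1[OF E(1)[of n] \<gamma>] xdist_ultra2[OF E(1)[of n] \<gamma>] by auto
    qed
    then show ?thesis by blast
  qed
  have evA: "\<exists>n0. \<forall>n\<ge>n0. (\<Prod>x\<in>#A. N (E n - x)) = (\<Prod>x\<in>#A. xdist x)" if "\<And>x. x \<in># A \<Longrightarrow> algebraic x" for A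
    using that
  proof (induction A)
    case (add x A)
    obtain n0 where n0: "\<And>n. n \<ge> n0 \<Longrightarrow> (\<Prod>x\<in>#A. N (E n - x)) = (\<Prod>x\<in>#A. xdist x)"
      using add by auto
    obtain n1 where "\<And>n. n \<ge> n1 \<Longrightarrow> N (E n - x) = xdist x" using ev[of x] add.prems by auto
    then show ?case using n0 by (intro exI[of _ "max n0 n1"]) auto
  qed auto
  have "\<exists>n0. \<forall>n\<ge>n0. N (poly f (E n)) = w (to_fract f)" if f: "f \<in> polys \<rat>" for f
  proof (cases "f = 0")
    case False
    obtain c A where cA: "\<And>x. x \<in># A \<Longrightarrow> algebraic x" "w (to_fract f) = N c * (\<Prod>x\<in>#A. xdist x)"
      "\<And>a. N (poly f a) = N c * (\<Prod>x\<in>#A. N (a - x))" using rat_poly_factor[OF f False] by blast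
    have "\<exists>n0. \<forall>n\<ge>n0. (\<Prod>x\<in>#A. N (E n - x)) = (\<Prod>x\<in>#A. xdist x)" by (rule evA) (rule cA(1))
    then show ?thesis unfolding cA(2,3) by metis
  qed auto
  moreover have "N (E m - E k) < N (E n - E m)" if "n < m" "m < k" for n m k
    using dist[OF that(1)] dist[OF that(2)] dec[OF that(1)] by simp
  ultimately show ?thesis by blast
qed

end

context rat_ext
begin

theorem approximating_sequence:
  "\<exists>E :: nat \<Rightarrow> 'c. (\<forall>n m k. n < m \<longrightarrow> m < k \<longrightarrow> N (E m - E k) < N (E n - E m)) \<and>
    (\<forall>f\<in>polys \<rat>. \<exists>n0. \<forall>n\<ge>n0. N (poly f (E n)) = w (to_fract f))"
proof -
  let ?A = "{const_fun a | a. N a \<le> 1} \<union> {\<phi> \<in> rat_funs \<rat>. w \<phi> \<le> 1}"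
  have "-1 = const_fun (-1 :: 'c)" "N (-1) \<le> 1" using N.minus[of 1] by simp_all
  then have m1: "-1 \<in> ?A" by blast
  obtain J R where pJ: "pos_ideal \<subseteq> J" and AR: "?A \<subseteq> R" and RJ: "J \<subseteq> R" "1 \<in> R"
    "\<And>x y. x \<in> R \<Longrightarrow> y \<in> R \<Longrightarrow> x + y \<in> R" "\<And>x y. x \<in> R \<Longrightarrow> y \<in> R \<Longrightarrow> x * y \<in> R"
    "\<And>x y. x \<in> J \<Longrightarrow> y \<in> J \<Longrightarrow> x + y \<in> J" "\<And>x y. x \<in> R \<Longrightarrow> y \<in> J \<Longrightarrow> x * y \<in> J" "1 \<notin> J"
    "\<And>x. x \<in> R \<or> inverse x \<in> R" "\<And>x. x \<in> R \<Longrightarrow> x \<notin> J \<Longrightarrow> inverse x \<in> R"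
    by (rule exists_dominating_valuation_ring[OF pos_ideal_stable m1], rule that; (assumption | blast))
  interpret dominating_ring N w p R J
  proof
    show "0 \<in> J" using pJ pos_ideal.zero by blast
    show "const_fun a \<in> J" if "N a < 1" for a
      using pos_ideal.add[OF pos_ideal.zero, of a 1] that w.KD(2) pJ by auto
    show "const_fun a \<in> R" if "N a \<le> 1" for a using AR that by blast
    show "\<phi> \<in> R" if "\<phi> \<in> rat_funs \<rat>" "w \<phi> \<le> 1" for \<phi> using AR that by blast
  qed (use RJ in auto)
  show ?thesis by (rule xdist_sequence)
qed

end

section \<open>Valuation rings and residue fields\<close>

lemma type_algebra_simps [simp]:
  "carrier (ring_of_type_algebra :: 'k::field ring) = UNIV"
  "monoid.mult (ring_of_type_algebra :: 'k::field ring) = (*)"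
  "one (ring_of_type_algebra :: 'k::field ring) = 1"
  "ring.zero (ring_of_type_algebra :: 'k::field ring) = 0"
  "add (ring_of_type_algebra :: 'k::field ring) = (+)"
  by (simp_all add: ring_of_type_algebra_def)

lemma ring_on_cring:
  fixes V :: "'k::field set"
  assumes "0 \<in> V" "1 \<in> V" "\<And>x y. x \<in> V \<Longrightarrow> y \<in> V \<Longrightarrow> x + y \<in> V"
    "\<And>x y. x \<in> V \<Longrightarrow> y \<in> V \<Longrightarrow> x * y \<in> V" "\<And>x. x \<in> V \<Longrightarrow> - x \<in> V"
  shows "cring (ring_on V)"
proof (rule cringI)
  show "abelian_group (ring_on V)"
    by (rule abelian_groupI) (use assms in \<open>auto simp: add_ac intro!: bexI[of _ "- _"]\<close>)
  show "Group.comm_monoid (ring_on V)"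
    by (rule comm_monoidI) (use assms in \<open>auto simp: mult_ac\<close>)
qed (auto simp: distrib_right)

lemma ring_on_a_inv:
  assumes "cring (ring_on V)" "x \<in> V" "- x \<in> V"
  shows "\<ominus>\<^bsub>ring_on V\<^esub> x = - x"
proof -
  interpret cring "ring_on V" by fact
  show ?thesis using assms by (intro minus_equality) auto
qed

lemma ring_on_nat_pow: "x [^]\<^bsub>ring_on V\<^esub> (n::nat) = x ^ n"
  by (induction n) (simp_all add: nat_pow_def mult.commute)

lemma subring_type_algebra:
  fixes V :: "'k::field set"
  assumes "1 \<in> V" "\<And>x y. x \<in> V \<Longrightarrow> y \<in> V \<Longrightarrow> x + y \<in> V"
    "\<And>x y. x \<in> V \<Longrightarrow> y \<in> V \<Longrightarrow> x * y \<in> V" "\<And>x. x \<in> V \<Longrightarrow> - x \<in> V"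
  shows "subring V ring_of_type_algebra"
proof -
  interpret cring "ring_of_type_algebra :: 'k ring" by (rule cring_from_type_algebra)
  have "\<ominus>\<^bsub>ring_of_type_algebra\<^esub> x = - x" for x :: 'k
    by (rule minus_equality) auto
  then show ?thesis
    by (intro ring.subringI[OF ring_axioms]) (use assms in auto)
qed

section \<open>Valuation ring and residue field of an absolute value\<close>

context ultranorm
begin

definition vring :: "'k set" where
  "vring = {x \<in> K. N x \<le> 1}"

lemma mem_vring: "x \<in> vring \<longleftrightarrow> x \<in> K \<and> N x \<le> 1"
  by (simp add: vring_def)

lemma vring_closed:
  "0 \<in> vring" "1 \<in> vring" "\<And>x y. x \<in> vring \<Longrightarrow> y \<in> vring \<Longrightarrow> x + y \<in> vring"
  "\<And>x y. x \<in> vring \<Longrightarrow> y \<in> vring \<Longrightarrow> x * y \<in> vring" "\<And>x. x \<in> vring \<Longrightarrow> - x \<in> vring"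
proof -
  show "x + y \<in> vring" if "x \<in> vring" "y \<in> vring" for x y
    using that add[of x y] KD(3) by (auto simp: mem_vring)
  show "x * y \<in> vring" if "x \<in> vring" "y \<in> vring" for x y
    using that nonneg by (auto simp: mem_vring mult KD(4) mult_le_one)
qed (auto simp: mem_vring KD)

lemma vring_valuation_domain: "valuation_domain K vring"
  unfolding valuation_domain_def
proof (intro conjI ballI)
  show "subring vring ring_of_type_algebra"
    by (rule subring_type_algebra) (use vring_closed in auto)
  show "vring \<subseteq> K" by (auto simp: mem_vring)
  fix x assume x: "x \<in> K - {0}"
  then have "N x > 0" using pos by blast
  then show "x \<in> vring \<or> Fields.inverse x \<in> vring"
    using x by (auto simp: mem_vring KD inverse inverse_le_1_iff)
qed

sublocale V: cring "ring_on vring"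
  by (rule ring_on_cring) (use vring_closed in auto)

lemma Units_vring: "Units (ring_on vring) = {x \<in> K. N x = 1}"
proof -
  have "x \<in> K \<and> N x = 1" if "x \<in> Units (ring_on vring)" for x
  proof -
    from that have "\<exists>y. x \<in> vring \<and> y \<in> vring \<and> x * y = 1"
      unfolding Units_def by auto
    then obtain y where y: "x \<in> vring" "y \<in> vring" "x * y = 1" by blast
    have "N x * N y = 1" using y mult[of x y] by (auto simp: mem_vring)
    moreover have "N x * N y \<le> N x" using y nonneg[of x] by (auto simp: mem_vring mult_left_le)
    ultimately show ?thesis using y by (auto simp: mem_vring)
  qed
  moreover have "x \<in> Units (ring_on vring)" if "x \<in> K" "N x = 1" for x
  proof -
    have "x \<noteq> 0" using that by auto
    then show ?thesis using that KD(6)[of x] inverse[of x]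
      unfolding Units_def by (auto simp: mem_vring intro!: bexI[of _ "Fields.inverse x"])
  qed
  ultimately show ?thesis by blast
qed

lemma max_ideal_vring: "max_ideal vring = {x \<in> K. N x < 1}"
  unfolding max_ideal_def Units_vring by (auto simp: mem_vring)

lemma max_ideal_ideal: "ideal (max_ideal vring) (ring_on vring)"
proof (rule idealI)
  show "ring (ring_on vring)" by (rule V.ring_axioms)
  show "subgroup (max_ideal vring) (add_monoid (ring_on vring))"
  proof (rule V.add.subgroupI)
    show "max_ideal vring \<subseteq> carrier (ring_on vring)" by (auto simp: max_ideal_vring mem_vring)
    show "max_ideal vring \<noteq> {}" unfolding max_ideal_vring using KD(1) by force
    fix x assume x: "x \<in> max_ideal vring"
    then have "\<ominus>\<^bsub>ring_on vring\<^esub> x = - x"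
      by (intro ring_on_a_inv V.cring_axioms) (auto simp: max_ideal_vring mem_vring KD)
    then show "\<ominus>\<^bsub>ring_on vring\<^esub> x \<in> max_ideal vring"
      using x by (simp add: max_ideal_vring KD(5))
    fix y assume y: "y \<in> max_ideal vring"
    show "x \<oplus>\<^bsub>ring_on vring\<^esub> y \<in> max_ideal vring"
      using x y add[of x y] by (auto simp: max_ideal_vring KD(3))
  qed
  have "x * a \<in> max_ideal vring" if "a \<in> max_ideal vring" "x \<in> vring" for a x
  proof -
    have "N x * N a \<le> 1 * N a"
      using that nonneg[of a] by (intro mult_right_mono) (auto simp: mem_vring max_ideal_vring)
    then show ?thesis using that by (auto simp: max_ideal_vring mem_vring mult KD(4))
  qed
  then show "x \<otimes>\<^bsub>ring_on vring\<^esub> a \<in> max_ideal vring" "a \<otimes>\<^bsub>ring_on vring\<^esub> x \<in> max_ideal vring"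
    if "a \<in> max_ideal vring" "x \<in> carrier (ring_on vring)" for a x
    using that by (auto simp: mult.commute)
qed

lemma max_ideal_maximalideal: "maximalideal (max_ideal vring) (ring_on vring)"
proof (rule maximalidealI[OF max_ideal_ideal])
  have "1 \<in> carrier (ring_on vring)" "1 \<notin> max_ideal vring"
    using vring_closed(2) by (auto simp: max_ideal_vring)
  then show "carrier (ring_on vring) \<noteq> max_ideal vring" by blast
  fix J assume J: "ideal J (ring_on vring)" "max_ideal vring \<subseteq> J" "J \<subseteq> carrier (ring_on vring)"
  show "J = max_ideal vring \<or> J = carrier (ring_on vring)"
  proof (rule disjCI)
    assume "J \<noteq> carrier (ring_on vring)"
    then have "1 \<notin> J" using ideal.one_imp_carrier[OF J(1)] by auto
    have "x \<in> max_ideal vring" if x: "x \<in> J" for x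
    proof (rule ccontr)
      assume "x \<notin> max_ideal vring"
      then have x1: "x \<in> K" "N x = 1" using x J(3) by (auto simp: max_ideal_vring mem_vring)
      then have "Fields.inverse x \<in> vring" "x \<noteq> 0" using inverse[of x] KD(6) by (auto simp: mem_vring)
      then show False using ideal.I_l_closed[OF J(1) x, of "Fields.inverse x"] \<open>1 \<notin> J\<close> by auto
    qed
    then show "J = max_ideal vring" using J(2) by blast
  qed
qed

lemma residue_field_field: "field (residue_field vring)"
  unfolding residue_field_def
  by (rule maximalideal.quotient_is_field[OF max_ideal_maximalideal V.cring_axioms])

sublocale k: field "residue_field vring"
  by (rule residue_field_field)

lemma residue_hom: "ring_hom_ring (ring_on vring) (residue_field vring) (residue_class vring)"
  using ideal.rcos_ring_hom_ring[OF max_ideal_ideal]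
  unfolding residue_field_def residue_class_def[abs_def] .

sublocale k: ring_hom_ring "ring_on vring" "residue_field vring" "residue_class vring"
  by (rule residue_hom)

lemma residue_class_alt: "residue_class vring x = {y + x | y. y \<in> K \<and> N y < 1}"
  unfolding residue_class_def a_r_coset_def' max_ideal_vring by auto

lemma mem_residue_class: "x \<in> vring \<Longrightarrow> y \<in> residue_class vring x \<longleftrightarrow> y \<in> K \<and> N (y - x) < 1"
proof
  assume x: "x \<in> vring"
  show "y \<in> K \<and> N (y - x) < 1" if "y \<in> residue_class vring x"
  proof -
    obtain z where "y = z + x" "z \<in> K" "N z < 1"
      using \<open>y \<in> residue_class vring x\<close> unfolding residue_class_alt by blast
    then show ?thesis using x by (auto simp: mem_vring intro: KD(3))
  qed
  show "y \<in> residue_class vring x" if "y \<in> K \<and> N (y - x) < 1"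
    unfolding residue_class_alt
    by (rule CollectI, rule exI[of _ "y - x"]) (use x that KD(7) in \<open>auto simp: mem_vring\<close>)
qed

lemma residue_class_eq_iff:
  assumes "x \<in> vring" "y \<in> vring"
  shows "residue_class vring x = residue_class vring y \<longleftrightarrow> N (x - y) < 1"
proof
  assume "residue_class vring x = residue_class vring y"
  then have "x \<in> residue_class vring y"
    using mem_residue_class[OF assms(1), of x] assms(1) by (auto simp: mem_vring)
  then show "N (x - y) < 1" using mem_residue_class[OF assms(2), of x] by simp
next
  assume d: "N (x - y) < 1"
  have K: "x \<in> K" "y \<in> K" using assms by (auto simp: mem_vring)
  have "N (z - x) < 1 \<longleftrightarrow> N (z - y) < 1" if "z \<in> K" for z
    using add[of "z - x" "x - y"] diff[of "z - y" "x - y"] d that K KD(7)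
    by (auto simp: max_def split: if_splits)
  then show "residue_class vring x = residue_class vring y"
    using mem_residue_class[OF assms(1)] mem_residue_class[OF assms(2)]
    by (intro Set.set_eqI) auto
qed

lemma carrier_residue_field: "carrier (residue_field vring) = residue_class vring ` vring"
  unfolding residue_field_def FactRing_def A_RCOSETS_def' residue_class_def by auto

lemma residue_zero_iff:
  assumes "x \<in> vring" shows "residue_class vring x = \<zero>\<^bsub>residue_field vring\<^esub> \<longleftrightarrow> N x < 1"
  using residue_class_eq_iff[OF assms vring_closed(1)] k.hom_zero by simp

end

text \<open>The map \<open>e\<close> need not be an inclusion because it will also be evaluation at
  a point. Preservation of norms identifies the kernel of the induced map to residues with the
  maximal ideal, and density up to norm less than one makes that map onto.\<close>

lemma residue_field_iso:
  fixes K :: "'k::field set" and L :: "'l::field set"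
  assumes "ultranorm K N" "ultranorm L M"
    and e: "\<And>x. x \<in> ultranorm.vring K N \<Longrightarrow> e x \<in> L \<and> M (e x) = N x"
    and hom: "e 1 = 1" "\<And>x y. x \<in> ultranorm.vring K N \<Longrightarrow> y \<in> ultranorm.vring K N \<Longrightarrow> e (x + y) = e x + e y"
      "\<And>x y. x \<in> ultranorm.vring K N \<Longrightarrow> y \<in> ultranorm.vring K N \<Longrightarrow> e (x * y) = e x * e y"
    and dense: "\<And>y. y \<in> L \<Longrightarrow> M y \<le> 1 \<Longrightarrow> \<exists>x\<in>ultranorm.vring K N. M (y - e x) < 1"
  shows "\<exists>h\<in>ring_iso (residue_field (ultranorm.vring K N)) (residue_field (ultranorm.vring L M)).
    \<forall>x\<in>ultranorm.vring K N. h (residue_class (ultranorm.vring K N) x) = residue_class (ultranorm.vring L M) (e x)"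
proof -
  interpret A: ultranorm K N by fact
  interpret B: ultranorm L M by fact
  let ?h = "\<lambda>x. residue_class B.vring (e x)"
  have eV: "e x \<in> B.vring" if "x \<in> A.vring" for x
    using e[OF that] that by (simp add: A.mem_vring B.mem_vring)
  interpret h: ring_hom_ring "ring_on A.vring" "residue_field B.vring" ?h
  proof (rule ring_hom_ringI)
    show "ring (ring_on A.vring)" by (rule A.V.ring_axioms)
    show "ring (residue_field B.vring)" by (rule B.k.ring_axioms)
    show "?h x \<in> carrier (residue_field B.vring)" if "x \<in> carrier (ring_on A.vring)" for x
      using that eV by (auto simp: B.carrier_residue_field)
    show "?h (x \<otimes>\<^bsub>ring_on A.vring\<^esub> y) = ?h x \<otimes>\<^bsub>residue_field B.vring\<^esub> ?h y"
      if "x \<in> carrier (ring_on A.vring)" "y \<in> carrier (ring_on A.vring)" for x y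
      using B.k.hom_mult[of "e x" "e y"] that eV hom(3) by simp
    show "?h (x \<oplus>\<^bsub>ring_on A.vring\<^esub> y) = ?h x \<oplus>\<^bsub>residue_field B.vring\<^esub> ?h y"
      if "x \<in> carrier (ring_on A.vring)" "y \<in> carrier (ring_on A.vring)" for x y
      using B.k.hom_add[of "e x" "e y"] that eV hom(2) by simp
    show "?h \<one>\<^bsub>ring_on A.vring\<^esub> = \<one>\<^bsub>residue_field B.vring\<^esub>"
      using B.k.hom_one hom(1) by simp
  qed
  have ker: "a_kernel (ring_on A.vring) (residue_field B.vring) ?h = max_ideal A.vring"
  proof -
    have "?h x = \<zero>\<^bsub>residue_field B.vring\<^esub> \<longleftrightarrow> N x < 1" if "x \<in> A.vring" for x
      using B.residue_zero_iff[OF eV[OF that]] e[OF that] by simp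
    then have "{x \<in> A.vring. ?h x = \<zero>\<^bsub>residue_field B.vring\<^esub>} = {x \<in> A.vring. N x < 1}"
      by (intro Collect_cong) blast
    also have "\<dots> = {x \<in> K. N x < 1}" by (auto simp: A.mem_vring)
    finally show ?thesis unfolding a_kernel_def' A.max_ideal_vring by simp
  qed
  have surj: "?h ` carrier (ring_on A.vring) = carrier (residue_field B.vring)"
  proof -
    have "residue_class B.vring y \<in> ?h ` A.vring" if y: "y \<in> B.vring" for y
    proof -
      obtain x where x: "x \<in> A.vring" "M (y - e x) < 1" using dense[of y] y by (auto simp: B.mem_vring)
      then have "residue_class B.vring y = ?h x"
        using B.residue_class_eq_iff[OF that eV[OF x(1)]] by simp
      then show ?thesis using x(1) by blast
    qed
    then show ?thesis using eV by (auto simp: B.carrier_residue_field)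
  qed
  have 1: "(\<lambda>Z. the_elem (?h ` Z)) \<in> ring_iso (residue_field A.vring) (residue_field B.vring)"
    using h.FactRing_iso_set[OF surj] unfolding ker residue_field_def[of A.vring, symmetric] .
  have 2: "the_elem (?h ` residue_class A.vring x) = ?h x" if x: "x \<in> A.vring" for x
  proof -
    have "?h y = ?h x" if "y \<in> residue_class A.vring x" for y
    proof -
      have y: "y \<in> K" "N (y - x) < 1" using that A.mem_residue_class[OF x] by auto
      then have "N y \<le> 1" using A.add[of "y - x" x] x by (auto simp: A.mem_vring A.KD)
      then have yV: "y \<in> A.vring" using y by (simp add: A.mem_vring)
      have mV: "- x \<in> A.vring" using A.vring_closed(5)[OF x] .
      have "e x + e (- x) = e 0" using hom(2)[OF x mV] by simp
      moreover have "e 0 = 0" using e[OF A.vring_closed(1)] B.eq_0_iff[of "e 0"] by simp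
      ultimately have "e (- x) = - e x" by (simp add: eq_neg_iff_add_eq_0 add.commute)
      then have "e (y - x) = e y - e x" using hom(2)[OF yV mV] by simp
      moreover have "y - x \<in> A.vring" using A.vring_closed(3)[OF yV mV] by simp
      ultimately have "M (e y - e x) < 1" using e[of "y - x"] y(2) by simp
      then show ?thesis using B.residue_class_eq_iff[OF eV[OF yV] eV[OF x]] by simp
    qed
    moreover have "x \<in> residue_class A.vring x"
      using A.mem_residue_class[OF x, of x] x by (auto simp: A.mem_vring)
    ultimately have "?h ` residue_class A.vring x = {?h x}" by blast
    then show ?thesis by simp
  qed
  show ?thesis by (rule bexI[OF _ 1], rule ballI, rule 2)
qed

text \<open>Sending an element of \<open>K\<close> to its class in the value group of
  \<open>L\<close> is a homomorphism whose kernel consists of the elements of norm one, and it is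
  onto since every norm on \<open>L\<close> is attained on \<open>K\<close>. The isomorphism theorem
  gives the map together with its values on classes.\<close>

lemma abstract_value_group_iso:
  assumes A: "ultranorm K N" and B: "ultranorm L M" and KL: "K \<subseteq> L"
    and e: "\<And>x. x \<in> K \<Longrightarrow> M x = N x"
    and dense: "\<And>y. y \<in> L \<Longrightarrow> y \<noteq> 0 \<Longrightarrow> \<exists>x\<in>K. M x = M y"
  shows "\<exists>h\<in>iso (abstract_value_group K (ultranorm.vring K N)) (abstract_value_group L (ultranorm.vring L M)).
    \<forall>x\<in>K - {0}. h (abstract_value K (ultranorm.vring K N) x) = abstract_value L (ultranorm.vring L M) x"
proof -
  interpret A: ultranorm K N by fact
  interpret B: ultranorm L M by fact
  have grp: "comm_group (mult_of (ring_on F))" if F: "is_subfield F" for F :: "'a set"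
  proof (rule comm_groupI)
    fix x assume "x \<in> carrier (mult_of (ring_on F))"
    then show "\<exists>y\<in>carrier (mult_of (ring_on F)). y \<otimes>\<^bsub>mult_of (ring_on F)\<^esub> x = \<one>\<^bsub>mult_of (ring_on F)\<^esub>"
      using is_subfieldD(6)[OF F, of x] by (intro bexI[of _ "inverse x"]) auto
  qed (use is_subfieldD[OF F] in auto)
  interpret GA: comm_group "mult_of (ring_on K)" by (rule grp[OF A.K])
  interpret GB: comm_group "mult_of (ring_on L)" by (rule grp[OF B.K])
  have inv: "inv\<^bsub>mult_of (ring_on L)\<^esub> x = inverse x" if "x \<in> L - {0}" for x
    using that B.KD(6)[of x] by (intro GB.inv_equality) auto
  let ?U = "Units (ring_on B.vring)"
  have sub: "subgroup ?U (mult_of (ring_on L))"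
  proof (rule GB.subgroupI)
    show "?U \<subseteq> carrier (mult_of (ring_on L))" by (auto simp: B.Units_vring)
    show "?U \<noteq> {}" unfolding B.Units_vring using B.KD(2) by force
    show "inv\<^bsub>mult_of (ring_on L)\<^esub> a \<in> ?U" if "a \<in> ?U" for a
    proof -
      have "a \<in> L - {0}" using that by (auto simp: B.Units_vring)
      then show ?thesis using that by (simp add: inv) (simp add: B.Units_vring B.KD(6) B.inverse)
    qed
    show "a \<otimes>\<^bsub>mult_of (ring_on L)\<^esub> b \<in> ?U" if "a \<in> ?U" "b \<in> ?U" for a b
      using that by (auto simp: B.Units_vring B.KD(4) B.mult)
  qed
  interpret U: normal ?U "mult_of (ring_on L)"
    by (rule GB.subgroup_imp_normal[OF sub])
  let ?h = "abstract_value L B.vring"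
  have val: "y \<in> ?h x \<longleftrightarrow> y \<in> L \<and> M y = M x" if "x \<in> L - {0}" for x y
  proof -
    have "y \<in> ?h x \<longleftrightarrow> (\<exists>u. u \<in> L \<and> M u = 1 \<and> y = u * x)"
      by (auto simp: abstract_value_def r_coset_def B.Units_vring)
    also have "\<dots> \<longleftrightarrow> y \<in> L \<and> M y = M x"
      using that B.pos[of x] by (auto simp: B.KD(4,8) B.mult B.divide intro!: exI[of _ "y / x"])
    finally show ?thesis .
  qed
  have heq: "?h x = ?h y \<longleftrightarrow> M x = M y" if "x \<in> L - {0}" "y \<in> L - {0}" for x y
  proof
    assume "?h x = ?h y"
    then have "x \<in> ?h y" using val[OF that(1), of x] that by auto
    then show "M x = M y" using val[OF that(2), of x] by simp
  next
    assume "M x = M y"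
    show "?h x = ?h y"
      by (rule Set.set_eqI) (simp only: val[OF that(1)] val[OF that(2)] \<open>M x = M y\<close>)
  qed
  interpret h: group_hom "mult_of (ring_on K)" "abstract_value_group L B.vring" ?h
  proof (rule group_hom.intro)
    show "Group.group (mult_of (ring_on K))" by (rule GA.group_axioms)
    show "Group.group (abstract_value_group L B.vring)"
      unfolding abstract_value_group_def by (rule U.factorgroup_is_group)
    show "group_hom_axioms (mult_of (ring_on K)) (abstract_value_group L B.vring) ?h"
    proof (rule group_hom_axioms.intro, rule homI)
      show "?h x \<in> carrier (abstract_value_group L B.vring)" if "x \<in> carrier (mult_of (ring_on K))" for x
        using that KL unfolding abstract_value_group_def abstract_value_def
        by (auto simp: FactGroup_def RCOSETS_def)
      show "?h (x \<otimes>\<^bsub>mult_of (ring_on K)\<^esub> y) = ?h x \<otimes>\<^bsub>abstract_value_group L B.vring\<^esub> ?h y"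
        if "x \<in> carrier (mult_of (ring_on K))" "y \<in> carrier (mult_of (ring_on K))" for x y
        using that KL U.rcos_sum[of x y] unfolding abstract_value_group_def abstract_value_def
        by (auto simp: FactGroup_def)
    qed
  qed
  have one: "\<one>\<^bsub>abstract_value_group L B.vring\<^esub> = ?h 1"
  proof -
    have "?h 1 = ?U"
      using val[of 1] B.KD(2) by (auto simp: B.Units_vring)
    then show ?thesis by (simp add: abstract_value_group_def FactGroup_def)
  qed
  have ker: "kernel (mult_of (ring_on K)) (abstract_value_group L B.vring) ?h = Units (ring_on A.vring)"
  proof -
    have "x \<in> kernel (mult_of (ring_on K)) (abstract_value_group L B.vring) ?h \<longleftrightarrow> x \<in> K \<and> N x = 1" for x
    proof (cases "x \<in> K - {0}")
      case True
      then have "?h x = ?h 1 \<longleftrightarrow> M x = M 1" using heq[of x 1] KL B.KD(2) by auto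
      then show ?thesis using True e[of x] by (auto simp: kernel_def one)
    qed (auto simp: kernel_def)
    then show ?thesis by (auto simp: A.Units_vring)
  qed
  have surj: "?h ` carrier (mult_of (ring_on K)) = carrier (abstract_value_group L B.vring)"
  proof -
    have "?h y \<in> ?h ` (K - {0})" if y: "y \<in> L - {0}" for y
    proof -
      obtain x where x: "x \<in> K" "M x = M y" using dense[of y] y by auto
      have "M y > 0" using B.pos y by auto
      then have x0: "x \<in> K - {0}" using x by auto
      then have "?h y = ?h x" using heq[OF y, of x] x KL by auto
      then show ?thesis using x0 by blast
    qed
    then show ?thesis using KL
      by (auto simp: abstract_value_group_def abstract_value_def FactGroup_def RCOSETS_def)
  qed
  have 1: "(\<lambda>Z. the_elem (?h ` Z)) \<in> iso (abstract_value_group K A.vring) (abstract_value_group L B.vring)"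
    using h.FactGroup_iso_set[OF surj] unfolding ker by (simp add: abstract_value_group_def)
  have 2: "the_elem (?h ` abstract_value K A.vring x) = ?h x" if x: "x \<in> K - {0}" for x
  proof -
    have "?h y = ?h x" if "y \<in> abstract_value K A.vring x" for y
    proof -
      have "\<exists>u. u \<in> K \<and> N u = 1 \<and> y = u * x"
        using that by (auto simp: abstract_value_def r_coset_def A.Units_vring)
      then obtain u where u: "u \<in> K" "N u = 1" "y = u * x" by blast
      then have "u \<noteq> 0" by auto
      then have yK: "y \<in> K - {0}" "N y = N x" using u x by (auto simp: A.KD(4) A.mult)
      then have "M y = M x" using e x by auto
      then show ?thesis using heq[of y x] yK x KL by auto
    qed
    moreover have "x \<in> abstract_value K A.vring x"
      using x A.KD(2) by (auto simp: abstract_value_def r_coset_def A.Units_vring intro!: bexI[of _ 1])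
    ultimately have "?h ` abstract_value K A.vring x = {?h x}" by blast
    then show ?thesis by simp
  qed
  show ?thesis by (rule bexI[OF _ 1], rule ballI, rule 2)
qed

section \<open>The p-adic numbers inside the algebraic closure\<close>

lemma exp_powi: "exp (x :: real) powi k = exp (of_int k * x)"
  by (cases k rule: int_cases2) (auto simp: power_int_def exp_of_nat_mult[symmetric] exp_minus[symmetric])

locale padic_closure =
  fixes p :: nat and v :: "'c::{alg_closed_field,field_char_0} \<Rightarrow> ereal"
  assumes prime: "prime p" and closure: "padic_algebraic_closure p v"
begin

abbreviation N :: "'c \<Rightarrow> real" where "N \<equiv> nrm v"

lemma valuation: "valuation_on UNIV v"
  using closure by (simp add: padic_algebraic_closure_def)

sublocale N: ultranorm UNIV N
  by (rule nrm_ultranorm[OF is_subfield_UNIV valuation])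

lemma v_gt: "v x > ereal r \<longleftrightarrow> N x < exp (- r)"
  and v_real: "v x = ereal r \<longleftrightarrow> N x = exp (- r)" and v_nonneg: "v x \<ge> 0 \<longleftrightarrow> N x \<le> 1"
  and v_less: "v x < v y \<longleftrightarrow> N y < N x" and v_eq: "v x = v y \<longleftrightarrow> N x = N y"
  using valuation_nrm[OF valuation] valuation_nrm2[OF valuation] by auto

lemma rat_val_int: "N (of_int a) = (if a = 0 then 0 else exp (- real (multiplicity (int p) a)))"
proof (cases "a = 0")
  case False
  have "v (of_int a) = v (of_rat (of_int a))" by simp
  also have "\<dots> = rat_val p (of_int a)"
    using closure unfolding padic_algebraic_closure_def by blast
  also have "\<dots> = ereal (real (multiplicity (int p) a))"
    using False by (simp add: rat_val_def)
  finally show ?thesis using False v_real by simp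
qed simp

lemma N_p: "N (of_nat p) = exp (-1)"
proof -
  have "prime_elem (int p)" using prime by (simp add: prime_imp_prime_elem)
  then show ?thesis
    using rat_val_int[of "int p"] prime_gt_0_nat[OF prime] by (simp add: multiplicity_prime)
qed

lemma N_p_bounds: "0 < N (of_nat p)" "N (of_nat p) < 1"
  unfolding N_p by auto

lemma p_nonzero: "(of_nat p :: 'c) \<noteq> 0"
  using N_p_bounds(1) by (metis N.zero less_irrefl)

lemma N_int_eq_1: "\<not> int p dvd a \<Longrightarrow> N (of_int a) = 1"
  by (subst rat_val_int) (auto simp: not_dvd_imp_multiplicity_0)

lemma N_p_power_less: "\<epsilon> > 0 \<Longrightarrow> \<exists>k. N (of_nat p) ^ k < \<epsilon>"
  using real_arch_pow_inv[OF _ N_p_bounds(2)] by blast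

text \<open>In lowest terms \<open>p\<close> cannot divide the denominator \<open>b\<close>, so
  \<open>b\<close> has an inverse \<open>u\<close> modulo \<open>p ^ k\<close>, and the remainder of
  \<open>a * u\<close> is the required integer. The finite number of candidates is the source of the
  compactness of \<open>Q_p v\<close> and of the finiteness of the prime residue field.\<close>

lemma rat_le_1_approx:
  assumes "N (of_rat q) \<le> 1"
  shows "\<exists>n<p ^ k. N (of_rat q - of_nat n) \<le> N (of_nat p) ^ k"
proof -
  obtain a b where q: "q = of_int a / of_int b" "b > 0" "coprime a b"
    by (metis quotient_of_unique of_int_rat quotient_of_div quotient_of_denom_pos
        quotient_of_coprime surj_pair)
  have b0: "(of_int b :: 'c) \<noteq> 0" using q(2) by simp
  have pr: "Factorial_Ring.prime (int p)" using prime by simp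
  have qc: "of_rat q = (of_int a / of_int b :: 'c)" using q by (simp add: of_rat_divide)
  have pb: "\<not> int p dvd b"
  proof
    assume b: "int p dvd b"
    then have "\<not> int p dvd a" using q(3) pr not_coprimeI not_prime_unit by blast
    then have "N (of_rat q) = 1 / N (of_int b)" unfolding qc by (simp add: N.divide N_int_eq_1)
    moreover have "N (of_int b) < 1"
      using q(2) b pr by (subst rat_val_int) (auto simp: prime_multiplicity_gt_zero_iff prime_imp_prime_elem)
    moreover have "N (of_int b) > 0" using N.pos[OF _ b0] by simp
    ultimately show False
      using assms by (metis (no_types) div_by_1 divide_less_cancel frac_le less_le_not_le
          linorder_not_le order_refl zero_less_one less_divide_eq_1_pos)
  qed
  then have "coprime b (int (p ^ k))"
    using prime_imp_coprime[OF pr pb] by (simp add: coprime_commute coprime_power_right_iff)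
  then obtain u w where uw: "u * b + w * int (p ^ k) = 1"
    using bezout_int[of b "int (p ^ k)"] by auto
  define n where "n = nat ((a * u) mod int (p ^ k))"
  have pk: "0 < p ^ k" using prime_gt_0_nat[OF prime] by simp
  have n: "int n = (a * u) mod int (p ^ k)" unfolding n_def using pk by simp
  have "n < p ^ k"
    using pk pos_mod_bound[of "int (p ^ k)" "a * u"] n by linarith
  moreover have "N (of_rat q - of_nat n) \<le> N (of_nat p) ^ k"
  proof -
    have "int (p ^ k) dvd a - b * int n"
    proof -
      define D where "D = a * u div int (p ^ k)"
      have "a * u = int (p ^ k) * D + int n" unfolding n D_def by simp
      then have "int n = a * u - int (p ^ k) * D" by simp
      then have "a - b * int n = a - b * (a * u - int (p ^ k) * D)" by (rule arg_cong)
      also have "\<dots> = a * (1 - u * b) + b * (int (p ^ k) * D)" by (simp add: algebra_simps)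
      also have "1 - u * b = w * int (p ^ k)" using uw by simp
      finally show ?thesis by simp
    qed
    then obtain t where t: "a - b * int n = int (p ^ k) * t" by (elim dvdE)
    have "of_rat q - of_nat n = (of_int (a - b * int n) / of_int b :: 'c)"
      unfolding qc using b0 by (simp add: field_simps)
    also have "\<dots> = of_nat p ^ k * of_int t / of_int b" unfolding t by simp
    finally have "N (of_rat q - of_nat n) = N (of_nat p) ^ k * N (of_int t) / N (of_int b)"
      by (simp add: N.divide N.mult N.power)
    then show ?thesis using N_int_eq_1[OF pb] N.of_int_le_1[of t] N_p_bounds(1)
      by (simp add: mult_left_le)
  qed
  ultimately show ?thesis by blast
qed

abbreviation Qp :: "'c set" where "Qp \<equiv> Q_p v"

lemma mem_Qp: "x \<in> Qp \<longleftrightarrow> (\<forall>\<epsilon>>0. \<exists>q\<in>\<rat>. N (x - q) < \<epsilon>)"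
proof -
  have "x \<in> Qp \<longleftrightarrow> (\<forall>r. \<exists>q. N (x - of_rat q) < exp (- r))"
    by (auto simp: Q_p_def v_gt)
  also have "\<dots> \<longleftrightarrow> (\<forall>\<epsilon>>0. \<exists>q. N (x - of_rat q) < \<epsilon>)"
  proof (intro iffI allI impI)
    fix \<epsilon> :: real assume "\<forall>r. \<exists>q. N (x - of_rat q) < exp (- r)" "\<epsilon> > 0"
    then show "\<exists>q. N (x - of_rat q) < \<epsilon>" by (metis exp_ln minus_minus)
  qed auto
  also have "\<dots> \<longleftrightarrow> (\<forall>\<epsilon>>0. \<exists>q\<in>\<rat>. N (x - q) < \<epsilon>)" by (auto simp: Rats_def)
  finally show ?thesis .
qed

lemma Rats_Qp: "\<rat> \<subseteq> Qp"
  unfolding mem_Qp subset_iff by (metis N.zero diff_self)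

text \<open>Stated for any \<open>F\<close> because two fields are closed up: the rationals, giving
  \<open>Q_p v\<close>, and the field of values at a point of the rational functions over the
  rationals.\<close>

lemma closure_subfield:
  assumes F: "is_subfield F"
  shows "is_subfield {x. \<forall>\<epsilon>>0. \<exists>q\<in>F. N (x - q) < \<epsilon>}"
proof -
  note D = is_subfieldD[OF F]
  let ?C = "{x. \<forall>\<epsilon>>0. \<exists>q\<in>F. N (x - q) < \<epsilon>}"
  have F: "x \<in> ?C" if "x \<in> F" for x using that by (auto intro!: bexI[of _ x])
  have C: "\<exists>q\<in>F. N (x - q) < \<epsilon>" if "x \<in> ?C" "\<epsilon> > 0" for x \<epsilon> using that by blast
  show ?thesis
  proof (rule is_subfieldI)
    show "0 \<in> ?C" "1 \<in> ?C" using F D by blast+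
    fix x assume x: "x \<in> ?C"
    show "- x \<in> ?C"
    proof (intro CollectI allI impI)
      fix \<epsilon> :: real assume "\<epsilon> > 0"
      then obtain q where q: "q \<in> F" "N (x - q) < \<epsilon>" using C[OF x] by blast
      then show "\<exists>q\<in>F. N (- x - q) < \<epsilon>" using D(5) N.minus[of "x - q"] by (intro bexI[of _ "- q"]) auto
    qed
    show "inverse x \<in> ?C" if x0: "x \<noteq> 0"
    proof (intro CollectI allI impI)
      fix \<epsilon> :: real assume \<epsilon>: "\<epsilon> > 0"
      have Nx: "N x > 0" using N.pos x0 by blast
      \<comment> \<open>The first bound gives \<open>q\<close> the norm of \<open>x\<close>, so that
        the second suffices for the inverses.\<close>
      obtain q where q: "q \<in> F" "N (x - q) < min (N x) (\<epsilon> * N x * N x)"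
        using C[OF x, of "min (N x) (\<epsilon> * N x * N x)"] Nx \<epsilon> by auto
      then have Nq: "N q = N x" using N.close_eq[of x q] by simp
      then have q0: "q \<noteq> 0" using Nx by auto
      have "inverse x - inverse q = (q - x) / (x * q)" using x0 q0 by (simp add: field_simps)
      then have "N (inverse x - inverse q) = N (x - q) / (N x * N x)"
        by (simp add: N.divide N.mult Nq N.diff_commute)
      also have "\<dots> < \<epsilon>" using q(2) Nx by (simp add: field_simps)
      finally show "\<exists>q\<in>F. N (inverse x - q) < \<epsilon>" using D(6) q(1) by blast
    qed
    fix y assume y: "y \<in> ?C"
    show "x + y \<in> ?C"
    proof (intro CollectI allI impI)
      fix \<epsilon> :: real assume "\<epsilon> > 0"
      then obtain q r where q: "q \<in> F" "N (x - q) < \<epsilon>" "r \<in> F" "N (y - r) < \<epsilon>"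
        using C[OF x] C[OF y] by blast
      have "N ((x - q) + (y - r)) \<le> max (N (x - q)) (N (y - r))" by (rule N.add) auto
      then show "\<exists>s\<in>F. N (x + y - s) < \<epsilon>"
        using q D(3) by (intro bexI[of _ "q + r"]) (auto simp: algebra_simps)
    qed
    show "x * y \<in> ?C"
    proof (intro CollectI allI impI)
      fix \<epsilon> :: real assume \<epsilon>: "\<epsilon> > 0"
      define B where "B = max 1 (max (N x) (N y))"
      have B: "B \<ge> 1" "N x \<le> B" "N y \<le> B" unfolding B_def by auto
      obtain q r where q: "q \<in> F" "N (x - q) < min 1 (\<epsilon> / B)" "r \<in> F" "N (y - r) < min 1 (\<epsilon> / B)"
        using C[OF x, of "min 1 (\<epsilon> / B)"] C[OF y, of "min 1 (\<epsilon> / B)"] \<epsilon> B(1) by auto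
      have "N q \<le> B"
        using N.diff[of x "x - q"] q B by (auto simp: max_def split: if_splits)
      have 1: "N (x * (y - r)) < \<epsilon>"
      proof -
        have "N (x * (y - r)) \<le> B * N (y - r)"
          using B(2) N.nonneg[of "y - r"] by (simp add: N.mult mult_right_mono)
        also have "\<dots> < \<epsilon>" using q(4) B(1) by (simp add: field_simps)
        finally show ?thesis .
      qed
      have Nr: "N r \<le> B" using N.diff[of y "y - r"] q B by (auto simp: max_def split: if_splits)
      have 2: "N ((x - q) * r) < \<epsilon>"
      proof -
        have "N ((x - q) * r) \<le> N (x - q) * B"
          using Nr N.nonneg[of "x - q"] by (simp add: N.mult mult_left_mono)
        also have "\<dots> < \<epsilon>" using q(2) B(1) by (simp add: field_simps)
        finally show ?thesis .
      qed
      have "N (x * (y - r) + (x - q) * r) < \<epsilon>"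
        using N.add[of "x * (y - r)" "(x - q) * r"] 1 2 by simp
      then show "\<exists>s\<in>F. N (x * y - s) < \<epsilon>"
        using q D(4) by (intro bexI[of _ "q * r"]) (auto simp: algebra_simps)
    qed
  qed
qed

lemma Qp_subfield: "is_subfield Qp"
proof -
  have "Qp = {x. \<forall>\<epsilon>>0. \<exists>q\<in>\<rat>. N (x - q) < \<epsilon>}" using mem_Qp by blast
  then show ?thesis using closure_subfield[OF is_subfield_Rats] by simp
qed

lemmas QpD = is_subfieldD[OF Qp_subfield]

definition N_cauchy :: "(nat \<Rightarrow> 'c) \<Rightarrow> bool" where
  "N_cauchy s \<longleftrightarrow> (\<forall>\<epsilon>>0. \<exists>M. \<forall>m\<ge>M. \<forall>n\<ge>M. N (s m - s n) < \<epsilon>)"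

lemma v_cauchy_iff: "v_cauchy v s \<longleftrightarrow> N_cauchy s"
proof -
  have "v_cauchy v s \<longleftrightarrow> (\<forall>r. \<exists>M. \<forall>m\<ge>M. \<forall>n\<ge>M. N (s m - s n) < exp (- r))"
    by (simp add: v_cauchy_def v_gt)
  also have "\<dots> \<longleftrightarrow> N_cauchy s"
    unfolding N_cauchy_def
  proof (intro iffI allI impI)
    fix \<epsilon> :: real assume "\<forall>r. \<exists>M. \<forall>m\<ge>M. \<forall>n\<ge>M. N (s m - s n) < exp (- r)" "\<epsilon> > 0"
    then show "\<exists>M. \<forall>m\<ge>M. \<forall>n\<ge>M. N (s m - s n) < \<epsilon>" by (metis exp_ln minus_minus)
  qed auto
  finally show ?thesis .
qed

lemma v_converges_iff: "v_converges v s a \<longleftrightarrow> (\<forall>\<epsilon>>0. \<exists>M. \<forall>n\<ge>M. N (s n - a) < \<epsilon>)"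
proof -
  have "v_converges v s a \<longleftrightarrow> (\<forall>r. \<exists>M. \<forall>n\<ge>M. N (s n - a) < exp (- r))"
    by (simp add: v_converges_def tendsto_PInfty eventually_sequentially v_gt)
  also have "\<dots> \<longleftrightarrow> (\<forall>\<epsilon>>0. \<exists>M. \<forall>n\<ge>M. N (s n - a) < \<epsilon>)"
  proof (intro iffI allI impI)
    fix \<epsilon> :: real assume "\<forall>r. \<exists>M. \<forall>n\<ge>M. N (s n - a) < exp (- r)" "\<epsilon> > 0"
    then show "\<exists>M. \<forall>n\<ge>M. N (s n - a) < \<epsilon>" by (metis exp_ln minus_minus)
  qed auto
  finally show ?thesis .
qed

lemma limit_in_Qp:
  assumes "v_converges v s x" "range s \<subseteq> Qp"
  shows "x \<in> Qp"
  unfolding mem_Qp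
proof (intro allI impI)
  fix \<epsilon> :: real assume \<epsilon>: "\<epsilon> > 0"
  then obtain n where n: "N (s n - x) < \<epsilon>" using assms(1) unfolding v_converges_iff by blast
  have "s n \<in> Qp" using assms(2) by auto
  then obtain q where q: "q \<in> \<rat>" "N (s n - q) < \<epsilon>" using \<epsilon> unfolding mem_Qp by blast
  have "N ((s n - q) - (s n - x)) \<le> max (N (s n - q)) (N (s n - x))" by (rule N.diff) auto
  then have "N (x - q) < \<epsilon>" using n q(2) by simp
  then show "\<exists>q\<in>\<rat>. N (x - q) < \<epsilon>" using q(1) by blast
qed

lemma limit_unique:
  assumes "v_converges v s x" "v_converges v s y" shows "x = y"
proof (rule ccontr)
  assume "x \<noteq> y"
  then have pos: "N (x - y) > 0" using N.pos by simp
  obtain M1 where M1: "\<And>n. n \<ge> M1 \<Longrightarrow> N (s n - x) < N (x - y)"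
    using assms(1) pos unfolding v_converges_iff by blast
  obtain M2 where M2: "\<And>n. n \<ge> M2 \<Longrightarrow> N (s n - y) < N (x - y)"
    using assms(2) pos unfolding v_converges_iff by blast
  let ?n = "max M1 M2"
  have "N ((s ?n - y) - (s ?n - x)) \<le> max (N (s ?n - y)) (N (s ?n - x))" by (rule N.diff) auto
  then show False using M1[of ?n] M2[of ?n] by simp
qed

section \<open>Completeness and compactness of finite-dimensional spaces over
  \<open>Q_p v\<close>\<close>

definition complete_set :: "'c set \<Rightarrow> bool" where
  "complete_set S \<longleftrightarrow> (\<forall>s. range s \<subseteq> S \<and> N_cauchy s \<longrightarrow> (\<exists>x\<in>S. v_converges v s x))"

text \<open>Total boundedness of every bounded part, which for a complete \<open>S\<close> amounts
  to local compactness.\<close>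

definition tot_bounded :: "'c set \<Rightarrow> bool" where
  "tot_bounded S \<longleftrightarrow> (\<forall>R \<epsilon>. \<epsilon> > 0 \<longrightarrow>
     (\<exists>T. finite T \<and> T \<subseteq> S \<and> (\<forall>z\<in>S. N z \<le> R \<longrightarrow> (\<exists>t\<in>T. N (z - t) \<le> \<epsilon>))))"

lemma complete_Qp: "complete_set Qp"
  unfolding complete_set_def
proof (intro allI impI)
  fix s assume s: "range s \<subseteq> Qp \<and> N_cauchy s"
  then obtain x where "v_converges v s x"
    using closure v_cauchy_iff unfolding padic_algebraic_closure_def by blast
  then show "\<exists>x\<in>Qp. v_converges v s x" using limit_in_Qp s by blast
qed

text \<open>Multiplication by a power of \<open>p\<close> moves the ball of radius \<open>R\<close>
  into the unit ball, where the integers below \<open>p ^ k\<close> approximate everything to within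
  the norm of \<open>p ^ k\<close>.\<close>

lemma tot_bounded_Qp: "tot_bounded Qp"
  unfolding tot_bounded_def
proof (intro allI impI)
  fix R \<epsilon> :: real assume \<epsilon>: "\<epsilon> > 0"
  let ?P = "N (of_nat p)"
  obtain m where "?P ^ m < inverse (max R 1)" using N_p_power_less[of "inverse (max R 1)"]
    by (auto simp: less_max_iff_disj)
  then have m: "?P ^ m * max R 1 \<le> 1" by (simp add: field_simps)
  have Pm: "?P ^ m > 0" using N_p_bounds by simp
  obtain k where k: "?P ^ k < \<epsilon> * ?P ^ m" using N_p_power_less[of "\<epsilon> * ?P ^ m"] \<epsilon> Pm by auto
  define T :: "'c set" where "T = (\<lambda>n. of_nat n / of_nat p ^ m) ` {..<p ^ k}"
  have "T \<subseteq> Qp" unfolding T_def using QpD by auto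
  moreover have "\<exists>t\<in>T. N (z - t) \<le> \<epsilon>" if z: "z \<in> Qp" "N z \<le> R" for z
  proof -
    let ?y = "of_nat p ^ m * z"
    have "?y \<in> Qp" using z QpD by simp
    moreover have Pk: "?P ^ k > 0" using N_p_bounds by simp
    ultimately obtain q where q: "N (?y - of_rat q) < ?P ^ k"
      unfolding mem_Qp by (metis Rats_cases)
    have "N z \<le> max R 1" using z(2) by simp
    then have "N ?y \<le> ?P ^ m * max R 1" using Pm by (simp add: N.mult N.power)
    then have Ny: "N ?y \<le> 1" using m by linarith
    have "?P ^ k \<le> 1" using N_p_bounds by (simp add: power_le_one)
    then have "N (of_rat q) \<le> 1"
      using N.diff[of ?y "?y - of_rat q"] q Ny by auto
    from rat_le_1_approx[OF this] obtain n where n: "n < p ^ k" "N (of_rat q - of_nat n) \<le> ?P ^ k" by blast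
    have "N ((?y - of_rat q) + (of_rat q - of_nat n)) \<le> max (N (?y - of_rat q)) (N (of_rat q - of_nat n))"
      by (rule N.add) auto
    then have "N (?y - of_nat n) \<le> ?P ^ k" using q n(2) by auto
    moreover have "z - of_nat n / of_nat p ^ m = (?y - of_nat n) / of_nat p ^ m"
      using p_nonzero by (simp add: field_simps)
    ultimately have "N (z - of_nat n / of_nat p ^ m) \<le> ?P ^ k / ?P ^ m"
      using Pm by (simp add: N.divide N.power divide_right_mono)
    also have "\<dots> \<le> \<epsilon>" using k Pm by (simp add: field_simps)
    finally show ?thesis using n(1) by (auto simp: T_def)
  qed
  moreover have "finite T" by (simp add: T_def)
  ultimately show "\<exists>T. finite T \<and> T \<subseteq> Qp \<and> (\<forall>z\<in>Qp. N z \<le> R \<longrightarrow> (\<exists>t\<in>T. N (z - t) \<le> \<epsilon>))" by blast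
qed

text \<open>Stands for a finite-dimensional space over \<open>Q_p v\<close> without mention of a
  basis: these properties pass from \<open>S\<close> to the span of \<open>S\<close> and one more
  vector.\<close>

definition fin_space :: "'c set \<Rightarrow> bool" where
  "fin_space S \<longleftrightarrow> 0 \<in> S \<and> (\<forall>x\<in>S. \<forall>y\<in>S. x + y \<in> S) \<and> (\<forall>k\<in>Qp. \<forall>x\<in>S. k * x \<in> S) \<and>
     complete_set S \<and> tot_bounded S"

lemma fin_space_0: "fin_space {0}"
proof -
  have "v_converges v s 0" if "range s \<subseteq> {0}" for s
  proof -
    have "s n = 0" for n using that by auto
    then show ?thesis unfolding v_converges_iff by auto
  qed
  then have "complete_set {0}" by (auto simp: complete_set_def)
  moreover have "tot_bounded {0}"
    unfolding tot_bounded_def by (intro allI impI exI[of _ "{0}"]) auto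
  ultimately show ?thesis by (simp add: fin_space_def)
qed

text \<open>If \<open>u\<close> is not in \<open>S\<close>, completeness of \<open>S\<close> keeps
  \<open>u\<close> at a positive distance \<delta> from \<open>S\<close>, and scaling gives
  \<open>\<delta> * N k \<le> N (k * u + s)\<close>. The coordinate \<open>k\<close>, and with it
  \<open>s\<close>, is therefore controlled by the vector, so that limits and finite nets can be
  found coordinatewise.\<close>

lemma fin_space_adjoin:
  assumes S: "fin_space S"
  shows "fin_space {k * u + s | k s. k \<in> Qp \<and> s \<in> S}"
proof -
  have S0: "0 \<in> S" and Sadd: "\<And>x y. x \<in> S \<Longrightarrow> y \<in> S \<Longrightarrow> x + y \<in> S"
    and Smult: "\<And>k x. k \<in> Qp \<Longrightarrow> x \<in> S \<Longrightarrow> k * x \<in> S" and Sc: "complete_set S" and St: "tot_bounded S"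
    using S unfolding fin_space_def by blast+
  have Sdiff: "x - y \<in> S" if "x \<in> S" "y \<in> S" for x y
    using Sadd[OF that(1) Smult[OF _ that(2)], of "-1"] QpD(2,5) by simp
  let ?S' = "{k * u + s | k s. k \<in> Qp \<and> s \<in> S}"
  show ?thesis
  proof (cases "u \<in> S")
    case True
    have "?S' = S"
    proof
      show "?S' \<subseteq> S" using True Sadd Smult by blast
      show "S \<subseteq> ?S'" using QpD(1) by force
    qed
    then show ?thesis using S by simp
  next
    case False
    have "\<exists>\<delta>>0. \<forall>s\<in>S. \<delta> \<le> N (u - s)"
    proof (rule ccontr)
      assume "\<not> ?thesis"
      then have "\<exists>s\<in>S. N (u - s) < 1 / real (Suc n)" for n by (metis not_le of_nat_0_less_iff zero_less_Suc zero_less_divide_1_iff)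
      then obtain s where s: "\<And>n. s n \<in> S" "\<And>n. N (u - s n) < 1 / real (Suc n)" by metis
      have conv: "v_converges v s u"
        unfolding v_converges_iff
      proof (intro allI impI)
        fix \<epsilon> :: real assume "\<epsilon> > 0"
        then obtain M where M: "1 / real (Suc M) < \<epsilon>" using nat_approx_posE by blast
        have "N (s n - u) < \<epsilon>" if "n \<ge> M" for n
        proof -
          have "1 / real (Suc n) \<le> 1 / real (Suc M)" using that by (simp add: frac_le)
          then show ?thesis using s(2)[of n] M N.diff_commute[of u "s n"] by simp
        qed
        then show "\<exists>M. \<forall>n\<ge>M. N (s n - u) < \<epsilon>" by blast
      qed
      have "N_cauchy s"
        unfolding N_cauchy_def
      proof (intro allI impI)
        fix \<epsilon> :: real assume "\<epsilon> > 0"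
        then obtain M where M: "\<And>n. n \<ge> M \<Longrightarrow> N (s n - u) < \<epsilon>" using conv unfolding v_converges_iff by blast
        have "N (s m - s n) < \<epsilon>" if "m \<ge> M" "n \<ge> M" for m n
          using N.diff[of "s m - u" "s n - u"] M[OF that(1)] M[OF that(2)] by simp
        then show "\<exists>M. \<forall>m\<ge>M. \<forall>n\<ge>M. N (s m - s n) < \<epsilon>" by blast
      qed
      then obtain x where "x \<in> S" "v_converges v s x" using Sc s(1) unfolding complete_set_def by blast
      then show False using limit_unique[OF conv] False by blast
    qed
    then obtain \<delta> where \<delta>: "\<delta> > 0" "\<And>s. s \<in> S \<Longrightarrow> \<delta> \<le> N (u - s)" by blast
    have kb: "\<delta> * N k \<le> N (k * u + s)" if "k \<in> Qp" "s \<in> S" for k s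
    proof (cases "k = 0")
      case False
      have "\<delta> \<le> N (u - (- inverse k) * s)" using that QpD by (intro \<delta>(2) Smult) auto
      then have "\<delta> * N k \<le> N (u - (- inverse k) * s) * N k" using N.nonneg[of k] by (intro mult_right_mono) auto
      also have "\<dots> = N ((u - (- inverse k) * s) * k)" by (simp add: N.mult)
      also have "(u - (- inverse k) * s) * k = k * u + s" using False by (simp add: field_simps)
      finally show ?thesis .
    qed (simp add: N.nonneg)
    have "complete_set ?S'"
      unfolding complete_set_def
    proof (intro allI impI)
      fix z assume z: "range z \<subseteq> ?S' \<and> N_cauchy z"
      then have zc: "N_cauchy z" and "\<forall>n. \<exists>k s. z n = k * u + s \<and> k \<in> Qp \<and> s \<in> S" by auto
      then obtain k s where ks: "\<And>n. z n = k n * u + s n" "\<And>n. k n \<in> Qp" "\<And>n. s n \<in> S" by metis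
      have kc: "N_cauchy k"
        unfolding N_cauchy_def
      proof (intro allI impI)
        fix \<epsilon> :: real assume "\<epsilon> > 0"
        then obtain M where M: "\<And>m n. m \<ge> M \<Longrightarrow> n \<ge> M \<Longrightarrow> N (z m - z n) < \<delta> * \<epsilon>"
          using zc \<delta>(1) unfolding N_cauchy_def by (metis mult_pos_pos)
        have "N (k m - k n) < \<epsilon>" if "m \<ge> M" "n \<ge> M" for m n
        proof -
          have "\<delta> * N (k m - k n) \<le> N ((k m - k n) * u + (s m - s n))"
            using ks QpD Sdiff by (intro kb) auto
          also have "(k m - k n) * u + (s m - s n) = z m - z n" by (simp add: ks(1) algebra_simps)
          finally show ?thesis using M[OF that] \<delta>(1) by (metis le_less_trans mult_less_cancel_left_pos)
        qed
        then show "\<exists>M. \<forall>m\<ge>M. \<forall>n\<ge>M. N (k m - k n) < \<epsilon>" by blast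
      qed
      have u0: "u \<noteq> 0" using False S0 by auto
      then have Nu: "N u > 0" using N.pos by simp
      have sc: "N_cauchy s"
        unfolding N_cauchy_def
      proof (intro allI impI)
        fix \<epsilon> :: real assume \<epsilon>: "\<epsilon> > 0"
        obtain M1 where M1: "\<And>m n. m \<ge> M1 \<Longrightarrow> n \<ge> M1 \<Longrightarrow> N (z m - z n) < \<epsilon>"
          using zc \<epsilon> unfolding N_cauchy_def by blast
        obtain M2 where M2: "\<And>m n. m \<ge> M2 \<Longrightarrow> n \<ge> M2 \<Longrightarrow> N (k m - k n) < \<epsilon> / N u"
          using kc \<epsilon> Nu unfolding N_cauchy_def by (metis divide_pos_pos)
        have "N (s m - s n) < \<epsilon>" if "m \<ge> max M1 M2" "n \<ge> max M1 M2" for m n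
        proof -
          have "N ((k m - k n) * u) < \<epsilon>"
            using M2[of m n] that Nu unfolding N.mult[OF UNIV_I UNIV_I] by (simp add: pos_less_divide_eq)
          moreover have "s m - s n = (z m - z n) - (k m - k n) * u" by (simp add: ks(1) algebra_simps)
          ultimately show ?thesis
            using M1[of m n] that N.diff[of "z m - z n" "(k m - k n) * u"] by simp
        qed
        then show "\<exists>M. \<forall>m\<ge>M. \<forall>n\<ge>M. N (s m - s n) < \<epsilon>" by blast
      qed
      obtain k' where k': "k' \<in> Qp" "v_converges v k k'"
        using complete_Qp kc ks(2) unfolding complete_set_def by blast
      obtain s' where s': "s' \<in> S" "v_converges v s s'"
        using Sc sc ks(3) unfolding complete_set_def by blast
      have "v_converges v z (k' * u + s')"
        unfolding v_converges_iff
      proof (intro allI impI)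
        fix \<epsilon> :: real assume \<epsilon>: "\<epsilon> > 0"
        obtain M1 where M1: "\<And>n. n \<ge> M1 \<Longrightarrow> N (s n - s') < \<epsilon>" using s'(2) \<epsilon> unfolding v_converges_iff by blast
        obtain M2 where M2: "\<And>n. n \<ge> M2 \<Longrightarrow> N (k n - k') < \<epsilon> / N u"
          using k'(2) \<epsilon> Nu unfolding v_converges_iff by (metis divide_pos_pos)
        have "N (z n - (k' * u + s')) < \<epsilon>" if "n \<ge> max M1 M2" for n
        proof -
          have "N ((k n - k') * u) < \<epsilon>"
            using M2[of n] that Nu unfolding N.mult[OF UNIV_I UNIV_I] by (simp add: pos_less_divide_eq)
          moreover have eq: "z n - (k' * u + s') = (k n - k') * u + (s n - s')" by (simp add: ks(1) algebra_simps)
          ultimately show ?thesis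
            using M1[of n] that N.add[of "(k n - k') * u" "s n - s'"] unfolding eq by simp
        qed
        then show "\<exists>M. \<forall>n\<ge>M. N (z n - (k' * u + s')) < \<epsilon>" by blast
      qed
      then show "\<exists>x\<in>?S'. v_converges v z x" using k'(1) s'(1) by blast
    qed
    moreover have "tot_bounded ?S'"
      unfolding tot_bounded_def
    proof (intro allI impI)
      fix R \<epsilon> :: real assume \<epsilon>: "\<epsilon> > 0"
      have u0: "u \<noteq> 0" using False S0 by auto
      then have Nu: "N u > 0" using N.pos by simp
      obtain T1 where T1: "finite T1" "T1 \<subseteq> Qp" "\<And>k. k \<in> Qp \<Longrightarrow> N k \<le> R / \<delta> \<Longrightarrow> \<exists>t\<in>T1. N (k - t) \<le> \<epsilon> / N u"
        using tot_bounded_Qp \<epsilon> Nu unfolding tot_bounded_def by (metis divide_pos_pos)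
      \<comment> \<open>The vector \<open>s\<close> is the difference of a vector of norm at most
        \<open>R\<close> and of \<open>k * u\<close>, whose norm is at most
        \<open>R / \<delta> * N u\<close>; hence this radius.\<close>
      obtain T2 where T2: "finite T2" "T2 \<subseteq> S" "\<And>s. s \<in> S \<Longrightarrow> N s \<le> max R (R / \<delta> * N u) \<Longrightarrow> \<exists>t\<in>T2. N (s - t) \<le> \<epsilon>"
        using St \<epsilon> unfolding tot_bounded_def by meson
      let ?T = "(\<lambda>(k, s). k * u + s) ` (T1 \<times> T2)"
      have fin: "finite ?T" using T1 T2 by simp
      have sub: "?T \<subseteq> ?S'"
      proof
        fix z assume "z \<in> ?T"
        then obtain k s where "k \<in> T1" "s \<in> T2" "z = k * u + s" by auto
        then show "z \<in> ?S'" using T1(2) T2(2) by blast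
      qed
      have "\<exists>t\<in>?T. N (z - t) \<le> \<epsilon>" if "z \<in> ?S'" "N z \<le> R" for z
      proof -
        obtain k s where ks: "z = k * u + s" "k \<in> Qp" "s \<in> S" using \<open>z \<in> ?S'\<close> by blast
        have "\<delta> * N k \<le> R" using kb[OF ks(2,3)] ks(1) \<open>N z \<le> R\<close> by simp
        then have Nk: "N k \<le> R / \<delta>" using \<delta>(1) by (simp add: field_simps)
        have "N (k * u) \<le> R / \<delta> * N u"
          unfolding N.mult[OF UNIV_I UNIV_I] using Nk Nu by (intro mult_right_mono) auto
        then have "N s \<le> max R (R / \<delta> * N u)"
          using N.diff[of z "k * u"] \<open>N z \<le> R\<close> unfolding ks(1) by auto
        then obtain t2 where t2: "t2 \<in> T2" "N (s - t2) \<le> \<epsilon>" using T2(3)[OF ks(3)] by blast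
        obtain t1 where t1: "t1 \<in> T1" "N (k - t1) \<le> \<epsilon> / N u" using T1(3)[OF ks(2) Nk] by blast
        have "N ((k - t1) * u) \<le> \<epsilon>"
          using t1(2) Nu unfolding N.mult[OF UNIV_I UNIV_I] by (simp add: pos_le_divide_eq)
        moreover have eq: "z - (t1 * u + t2) = (k - t1) * u + (s - t2)" by (simp add: ks(1) algebra_simps)
        ultimately have "N (z - (t1 * u + t2)) \<le> \<epsilon>"
          using t2(2) N.add[of "(k - t1) * u" "s - t2"] unfolding eq by simp
        then show ?thesis using t1(1) t2(1) by force
      qed
      then show "\<exists>T. finite T \<and> T \<subseteq> ?S' \<and> (\<forall>z\<in>?S'. N z \<le> R \<longrightarrow> (\<exists>t\<in>T. N (z - t) \<le> \<epsilon>))"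
        using fin sub by (intro exI[of _ ?T] conjI ballI impI)
    qed
    moreover have "x + y \<in> ?S'" if "x \<in> ?S'" "y \<in> ?S'" for x y
    proof -
      obtain k s k' s' where "x = k * u + s" "k \<in> Qp" "s \<in> S" "y = k' * u + s'" "k' \<in> Qp" "s' \<in> S"
        using \<open>x \<in> ?S'\<close> \<open>y \<in> ?S'\<close> by blast
      then show ?thesis using QpD(3) Sadd
        by (intro CollectI exI[of _ "k + k'"] exI[of _ "s + s'"]) (auto simp: algebra_simps)
    qed
    moreover have "c * x \<in> ?S'" if "c \<in> Qp" "x \<in> ?S'" for c x
    proof -
      obtain k s where "x = k * u + s" "k \<in> Qp" "s \<in> S" using \<open>x \<in> ?S'\<close> by blast
      then show ?thesis using QpD(4) Smult \<open>c \<in> Qp\<close>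
        by (intro CollectI exI[of _ "c * k"] exI[of _ "c * s"]) (auto simp: algebra_simps)
    qed
    moreover have "0 \<in> ?S'" using S0 QpD(1) by force
    ultimately show ?thesis unfolding fin_space_def by blast
  qed
qed

end

text \<open>The given fraction need not be reduced, so \<open>g\<close> may vanish at
  \<open>a\<close> although there is a value; the conclusion avoids division for this
  reason.\<close>

lemma has_value_at_Fract:
  assumes "g \<noteq> 0" "has_value_at (to_fract f / to_fract g) a y"
  shows "poly f a = y * poly g a"
proof -
  obtain f' g' where fg: "to_fract f / to_fract g = Fract f' g'" "poly g' a \<noteq> 0" "y = poly f' a / poly g' a"
    using assms(2) unfolding has_value_at_def by blast
  have "g' \<noteq> 0" using fg(2) by auto
  then have "to_fract (f * g') = to_fract (f' * g)"
    using fg(1) assms(1) unfolding Fract_to_fract by (simp add: field_simps)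
  then have "f * g' = f' * g" by (simp only: to_fract_eq_iff)
  then have "poly f a * poly g' a = poly f' a * poly g a" by (metis poly_mult)
  then have "poly f a = (poly f' a * poly g a) / poly g' a" using fg(2) by (simp add: eq_divide_eq)
  then show ?thesis using fg(3) by simp
qed

lemma has_value_atI:
  "poly g a \<noteq> 0 \<Longrightarrow> has_value_at (to_fract f / to_fract g) a (poly f a / poly g a)"
  unfolding has_value_at_def Fract_to_fract by blast

context padic_closure
begin

subsection \<open>Adjoining an algebraic element\<close>

definition Qp_span :: "'c \<Rightarrow> nat \<Rightarrow> 'c set" where
  "Qp_span \<alpha> d = {\<Sum>i<d. c i * \<alpha> ^ i | c. \<forall>i. c i \<in> Qp}"

lemma fin_space_Qp_span: "fin_space (Qp_span \<alpha> d)"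
proof (induction d)
  case 0
  have "Qp_span \<alpha> 0 = {0}" using QpD(1) by (auto simp: Qp_span_def)
  then show ?case by (simp add: fin_space_0)
next
  case (Suc d)
  have "Qp_span \<alpha> (Suc d) = {k * \<alpha> ^ d + s | k s. k \<in> Qp \<and> s \<in> Qp_span \<alpha> d}" (is "?L = ?R")
  proof
    show "?L \<subseteq> ?R"
    proof
      fix x assume "x \<in> ?L"
      then obtain c where c: "x = (\<Sum>i<Suc d. c i * \<alpha> ^ i)" "\<forall>i. c i \<in> Qp" by (auto simp: Qp_span_def)
      have "x = c d * \<alpha> ^ d + (\<Sum>i<d. c i * \<alpha> ^ i)" unfolding c(1) by simp
      moreover have "(\<Sum>i<d. c i * \<alpha> ^ i) \<in> Qp_span \<alpha> d" using c(2) by (auto simp: Qp_span_def)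
      ultimately show "x \<in> ?R" using c(2) by blast
    qed
    show "?R \<subseteq> ?L"
    proof
      fix x assume "x \<in> ?R"
      then obtain k c where c: "x = k * \<alpha> ^ d + (\<Sum>i<d. c i * \<alpha> ^ i)" "k \<in> Qp" "\<forall>i. c i \<in> Qp"
        by (auto simp: Qp_span_def)
      have "x = (\<Sum>i<Suc d. (c(d := k)) i * \<alpha> ^ i)" unfolding c(1) by simp
      then show "x \<in> ?L" unfolding Qp_span_def using c(2,3)
        by (intro CollectI exI[of _ "c(d := k)"]) auto
    qed
  qed
  then show ?case using fin_space_adjoin[OF Suc] by simp
qed

definition Qp_poly_values :: "'c \<Rightarrow> 'c set" where
  "Qp_poly_values \<alpha> = {poly f \<alpha> | f. f \<in> polys Qp}"

lemma algebraic_over_Qp: "\<exists>g\<in>polys Qp. g \<noteq> 0 \<and> poly g \<alpha> = 0"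
proof -
  obtain g where "g \<noteq> 0" "set (coeffs g) \<subseteq> Qp" "poly g \<alpha> = 0"
    using closure unfolding padic_algebraic_closure_def by blast
  then show ?thesis using coeffs_subset_iff[OF QpD(1), of g] by blast
qed

text \<open>An equation of \<alpha> of some degree \<open>d\<close> puts \<open>\<alpha> ^ d\<close>
  into the span of the lower powers, which is then stable under multiplication by \<alpha>. A
  spanning set is enough, so the equation may be any one rather than the minimal one.\<close>

lemma Qp_poly_values_span: "\<exists>d. Qp_poly_values \<alpha> = Qp_span \<alpha> d"
proof -
  obtain g where g: "g \<in> polys Qp" "g \<noteq> 0" "poly g \<alpha> = 0" using algebraic_over_Qp by blast
  define d where "d = degree g"
  let ?S = "Qp_span \<alpha> d"
  have S: "fin_space ?S" by (rule fin_space_Qp_span)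
  have S0: "0 \<in> ?S" and Sadd: "\<And>x y. x \<in> ?S \<Longrightarrow> y \<in> ?S \<Longrightarrow> x + y \<in> ?S"
    and Smult: "\<And>k x. k \<in> Qp \<Longrightarrow> x \<in> ?S \<Longrightarrow> k * x \<in> ?S"
    using S unfolding fin_space_def by blast+
  have Ssum: "sum f A \<in> ?S" if "\<And>i. i \<in> A \<Longrightarrow> f i \<in> ?S" for f and A :: "nat set"
    using that by (induction A rule: infinite_finite_induct) (auto simp: S0 Sadd)
  have low: "\<alpha> ^ i \<in> ?S" if "i < d" for i
  proof -
    have "\<alpha> ^ i = (\<Sum>j<d. (if j = i then 1 else 0) * \<alpha> ^ j)"
      using that by (subst sum.remove[of _ i]) auto
    then show ?thesis unfolding Qp_span_def using QpD(1,2)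
      by (intro CollectI exI[of _ "\<lambda>j. if j = i then 1 else 0"]) auto
  qed
  have lc: "lead_coeff g \<noteq> 0" using g(2) by simp
  have top: "\<alpha> ^ d \<in> ?S"
  proof -
    have "(\<Sum>i<d. coeff g i * \<alpha> ^ i) + coeff g d * \<alpha> ^ d = 0"
      using g(3) unfolding poly_altdef d_def lessThan_Suc_atMost[symmetric] by simp
    then have "coeff g d * \<alpha> ^ d = - (\<Sum>i<d. coeff g i * \<alpha> ^ i)"
      by (simp add: eq_neg_iff_add_eq_0 add.commute)
    then have "\<alpha> ^ d = - (\<Sum>i<d. coeff g i * \<alpha> ^ i) / coeff g d"
      using lc by (simp add: d_def field_simps)
    also have "\<dots> = (\<Sum>i<d. (- (coeff g i / coeff g d)) * \<alpha> ^ i)"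
      by (simp add: sum_divide_distrib sum_negf)
    also have "\<dots> \<in> ?S"
      using low polysD[OF g(1)] by (intro Ssum Smult QpD) auto
    finally show ?thesis .
  qed
  have shift: "\<alpha> * x \<in> ?S" if "x \<in> ?S" for x
  proof -
    obtain c where c: "x = (\<Sum>i<d. c i * \<alpha> ^ i)" "\<forall>i. c i \<in> Qp"
      using \<open>x \<in> ?S\<close> by (auto simp: Qp_span_def)
    have "\<alpha> * x = (\<Sum>i<d. c i * \<alpha> ^ Suc i)" unfolding c(1) by (simp add: sum_distrib_left mult_ac)
    also have "\<dots> \<in> ?S"
    proof (rule Ssum, rule Smult)
      fix i assume "i \<in> {..<d}"
      then have "Suc i < d \<or> Suc i = d" by auto
      then show "\<alpha> ^ Suc i \<in> ?S" using low top by metis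
    qed (use c(2) in auto)
    finally show ?thesis .
  qed
  have d0: "d > 0"
  proof (rule ccontr)
    assume "\<not> d > 0"
    then obtain c where "g = [:c:]" unfolding d_def using degree_eq_zeroE by blast
    then show False using g(2,3) by simp
  qed
  have "poly f \<alpha> \<in> ?S" if "f \<in> polys Qp" for f
    using that
  proof (induction f)
    case (pCons a f)
    have a: "a \<in> Qp" "f \<in> polys Qp"
      using polysD[OF pCons.prems, of 0] polysD[OF pCons.prems, of "Suc i" for i] by (auto intro: polysI)
    have "a * \<alpha> ^ 0 + \<alpha> * poly f \<alpha> \<in> ?S"
      using Smult[OF a(1) low[OF d0]] shift[OF pCons.IH[OF a(2)]] by (rule Sadd)
    then show ?case by simp
  qed (simp add: S0)
  moreover have "x \<in> Qp_poly_values \<alpha>" if "x \<in> ?S" for x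
  proof -
    obtain c where c: "x = (\<Sum>i<d. c i * \<alpha> ^ i)" "\<forall>i. c i \<in> Qp"
      using \<open>x \<in> ?S\<close> by (auto simp: Qp_span_def)
    have "x = poly (\<Sum>i<d. monom (c i) i) \<alpha>" unfolding c(1) by (simp add: poly_sum poly_monom)
    moreover have "(\<Sum>i<d. monom (c i) i) \<in> polys Qp"
      using c(2) by (intro polys_closed(11)[OF Qp_subfield] polys_closed(9)[OF Qp_subfield]) auto
    ultimately show ?thesis unfolding Qp_poly_values_def by blast
  qed
  ultimately have "Qp_poly_values \<alpha> = ?S" by (auto simp: Qp_poly_values_def)
  then show ?thesis by blast
qed

lemma tot_bounded_Qp_poly_values: "tot_bounded (Qp_poly_values \<alpha>)"
  using Qp_poly_values_span[of \<alpha>] fin_space_Qp_span unfolding fin_space_def by metis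

lemma Qp_poly_values_subfield: "is_subfield (Qp_poly_values \<alpha>)"
proof (rule is_subfieldI)
  note P = polys_closed[OF Qp_subfield]
  have I: "poly f \<alpha> \<in> Qp_poly_values \<alpha>" if "f \<in> polys Qp" for f
    using that by (auto simp: Qp_poly_values_def)
  show "0 \<in> Qp_poly_values \<alpha>" "1 \<in> Qp_poly_values \<alpha>" using I[OF P(1)] I[OF P(2)] by auto
  fix x assume "x \<in> Qp_poly_values \<alpha>"
  then obtain f where f: "f \<in> polys Qp" "x = poly f \<alpha>" by (auto simp: Qp_poly_values_def)
  show "- x \<in> Qp_poly_values \<alpha>" using I[OF P(5)[OF f(1)]] f(2) by simp
  show "inverse x \<in> Qp_poly_values \<alpha>" if x0: "x \<noteq> 0"
  proof -
    \<comment> \<open>An equation of least degree for \<open>x\<close> has a nonzero constant term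
      \<open>a\<close>, since otherwise a factor \<open>x\<close> could be cancelled. Solving
      \<open>a + x * k(x) = 0\<close> for the inverse gives a polynomial in \<open>x\<close>, hence
      in \<alpha>.\<close>
    let ?P = "\<lambda>h. h \<in> polys Qp \<and> h \<noteq> 0 \<and> poly h x = 0"
    have "\<exists>h. ?P h" using algebraic_over_Qp by blast
    then obtain h where h: "?P h" "\<And>k. ?P k \<Longrightarrow> degree h \<le> degree k"
      using ex_has_least_nat[of ?P _ degree] by metis
    obtain a k where hk: "h = pCons a k" by (cases h)
    have a: "a \<in> Qp" "k \<in> polys Qp"
      using polysD[of h Qp 0] polysD[of h Qp "Suc i" for i] h(1) hk by (auto intro: polysI)
    have a0: "a \<noteq> 0"
    proof
      assume "a = 0"
      then have "?P k" using h(1) hk a(2) x0 by auto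
      moreover have "degree k < degree h" using \<open>a = 0\<close> h(1) hk by auto
      ultimately show False using h(2)[of k] by simp
    qed
    have "a + x * poly k x = 0" using h(1) hk by simp
    then have "- (x * poly k x) = a" by (simp add: neg_eq_iff_add_eq_0 add.commute)
    moreover have "x * (- poly k x / a) = - (x * poly k x) / a" by simp
    ultimately have "x * (- poly k x / a) = a / a" by presburger
    then have "x * (- poly k x / a) = 1" using a0 by simp
    then have "inverse x = - poly k x / a" by (metis inverse_unique)
    also have "\<dots> = poly (smult (- inverse a) (pcompose k f)) \<alpha>"
      by (simp add: poly_pcompose f(2) divide_inverse)
    also have "\<dots> \<in> Qp_poly_values \<alpha>"
      by (intro I P(7,13) QpD(5,6) a f)
    finally show ?thesis .
  qed
  fix y assume "y \<in> Qp_poly_values \<alpha>"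
  then obtain g where g: "g \<in> polys Qp" "y = poly g \<alpha>" by (auto simp: Qp_poly_values_def)
  show "x + y \<in> Qp_poly_values \<alpha>" using I[OF P(3)[OF f(1) g(1)]] f(2) g(2) by simp
  show "x * y \<in> Qp_poly_values \<alpha>" using I[OF P(4)[OF f(1) g(1)]] f(2) g(2) by simp
qed

end

section \<open>Residually algebraic torsion extensions\<close>

locale padic_ext = padic_closure p v
  for p :: nat and v :: "'c::{alg_closed_field,field_char_0} \<Rightarrow> ereal" +
  fixes W :: "'c poly fract set" and w :: "'c poly fract \<Rightarrow> ereal"
  assumes ext: "valuation_domain_extension p W"
    and res: "residually_algebraic p W"
    and norm: "normalized_valuation p W w"
    and tors: "value_group (rat_funs \<rat>) w \<subseteq> \<rat>"
begin

abbreviation QX :: "'c poly fract set" where "QX \<equiv> rat_funs \<rat>"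
abbreviation M :: "'c poly fract \<Rightarrow> real" where "M \<equiv> nrm w"

lemma QX_subfield: "is_subfield QX"
  by (rule rat_funs_subfield[OF is_subfield_Rats])

lemma w_valuation: "valuation_on QX w"
  using norm by (simp add: normalized_valuation_def)

sublocale w: ultranorm QX M
  by (rule nrm_ultranorm[OF QX_subfield w_valuation])

lemma W_vring: "W = w.vring"
proof -
  have "W = {\<phi> \<in> QX. w \<phi> \<ge> 0}" using norm by (simp add: normalized_valuation_def)
  then show ?thesis using valuation_nrm(4)[OF w_valuation] by (auto simp: w.mem_vring)
qed

lemma M_const: "M (const_fun (of_rat q)) = N (of_rat q)"
proof -
  have "w (const_fun (of_rat q)) = rat_val p q" using norm by (simp add: normalized_valuation_def)
  moreover have "v (of_rat q) = rat_val p q" using closure unfolding padic_algebraic_closure_def by blast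
  ultimately show ?thesis by (simp add: nrm_def)
qed

lemma M_torsion:
  assumes "\<phi> \<in> QX" "\<phi> \<noteq> 0"
  shows "\<exists>n>0. \<exists>k. M \<phi> ^ n = N (of_nat p) powi k"
proof -
  obtain r where r: "w \<phi> = ereal r"
    using w_valuation assms unfolding valuation_on_def by (cases "w \<phi>") auto
  then have "r \<in> \<rat>" using tors assms unfolding value_group_def by blast
  then obtain a b where ab: "r = of_int a / of_int b" "b > 0"
    by (auto elim!: Rats_cases' )
  have "M \<phi> = exp (- r)" using r valuation_nrm(3)[OF w_valuation assms(1)] by simp
  then have "M \<phi> ^ nat b = exp (real (nat b) * (- r))" by (simp only: exp_of_nat_mult)
  also have "real (nat b) * (- r) = of_int (- a) * 1" using ab by simp
  finally have "M \<phi> ^ nat b = N (of_nat p) powi a" unfolding N_p exp_powi by simp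
  then show ?thesis using ab(2) by (intro exI[of _ "nat b"]) auto
qed

lemma Z_loc_funs_eq: "Z_loc_funs p = {const_fun c | c :: 'c. c \<in> \<rat> \<and> N c \<le> 1}"
proof -
  have "Z_loc_funs p = W \<inter> const_fun ` \<rat>"
    using ext by (simp add: valuation_domain_extension_def)
  also have "\<dots> = {const_fun c | c. c \<in> \<rat> \<and> N c \<le> 1}"
    using M_const const_QX[where 'a='c] by (auto simp: W_vring w.mem_vring elim!: Rats_cases)
  finally show ?thesis .
qed

lemma const_vring: "c \<in> \<rat> \<Longrightarrow> N c \<le> 1 \<Longrightarrow> const_fun c \<in> w.vring"
  using M_const const_QX[where 'a='c] by (auto simp: w.mem_vring elim!: Rats_cases)

lemma Z_loc_funs_subring: "subring (Z_loc_funs p) (ring_on w.vring)"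
proof (rule w.V.subringI)
  show "Z_loc_funs p \<subseteq> carrier (ring_on w.vring)" unfolding Z_loc_funs_eq using const_vring by auto
  have I: "const_fun c \<in> Z_loc_funs p" if "c \<in> \<rat>" "N c \<le> 1" for c :: 'c
    unfolding Z_loc_funs_eq using that by blast
  show "\<one>\<^bsub>ring_on w.vring\<^esub> \<in> Z_loc_funs p" using I[of 1] by simp
  fix x :: "'c poly fract" assume "x \<in> Z_loc_funs p"
  then obtain a where a: "x = const_fun a" "a \<in> \<rat>" "N a \<le> 1" unfolding Z_loc_funs_eq by blast
  have "\<ominus>\<^bsub>ring_on w.vring\<^esub> x = - x"
    using const_vring a w.vring_closed(5) by (intro ring_on_a_inv w.V.cring_axioms) auto
  then show "\<ominus>\<^bsub>ring_on w.vring\<^esub> x \<in> Z_loc_funs p" using I[of "- a"] a by simp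
  fix y :: "'c poly fract" assume "y \<in> Z_loc_funs p"
  then obtain b where b: "y = const_fun b" "b \<in> \<rat>" "N b \<le> 1" unfolding Z_loc_funs_eq by blast
  show "x \<otimes>\<^bsub>ring_on w.vring\<^esub> y \<in> Z_loc_funs p"
    using I[of "a * b"] a b N.nonneg by (simp add: N.mult mult_le_one)
  show "x \<oplus>\<^bsub>ring_on w.vring\<^esub> y \<in> Z_loc_funs p"
    using I[of "a + b"] a b N.add[of a b] by simp
qed

lemma residue_prime_field_subring: "subring (residue_prime_field p W) (residue_field w.vring)"
  unfolding residue_prime_field_def W_vring by (rule w.k.img_is_subring[OF Z_loc_funs_subring])

lemma strip_small_coeffs:
  assumes "h \<in> polys \<rat>" "\<And>i. N (coeff h i) \<le> 1" "N (coeff h j) = 1"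
    and \<psi>: "\<psi> \<in> polys \<rat>" "M (to_fract \<psi>) = 1" and "M (to_fract (pcompose h \<psi>)) < 1"
  shows "\<exists>h\<in>polys \<rat>. N (coeff h 0) = 1 \<and> M (to_fract (pcompose h \<psi>)) < 1"
  using assms(1,2,3,6)
proof (induction h arbitrary: j)
  case (pCons a h)
  show ?case
  proof (cases "N a = 1")
    case True
    then show ?thesis using pCons.prems by (intro bexI[of _ "pCons a h"]) auto
  next
    case False
    then have a: "N a < 1" using pCons.prems(2)[of 0] by simp
    have aR: "a \<in> \<rat>" and hR: "h \<in> polys \<rat>"
      using polysD[OF pCons.prems(1), of 0] polysD[OF pCons.prems(1), of "Suc i" for i] by (auto intro: polysI)
    have Ma: "M (const_fun a) < 1" using a aR M_const by (auto elim!: Rats_cases)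
    obtain i where j: "j = Suc i" using False pCons.prems(3) by (cases j) auto
    have in_QX: "to_fract \<psi> \<in> QX" "to_fract (pcompose h \<psi>) \<in> QX" "const_fun a \<in> QX"
      using \<psi>(1) hR aR by (auto intro!: to_fract_QX const_QX polys_closed(13)[OF is_subfield_Rats])
    have "to_fract (pcompose (pCons a h) \<psi>) = const_fun a + to_fract \<psi> * to_fract (pcompose h \<psi>)"
      by (simp add: pcompose_pCons const_fun_to_fract)
    then have "to_fract \<psi> * to_fract (pcompose h \<psi>) = to_fract (pcompose (pCons a h) \<psi>) - const_fun a"
      by simp
    moreover have "M (to_fract (pcompose (pCons a h) \<psi>) - const_fun a) < 1"
    proof -
      have "to_fract (pcompose (pCons a h) \<psi>) \<in> QX"
        by (intro to_fract_QX polys_closed(13)[OF is_subfield_Rats] pCons.prems \<psi>)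
      then show ?thesis using w.diff[OF _ in_QX(3)] pCons.prems(4) Ma by fastforce
    qed
    ultimately have "M (to_fract (pcompose h \<psi>)) < 1" using w.mult[OF in_QX(1,2)] \<psi>(2) by simp
    then show ?thesis
      using pCons.IH[OF hR, of i] pCons.prems(2)[of "Suc _"] pCons.prems(3) j by simp
  qed
qed simp

text \<open>The residue of \<psi> satisfies an equation over the prime field, whose coefficients
  lift to integral rationals. As evaluation commutes with residues, the lifted polynomial is small
  at \<psi>. Its leading coefficient lifts a nonzero residue and so has norm one, which is enough
  for \<open>strip_small_coeffs\<close>.\<close>

lemma M_resid_alg:
  assumes \<psi>: "\<psi> \<in> polys \<rat>" "M (to_fract \<psi>) = 1"
  shows "\<exists>h\<in>polys \<rat>. N (coeff h 0) = 1 \<and> M (to_fract (pcompose h \<psi>)) < 1"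
proof -
  let ?F = "residue_prime_field p W"
  let ?r = "residue_class w.vring"
  define z where "z = ?r (to_fract \<psi>)"
  have \<psi>V: "to_fract \<psi> \<in> w.vring"
    using to_fract_QX[OF \<psi>(1)] \<psi>(2) by (simp add: w.mem_vring)
  then have zk: "z \<in> carrier (residue_field w.vring)" by (auto simp: z_def w.carrier_residue_field)
  then have alg: "ring.algebraic (residue_field w.vring) ?F z"
    using res unfolding residually_algebraic_def W_vring by blast
  then have alg: "(w.k.algebraic over ?F) z" by (simp add: over_def)
  obtain P where P: "P \<in> carrier (?F[X]\<^bsub>residue_field w.vring\<^esub>)" "P \<noteq> []"
    "w.k.eval P z = \<zero>\<^bsub>residue_field w.vring\<^esub>"
    by (rule w.k.algebraicE[OF residue_prime_field_subring zk alg])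
  have PF: "set P \<subseteq> ?F" "hd P \<noteq> \<zero>\<^bsub>residue_field w.vring\<^esub>"
    using P(1,2) unfolding univ_poly_carrier[symmetric] polynomial_def by auto
  have "\<exists>c. c \<in> \<rat> \<and> N c \<le> 1 \<and> x = ?r (const_fun c)" if "x \<in> ?F" for x
    using that unfolding residue_prime_field_def W_vring Z_loc_funs_eq by blast
  then obtain g where g: "\<And>x. x \<in> ?F \<Longrightarrow> g x \<in> \<rat> \<and> N (g x) \<le> 1 \<and> x = ?r (const_fun (g x))" by metis
  define cs where "cs = map g P"
  have csR: "c \<in> \<rat> \<and> N c \<le> 1" if "c \<in> set cs" for c using that g PF(1) unfolding cs_def by auto
  have Pcs: "P = map ?r (map const_fun cs)"
    unfolding cs_def using g PF(1) by (induction P) auto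
  have csV: "set (map const_fun cs) \<subseteq> carrier (ring_on w.vring)"
    using csR const_vring by auto
  \<comment> \<open>The list \<open>P\<close> starts with the leading coefficient, while
    \<open>Poly\<close> expects the constant one first.\<close>
  define h where "h = Poly (rev cs)"
  have coeff_h: "coeff h i \<in> insert 0 (set cs)" for i
    by (auto simp: h_def nth_default_def intro: nth_mem[of _ "rev cs", simplified])
  have h1: "coeff h i \<in> \<rat>" "N (coeff h i) \<le> 1" for i using coeff_h[of i] csR by auto
  have ev: "ring.eval (ring_on w.vring) (map const_fun cs) (to_fract \<psi>) = to_fract (pcompose h \<psi>)"
    unfolding h_def
  proof (induction cs)
    case (Cons c cs)
    have "to_fract (pcompose (Poly (rev (c # cs))) \<psi>) =
        to_fract (pcompose (Poly (rev cs)) \<psi>) + to_fract \<psi> ^ length cs * const_fun c"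
    proof -
      have "pcompose (monom 1 n) \<psi> = \<psi> ^ n" for n
        by (induction n) (auto simp: monom_Suc pcompose_pCons pcompose_1)
      then show ?thesis
        by (simp add: Poly_append pcompose_add pcompose_smult to_fract_power to_fract_smult mult.commute)
    qed
    then show ?case using Cons by (simp add: ring_on_nat_pow add.commute mult.commute)
  qed simp
  have "?r (to_fract (pcompose h \<psi>)) = \<zero>\<^bsub>residue_field w.vring\<^esub>"
    using w.k.eval_hom'[of "to_fract \<psi>" "map const_fun cs"] \<psi>V csV P(3) unfolding ev Pcs z_def by simp
  moreover have "to_fract (pcompose h \<psi>) \<in> w.vring"
    using w.V.eval_in_carrier[OF csV, of "to_fract \<psi>"] \<psi>V unfolding ev by simp
  ultimately have small: "M (to_fract (pcompose h \<psi>)) < 1" using w.residue_zero_iff by blast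
  have "coeff h (length P - 1) = g (hd P)"
    unfolding h_def cs_def using P(2) by (cases P) (auto simp: nth_default_def nth_append)
  moreover have "N (g (hd P)) = 1"
  proof -
    have hF: "hd P \<in> ?F" using PF(1) P(2) by auto
    have "\<not> M (const_fun (g (hd P))) < 1"
      using g[OF hF] PF(2) w.residue_zero_iff[OF const_vring] by metis
    then show ?thesis using g[OF hF] M_const by (force elim: Rats_cases)
  qed
  ultimately show ?thesis
    using strip_small_coeffs[OF _ h1(2) _ \<psi> small, of "length P - 1"] h1(1) by (simp add: polysI)
qed

sublocale rat_ext N M p
proof
  show "M (const_fun (of_rat q)) = N (of_rat q)" for q by (rule M_const)
  show "0 < N (of_nat p)" "N (of_nat p) < 1" by (fact N_p_bounds)+
qed (fact M_torsion M_resid_alg)+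

end

lemma has_value_at_unique: "has_value_at \<phi> a y \<Longrightarrow> has_value_at \<phi> a z \<Longrightarrow> y = z"
proof -
  assume "has_value_at \<phi> a y" and z: "has_value_at \<phi> a z"
  then obtain f g where fg: "\<phi> = Fract f g" "poly g a \<noteq> 0" "y = poly f a / poly g a"
    unfolding has_value_at_def by blast
  then have "g \<noteq> 0" by auto
  from has_value_at_Fract[OF this, of f a z] z fg show "y = z"
    by (simp add: Fract_to_fract)
qed

lemma has_value_at_arith:
  assumes "has_value_at \<phi> a y" "has_value_at \<psi> a z"
  shows "has_value_at (\<phi> + \<psi>) a (y + z)" "has_value_at (\<phi> - \<psi>) a (y - z)" "has_value_at (\<phi> * \<psi>) a (y * z)"
proof -
  obtain f g where fg: "\<phi> = Fract f g" "poly g a \<noteq> 0" "y = poly f a / poly g a"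
    using assms(1) unfolding has_value_at_def by blast
  obtain h k where hk: "\<psi> = Fract h k" "poly k a \<noteq> 0" "z = poly h a / poly k a"
    using assms(2) unfolding has_value_at_def by blast
  have nz: "g \<noteq> 0" "k \<noteq> 0" using fg(2) hk(2) by auto
  have 1: "\<phi> + \<psi> = Fract (f * k + h * g) (g * k)" "\<phi> - \<psi> = Fract (f * k - h * g) (g * k)"
    "\<phi> * \<psi> = Fract (f * h) (g * k)"
    using nz unfolding fg(1) hk(1) by simp_all
  have v: "has_value_at (Fract u (g * k)) a (poly u a / (poly g a * poly k a))" for u
    using has_value_atI[of "g * k" a u] fg(2) hk(2) unfolding Fract_to_fract by simp
  have "y + z = poly (f * k + h * g) a / (poly g a * poly k a)"
    "y - z = poly (f * k - h * g) a / (poly g a * poly k a)"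
    "y * z = poly (f * h) a / (poly g a * poly k a)"
    unfolding fg(3) hk(3) using fg(2) hk(2) by (simp_all add: field_simps)
  then show "has_value_at (\<phi> + \<psi>) a (y + z)" "has_value_at (\<phi> - \<psi>) a (y - z)"
    "has_value_at (\<phi> * \<psi>) a (y * z)"
    unfolding 1 using v by metis+
qed

context padic_closure
begin

subsection \<open>Pseudo-convergent sequences\<close>

definition pseudo :: "(nat \<Rightarrow> 'c) \<Rightarrow> bool" where
  "pseudo E \<longleftrightarrow> (\<forall>n m k. n < m \<longrightarrow> m < k \<longrightarrow> N (E m - E k) < N (E n - E m))"

lemma pseudo_iff: "pseudo_convergent v E \<longleftrightarrow> pseudo E"
  unfolding pseudo_convergent_def pseudo_def by (auto simp: v_less)

lemma pseudoD: "pseudo E \<Longrightarrow> n < m \<Longrightarrow> m < k \<Longrightarrow> N (E m - E k) < N (E n - E m)"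
  unfolding pseudo_def by blast

lemma pseudo_pos: "pseudo E \<Longrightarrow> n < m \<Longrightarrow> 0 < N (E n - E m)"
  using pseudoD[of E n m "Suc m"] N.nonneg[of "E m - E (Suc m)"] by simp

text \<open>Later terms are closer to one another than to \<open>E n\<close>, so the isosceles
  principle applies.\<close>

lemma pseudo_dist:
  assumes "pseudo E" "n < m" "n < k"
  shows "N (E n - E m) = N (E n - E k)"
proof -
  have le: "N (E n - E k) = N (E n - E m)" if "m < k" "n < m" for m k
  proof (rule N.close_eq)
    show "N ((E n - E m) - (E n - E k)) < N (E n - E m)"
      using pseudoD[OF assms(1) that(2,1)] N.diff_commute[of "E m" "E k"] by simp
  qed auto
  show ?thesis using le[of m k] le[of k m] assms(2,3) by (cases m k rule: linorder_cases) auto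
qed

lemma pseudo_decreasing:
  assumes "pseudo E" "n < m" shows "N (E m - E (Suc m)) < N (E n - E (Suc n))"
proof -
  have "N (E m - E (Suc m)) < N (E n - E m)" by (rule pseudoD[OF assms]) simp
  then show ?thesis using pseudo_dist[OF assms, of "Suc n"] by simp
qed

lemma pseudo_bounded:
  assumes "pseudo E" obtains R where "R \<ge> 1" "\<And>n. N (E n) \<le> R"
proof
  define R where "R = max 1 (max (N (E 0)) (N (E 0 - E 1)))"
  show "R \<ge> 1" by (simp add: R_def)
  show "N (E n) \<le> R" for n
  proof (cases "n = 0")
    case False
    then have "N (E 0 - E n) = N (E 0 - E 1)" using pseudo_dist[OF assms, of 0 n 1] by simp
    then show ?thesis using N.diff[of "E 0" "E 0 - E n"] by (auto simp: R_def)
  qed (simp add: R_def)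
qed

lemma poly_bound:
  assumes "\<And>i. N (coeff f i) \<le> \<epsilon>" "degree f \<le> d" "R \<ge> 1" "N x \<le> R"
  shows "N (poly f x) \<le> \<epsilon> * R ^ d"
  unfolding poly_altdef
proof (rule N.sum_le)
  have \<epsilon>: "\<epsilon> \<ge> 0" using assms(1)[of 0] N.nonneg[of "coeff f 0"] by simp
  then show "0 \<le> \<epsilon> * R ^ d" using assms(3) by simp
  fix i assume "i \<in> {..degree f}"
  then have "N x ^ i \<le> R ^ d"
    using assms(2,3,4) N.nonneg[of x] power_mono[of "N x" R i] power_increasing[of i d R] by auto
  then show "N (coeff f i * x ^ i) \<le> \<epsilon> * R ^ d"
    using assms(1)[of i] \<epsilon> N.nonneg by (simp add: N.mult N.power mult_mono)
qed auto

lemma poly_bounded: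
  assumes "R \<ge> 1" obtains B where "B > 0" "\<And>x. N x \<le> R \<Longrightarrow> N (poly f x) \<le> B"
proof
  define \<epsilon> where "\<epsilon> = Max (insert 1 ((\<lambda>i. N (coeff f i)) ` {..degree f}))"
  have \<epsilon>: "\<epsilon> \<ge> 1" by (simp add: \<epsilon>_def)
  have c: "N (coeff f i) \<le> \<epsilon>" for i
  proof (cases "i \<le> degree f")
    case True
    then show ?thesis unfolding \<epsilon>_def by (intro Max_ge) auto
  next
    case False
    then show ?thesis using \<epsilon> by (simp add: coeff_eq_0)
  qed
  show "\<epsilon> * R ^ degree f > 0" using \<epsilon> assms by simp
  show "N (poly f x) \<le> \<epsilon> * R ^ degree f" if "N x \<le> R" for x
    using poly_bound[OF c order_refl assms that] .
qed

text \<open>The difference \<open>f - f(\<alpha>)\<close> has the factor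
  \<open>X - \<alpha>\<close>, and the cofactor is bounded near \<alpha>.\<close>

lemma poly_converges:
  assumes "v_converges v s \<alpha>" shows "v_converges v (\<lambda>n. poly f (s n)) (poly f \<alpha>)"
proof -
  have "poly (f - [:poly f \<alpha>:]) \<alpha> = 0" by simp
  then obtain q where q: "f - [:poly f \<alpha>:] = [:-\<alpha>, 1:] * q"
    unfolding poly_eq_0_iff_dvd by (elim dvdE)
  have fq: "poly f x - poly f \<alpha> = (x - \<alpha>) * poly q x" for x
    using arg_cong[OF q, of "\<lambda>h. poly h x"] by (simp add: algebra_simps)
  define R where "R = max 1 (N \<alpha>)"
  obtain B where B: "B > 0" "\<And>x. N x \<le> R \<Longrightarrow> N (poly q x) \<le> B"
    using poly_bounded[of R q] by (auto simp: R_def)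
  show ?thesis unfolding v_converges_iff
  proof (intro allI impI)
    fix \<epsilon> :: real assume "\<epsilon> > 0"
    then have "min 1 (\<epsilon> / B) > 0" using B(1) by simp
    then obtain n0 where n0: "\<And>n. n \<ge> n0 \<Longrightarrow> N (s n - \<alpha>) < min 1 (\<epsilon> / B)"
      using assms unfolding v_converges_iff by meson
    have "N (poly f (s n) - poly f \<alpha>) < \<epsilon>" if "n \<ge> n0" for n
    proof -
      have 1: "N (s n - \<alpha>) < 1" "N (s n - \<alpha>) < \<epsilon> / B" using n0[OF that] by auto
      have "N (s n) \<le> R" using N.add[of "s n - \<alpha>" \<alpha>] 1(1) by (auto simp: R_def)
      then have "N (s n - \<alpha>) * N (poly q (s n)) \<le> N (s n - \<alpha>) * B"
        using B(2) N.nonneg by (intro mult_left_mono) auto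
      also have "\<dots> < \<epsilon>" using 1(2) B(1) by (simp add: pos_less_divide_eq)
      finally show ?thesis unfolding fq N.mult[OF UNIV_I UNIV_I] .
    qed
    then show "\<exists>n0. \<forall>n\<ge>n0. N (poly f (s n) - poly f \<alpha>) < \<epsilon>" by blast
  qed
qed

lemma poly_factors:
  assumes "f \<noteq> 0"
  obtains c A where "c \<noteq> 0" "\<And>x. poly f x = 0 \<longleftrightarrow> x \<in># A" "\<And>a. N (poly f a) = N c * (\<Prod>x\<in>#A. N (a - x))"
proof -
  obtain A where A: "f = smult (lead_coeff f) (\<Prod>x\<in>#A. [:-x, 1:])"
    using alg_closed_imp_factorization[OF assms] by blast
  define c where "c = lead_coeff f"
  have fc: "poly f a = c * (\<Prod>x\<in>#A. a - x)" for a
    using arg_cong[OF A, of "\<lambda>f. poly f a"]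
    by (simp add: poly_prod_mset image_mset.compositionality o_def c_def)
  have c0: "c \<noteq> 0" using assms c_def by simp
  have "N (\<Prod>x\<in>#A. a - x) = (\<Prod>x\<in>#A. N (a - x))" for a
    by (induction A) (auto simp: N.mult)
  then have "N (poly f a) = N c * (\<Prod>x\<in>#A. N (a - x))" for a
    by (simp add: fc N.mult)
  moreover have "poly f x = 0 \<longleftrightarrow> x \<in># A" for x
    using c0 by (auto simp: fc prod_mset_zero_iff)
  ultimately show thesis using that[OF c0] by blast
qed

text \<open>Up to a constant, the norm of \<open>poly g (E n)\<close> is a product of distances to
  the finitely many roots of \<open>g\<close>. If the sequence stayed away from all of them, the
  values would be bounded below. A root that a pseudo-convergent sequence approaches infinitely
  often is already its limit.\<close>

lemma small_values_limit:
  assumes E: "pseudo E" and g: "g \<noteq> 0"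
    and small: "\<And>\<epsilon> n0. \<epsilon> > 0 \<Longrightarrow> \<exists>n\<ge>n0. N (poly g (E n)) < \<epsilon>"
  shows "\<exists>\<alpha>. poly g \<alpha> = 0 \<and> v_converges v E \<alpha>"
proof -
  obtain c A where cA: "c \<noteq> 0" "\<And>x. poly g x = 0 \<longleftrightarrow> x \<in># A"
    "\<And>a. N (poly g a) = N c * (\<Prod>x\<in>#A. N (a - x))" using poly_factors[OF g] by metis
  have "\<exists>x\<in>#A. \<forall>\<epsilon>>0. \<forall>n0. \<exists>n\<ge>n0. N (E n - x) < \<epsilon>"
  proof (rule ccontr)
    assume "\<not> ?thesis"
    then have far: "\<exists>\<epsilon>>0. \<exists>n0. \<forall>n\<ge>n0. \<epsilon> \<le> N (E n - x)" if "x \<in># A" for x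
      using that by (meson not_le)
    have "\<exists>\<epsilon>>0. \<exists>n0. \<forall>n\<ge>n0. \<epsilon> \<le> (\<Prod>x\<in>#A. N (E n - x))"
      using far
    proof (induction A)
      case empty
      then show ?case by (intro exI[of _ 1]) auto
    next
      case (add x A)
      obtain e1 n1 where 1: "e1 > 0" "\<And>n. n \<ge> n1 \<Longrightarrow> e1 \<le> N (E n - x)" using add.prems[of x] by auto
      obtain e2 n2 where 2: "e2 > 0" "\<And>n. n \<ge> n2 \<Longrightarrow> e2 \<le> (\<Prod>x\<in>#A. N (E n - x))"
        using add.IH add.prems by auto
      have "e1 * e2 \<le> (\<Prod>x\<in>#add_mset x A. N (E n - x))" if "n \<ge> max n1 n2" for n
        using 1(2)[of n] 2(2)[of n] that 1(1) 2(1) by (simp add: mult_mono)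
      then show ?case using 1(1) 2(1) by (meson mult_pos_pos)
    qed
    then obtain e n0 where e: "e > 0" "\<And>n. n \<ge> n0 \<Longrightarrow> e \<le> (\<Prod>x\<in>#A. N (E n - x))" by blast
    have Nc: "N c > 0" using N.pos cA(1) by simp
    then obtain n where n: "n \<ge> n0" "N (poly g (E n)) < N c * e" using small[of "N c * e" n0] e(1) by auto
    have "N c * e \<le> N (poly g (E n))" unfolding cA(3) using e(2)[OF n(1)] Nc by simp
    then show False using n(2) by simp
  qed
  then obtain x where x: "x \<in># A" "\<And>\<epsilon> n0. \<epsilon> > 0 \<Longrightarrow> \<exists>n\<ge>n0. N (E n - x) < \<epsilon>" by blast
  have "v_converges v E x"
    unfolding v_converges_iff
  proof (intro allI impI)
    fix \<epsilon> :: real assume \<epsilon>: "\<epsilon> > 0"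
    obtain n where n: "N (E n - x) < \<epsilon>" using x(2)[OF \<epsilon>] by blast
    obtain m where m: "m \<ge> Suc n" "N (E m - x) < \<epsilon>" using x(2)[OF \<epsilon>] by blast
    \<comment> \<open>Two terms near \<open>x\<close> are near each other, and \<open>E n\<close>
      has the same distance to all later terms.\<close>
    have nm: "N (E n - E m) < \<epsilon>" using N.diff[of "E n - x" "E m - x"] n m(2) by simp
    have "N (E k - x) < \<epsilon>" if "k \<ge> Suc n" for k
    proof -
      have "N (E n - E k) < \<epsilon>" using pseudo_dist[OF E, of n k m] that m(1) nm by simp
      then show ?thesis using N.diff[of "E n - x" "E n - E k"] n by simp
    qed
    then show "\<exists>n0. \<forall>n\<ge>n0. N (E n - x) < \<epsilon>" by blast
  qed
  then show ?thesis using x(1) cA(2) by blast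
qed

lemma converges_cauchy:
  assumes "v_converges v s \<alpha>" shows "v_cauchy v s"
  unfolding v_cauchy_iff N_cauchy_def
proof (intro allI impI)
  fix \<epsilon> :: real assume "\<epsilon> > 0"
  then obtain n0 where n0: "\<And>n. n \<ge> n0 \<Longrightarrow> N (s n - \<alpha>) < \<epsilon>" using assms unfolding v_converges_iff by blast
  have "N (s m - s n) < \<epsilon>" if "m \<ge> n0" "n \<ge> n0" for m n
    using N.diff[of "s m - \<alpha>" "s n - \<alpha>"] n0[OF that(1)] n0[OF that(2)] by simp
  then show "\<exists>n0. \<forall>m\<ge>n0. \<forall>n\<ge>n0. N (s m - s n) < \<epsilon>" by blast
qed

text \<open>For an equation \<open>g\<close> of \<alpha> over \<open>Q_p v\<close>, the distances of
  \<open>E n\<close> to \<alpha> strictly decrease, while those to the other roots are eventually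
  constant and nonzero.\<close>

lemma converges_algebraic_type:
  assumes E: "pseudo E" and lim: "v_converges v E \<alpha>"
  shows "algebraic_type v Qp E"
proof -
  have dist: "N (E n - \<alpha>) = N (E n - E (Suc n))" for n
  proof -
    obtain n0 where n0: "\<And>m. m \<ge> n0 \<Longrightarrow> N (E m - \<alpha>) < N (E n - E (Suc n))"
      using lim pseudo_pos[OF E, of n "Suc n"] unfolding v_converges_iff by blast
    let ?m = "max n0 (Suc n)"
    have "N (E n - E ?m) = N (E n - E (Suc n))" using pseudo_dist[OF E, of n ?m "Suc n"] by simp
    then show ?thesis
      using N.close_eq[of "E n - E ?m" "E n - \<alpha>"] n0[of ?m] N.diff_commute[of "E ?m" \<alpha>] by simp
  qed
  obtain g where g: "g \<in> polys Qp" "g \<noteq> 0" "poly g \<alpha> = 0" using algebraic_over_Qp by blast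
  obtain c A where cA: "c \<noteq> 0" "\<And>x. poly g x = 0 \<longleftrightarrow> x \<in># A"
    "\<And>a. N (poly g a) = N c * (\<Prod>x\<in>#A. N (a - x))" using poly_factors[OF g(2)] by metis
  have other: "\<exists>n0. \<forall>n\<ge>n0. N (E n - x) = N (\<alpha> - x)" if "x \<noteq> \<alpha>" for x
  proof -
    have "N (\<alpha> - x) > 0" using N.pos that by simp
    then obtain n0 where n0: "\<And>n. n \<ge> n0 \<Longrightarrow> N (E n - \<alpha>) < N (\<alpha> - x)"
      using lim unfolding v_converges_iff by blast
    have "N (E n - x) = N (\<alpha> - x)" if "n \<ge> n0" for n
      using N.close_eq[of "\<alpha> - x" "E n - x"] n0[OF that] N.diff_commute[of "E n" \<alpha>] by simp
    then show ?thesis by blast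
  qed
  \<comment> \<open>Strictness comes only from the factors belonging to \<alpha>; positivity and
    weak decrease are carried along so that the induction can multiply inequalities.\<close>
  have "\<exists>n0. \<forall>m\<ge>n0. \<forall>n>m. 0 < (\<Prod>x\<in>#A. N (E n - x)) \<and>
      (\<Prod>x\<in>#A. N (E n - x)) \<le> (\<Prod>x\<in>#A. N (E m - x)) \<and>
      (\<alpha> \<in># A \<longrightarrow> (\<Prod>x\<in>#A. N (E n - x)) < (\<Prod>x\<in>#A. N (E m - x)))"
  proof (induction A)
    case (add x A)
    then obtain n1 where n1: "\<And>m n. m \<ge> n1 \<Longrightarrow> n > m \<Longrightarrow> 0 < (\<Prod>x\<in>#A. N (E n - x))"
      "\<And>m n. m \<ge> n1 \<Longrightarrow> n > m \<Longrightarrow> (\<Prod>x\<in>#A. N (E n - x)) \<le> (\<Prod>x\<in>#A. N (E m - x))"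
      "\<And>m n. m \<ge> n1 \<Longrightarrow> n > m \<Longrightarrow> \<alpha> \<in># A \<Longrightarrow> (\<Prod>x\<in>#A. N (E n - x)) < (\<Prod>x\<in>#A. N (E m - x))"
      by blast
    show ?case
    proof (cases "x = \<alpha>")
      case True
      have "N (E n - \<alpha>) > 0" for n unfolding dist by (rule pseudo_pos[OF E]) simp
      moreover have "N (E n - \<alpha>) < N (E m - \<alpha>)" if "m < n" for m n
        unfolding dist by (rule pseudo_decreasing[OF E that])
      ultimately have "0 < N (E n - \<alpha>) * (\<Prod>x\<in>#A. N (E n - x)) \<and>
          N (E n - \<alpha>) * (\<Prod>x\<in>#A. N (E n - x)) < N (E m - \<alpha>) * (\<Prod>x\<in>#A. N (E m - x))"
        if "m \<ge> n1" "n > m" for m n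
        using n1(1,2)[OF that] that(2) by (auto intro!: mult_less_le_imp_less less_imp_le)
      then show ?thesis using True by (intro exI[of _ n1]) (auto intro: less_imp_le)
    next
      case False
      then obtain n2 where n2: "\<And>n. n \<ge> n2 \<Longrightarrow> N (E n - x) = N (\<alpha> - x)" using other by blast
      have pos: "N (\<alpha> - x) > 0" using N.pos False by simp
      show ?thesis
        using n1 pos n2 False by (intro exI[of _ "max n1 n2"]) auto
    qed
  qed auto
  then obtain n0 where n0: "\<And>m n. m \<ge> n0 \<Longrightarrow> n > m \<Longrightarrow> (\<Prod>x\<in>#A. N (E n - x)) < (\<Prod>x\<in>#A. N (E m - x))"
    using cA(2)[of \<alpha>] g(3) by blast
  have "N c > 0" using N.pos cA(1) by simp
  then have "v (poly g (E m)) < v (poly g (E n))" if "n0 \<le> m" "m < n" for m n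
    unfolding v_less cA(3) using n0[OF that] by simp
  then show ?thesis
    unfolding algebraic_type_def coeffs_subset_iff[OF QpD(1)] using g(1) by blast
qed

lemma poly_approx:
  assumes "g \<in> polys Qp" "\<epsilon> > 0"
  obtains h where "h \<in> polys \<rat>" "degree h \<le> degree g" "\<And>i. N (coeff (g - h) i) \<le> \<epsilon>"
proof -
  have "\<exists>q\<in>\<rat>. N (coeff g i - q) < \<epsilon>" for i
    using polysD[OF assms(1), of i] assms(2) unfolding mem_Qp by blast
  then obtain q where q: "\<And>i. q i \<in> \<rat>" "\<And>i. N (coeff g i - q i) < \<epsilon>" by metis
  define h where "h = (\<Sum>i\<le>degree g. monom (q i) i)"
  have ch: "coeff h i = (if i \<le> degree g then q i else 0)" for i
    unfolding h_def by (simp add: coeff_sum)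
  show thesis
  proof (rule that)
    show "h \<in> polys \<rat>" using q(1) by (auto simp: polys_def ch)
    show "degree h \<le> degree g" by (rule degree_le) (auto simp: ch)
    show "N (coeff (g - h) i) \<le> \<epsilon>" for i
      using q(2)[of i] assms(2) by (auto simp: ch coeff_eq_0)
  qed
qed

lemma poly_approx_values:
  assumes "g \<in> polys Qp" "\<epsilon> > 0" "R \<ge> 1"
  obtains h where "h \<in> polys \<rat>" "degree h \<le> degree g" "\<And>x. N x \<le> R \<Longrightarrow> N (poly g x - poly h x) < \<epsilon>"
proof -
  define d where "d = degree g"
  have R: "R ^ d > 0" using assms(3) by simp
  \<comment> \<open>By \<open>poly_bound\<close>, \<open>R ^ d\<close> is the factor by which
    coefficients of norm at most a constant grow on the ball of radius \<open>R\<close>. The 2 makes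
    the final inequality strict.\<close>
  obtain h where h: "h \<in> polys \<rat>" "degree h \<le> d" "\<And>i. N (coeff (g - h) i) \<le> \<epsilon> / (2 * R ^ d)"
    using poly_approx[OF assms(1), of "\<epsilon> / (2 * R ^ d)"] assms(2) R unfolding d_def by auto
  have "N (poly g x - poly h x) < \<epsilon>" if "N x \<le> R" for x
  proof -
    have "degree (g - h) \<le> d" using h(2) by (intro degree_diff_le) (auto simp: d_def)
    from poly_bound[OF h(3) this assms(3) that]
    have "N (poly (g - h) x) \<le> \<epsilon> / (2 * R ^ d) * R ^ d" .
    also have "\<dots> = \<epsilon> / 2" using R by (metis less_irrefl nonzero_mult_divide_mult_cancel_right2
          times_divide_eq_left mult.commute)
    finally have "N (poly (g - h) x) \<le> \<epsilon> / 2" .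
    then show ?thesis using assms(2) by simp
  qed
  then show thesis using that h(1,2) d_def by blast
qed

end

section \<open>Sequences and points that compute \<open>w\<close>\<close>

context padic_ext
begin

text \<open>With \<open>norm_point\<close>, this is the form in which the conditions on sequences
  and on points are used; \<open>along_iff\<close> and \<open>at_point_iff\<close> are the
  translations.\<close>

definition follows :: "(nat \<Rightarrow> 'c) \<Rightarrow> bool" where
  "follows E \<longleftrightarrow> (\<forall>f\<in>polys \<rat>. \<exists>n0. \<forall>n\<ge>n0. N (poly f (E n)) = M (to_fract f))"

definition norm_point :: "'c \<Rightarrow> bool" where
  "norm_point \<alpha> \<longleftrightarrow> (\<forall>f\<in>polys \<rat>. N (poly f \<alpha>) = M (to_fract f))"

lemma exists_following: "\<exists>E. pseudo E \<and> follows E"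
  using approximating_sequence unfolding pseudo_def follows_def by blast

lemma W_iff: "\<phi> \<in> W \<longleftrightarrow> \<phi> \<in> QX \<and> M \<phi> \<le> 1"
  by (simp add: W_vring w.mem_vring)

text \<open>
  The witnesses are \<open>f^n / p^k\<close> and its inverse, which are units of \<open>W\<close> as \<open>W\<close> is torsion.
\<close>

lemma value_from_W:
  assumes f: "f \<in> polys \<rat>" "f \<noteq> 0"
  shows "\<exists>\<phi>\<in>W. \<exists>\<psi>\<in>W. \<forall>a y z. has_value_at \<phi> a y \<longrightarrow> N y \<le> 1 \<longrightarrow> has_value_at \<psi> a z \<longrightarrow> N z \<le> 1 \<longrightarrow>
    N (poly f a) = M (to_fract f)"
proof -
  have fQ: "to_fract f \<in> QX" by (rule to_fract_QX[OF f(1)])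
  obtain n k where nk: "n > 0" "M (to_fract f) ^ n = N (of_nat p) powi k"
    using M_torsion[OF fQ] f(2) by auto
  define r where "r = (of_nat p :: 'c) powi k"
  have rR: "r \<in> \<rat>" unfolding r_def by (auto simp: power_int_def)
  have r0: "r \<noteq> 0" unfolding r_def using p_nonzero by simp
  have rN: "N r = N (of_nat p) powi k"
    unfolding r_def by (auto simp: power_int_def N.power N.inverse)
  have Nr: "N r > 0" using r0 N.pos by simp
  have Mr: "M (to_fract [:r:]) = N r" "to_fract [:r:] \<in> QX"
    using w_Rats[OF rR] const_QX[OF rR] by (simp_all add: const_fun_to_fract)
  have Mf: "M (to_fract (f ^ n)) = N r" "to_fract (f ^ n) \<in> QX"
    using fQ nk(2) rN by (simp_all add: to_fract_power w.power w.KD)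
  show ?thesis
  proof (rule bexI, rule bexI, intro allI impI)
    show "to_fract (f ^ n) / to_fract [:r:] \<in> W" "to_fract [:r:] / to_fract (f ^ n) \<in> W"
      unfolding W_iff using Mr Mf Nr by (simp_all add: w.divide w.KD(8))
    fix a y z assume y: "has_value_at (to_fract (f ^ n) / to_fract [:r:]) a y" "N y \<le> 1"
      and z: "has_value_at (to_fract [:r:] / to_fract (f ^ n)) a z" "N z \<le> 1"
    have "poly f a ^ n = y * r" "r = z * poly f a ^ n"
      using has_value_at_Fract[OF _ y(1)] has_value_at_Fract[OF _ z(1)] r0 f(2)
      by (auto simp: poly_power)
    then have "N (poly f a) ^ n = N y * N r" "N r = N z * N (poly f a) ^ n"
      by (metis N.mult N.power UNIV_I)+
    then have "N (poly f a) ^ n \<le> N r" "N r \<le> N (poly f a) ^ n"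
      using y(2) z(2) N.nonneg[of r] N.nonneg[of "poly f a"]
      by (metis mult_left_le_one_le N.nonneg UNIV_I zero_le_power)+
    then have "N (poly f a) ^ n = M (to_fract f) ^ n" using nk(2) rN by simp
    then show "N (poly f a) = M (to_fract f)"
      using power_eq_imp_eq_base[OF _ _ _ nk(1)] N.nonneg w.nonneg[OF fQ] by blast
  qed
qed

lemma value_norm:
  assumes "f \<in> polys \<rat>" "g \<in> polys \<rat>" "g \<noteq> 0" "N (poly f a) = M (to_fract f)" "N (poly g a) = M (to_fract g)"
  shows "\<exists>y. has_value_at (to_fract f / to_fract g) a y"
    "has_value_at (to_fract f / to_fract g) a y \<Longrightarrow> N y = M (to_fract f / to_fract g)"
proof -
  have "M (to_fract g) > 0" using w.pos[OF to_fract_QX[OF assms(2)]] assms(3) by simp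
  then have g0: "poly g a \<noteq> 0" using assms(5) by auto
  note val = has_value_atI[OF g0, of f]
  then show "\<exists>y. has_value_at (to_fract f / to_fract g) a y" by blast
  assume "has_value_at (to_fract f / to_fract g) a y"
  then have "y = poly f a / poly g a" using has_value_at_unique val by blast
  then show "N y = M (to_fract f / to_fract g)"
    using assms(4,5) to_fract_QX[OF assms(1)] to_fract_QX[OF assms(2)] by (simp add: N.divide w.divide)
qed

lemma QX_cases:
  assumes "\<phi> \<in> QX" obtains f g where "f \<in> polys \<rat>" "g \<in> polys \<rat>" "g \<noteq> 0" "\<phi> = to_fract f / to_fract g"
  using assms unfolding rat_funs_iff[OF is_subfield_Rats] by blast

text \<open>If \<open>W\<close> is given by the sequence, the two functions from
  \<open>value_from_W\<close> eventually have values of norm at most one along it, which forces the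
  norm of \<open>f\<close> exactly. Conversely the norms of numerator and denominator decide
  membership in \<open>Z_seq\<close>.\<close>

lemma along_iff:
  "pseudo_convergent v E \<and> transcendental_type v \<rat> E \<and> W = Z_seq v \<rat> E \<longleftrightarrow> pseudo E \<and> follows E"
proof
  assume *: "pseudo_convergent v E \<and> transcendental_type v \<rat> E \<and> W = Z_seq v \<rat> E"
  have "\<exists>n0. \<forall>n\<ge>n0. N (poly f (E n)) = M (to_fract f)" if f: "f \<in> polys \<rat>" for f
  proof (cases "f = 0")
    case False
    obtain \<phi> \<psi> where pp: "\<phi> \<in> W" "\<psi> \<in> W" "\<And>a y z. has_value_at \<phi> a y \<Longrightarrow> N y \<le> 1 \<Longrightarrow> has_value_at \<psi> a z \<Longrightarrow>
      N z \<le> 1 \<Longrightarrow> N (poly f a) = M (to_fract f)" using value_from_W[OF f False] by blast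
    obtain n1 where n1: "\<And>n. n \<ge> n1 \<Longrightarrow> \<exists>y. has_value_at \<phi> (E n) y \<and> N y \<le> 1"
      using pp(1) * unfolding Z_seq_def v_nonneg by blast
    obtain n2 where n2: "\<And>n. n \<ge> n2 \<Longrightarrow> \<exists>y. has_value_at \<psi> (E n) y \<and> N y \<le> 1"
      using pp(2) * unfolding Z_seq_def v_nonneg by blast
    have "N (poly f (E n)) = M (to_fract f)" if "n \<ge> max n1 n2" for n
      using n1[of n] n2[of n] that pp(3) by auto
    then show ?thesis by blast
  qed auto
  then show "pseudo E \<and> follows E" using * unfolding follows_def pseudo_iff by blast
next
  assume *: "pseudo E \<and> follows E"
  have fol: "\<exists>n0. \<forall>n\<ge>n0. N (poly f (E n)) = M (to_fract f)" if "f \<in> polys \<rat>" for f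
    using * that unfolding follows_def by blast
  have "transcendental_type v \<rat> E"
    unfolding transcendental_type_def coeffs_subset_iff[OF Rats_0] v_eq
  proof (intro allI impI)
    fix g :: "'c poly" assume "g \<in> polys \<rat>"
    from fol[OF this] obtain n0 where "\<And>n. n \<ge> n0 \<Longrightarrow> N (poly g (E n)) = M (to_fract g)" by blast
    then show "\<exists>n0. \<forall>n\<ge>n0. N (poly g (E n)) = N (poly g (E n0))" by (intro exI[of _ n0]) auto
  qed
  moreover have "\<phi> \<in> W \<longleftrightarrow> \<phi> \<in> Z_seq v \<rat> E" for \<phi>
  proof (cases "\<phi> \<in> QX")
    case True
    then obtain f g where fg: "f \<in> polys \<rat>" "g \<in> polys \<rat>" "g \<noteq> 0" "\<phi> = to_fract f / to_fract g"
      by (rule QX_cases)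
    obtain n1 where n1: "\<And>n. n \<ge> n1 \<Longrightarrow> N (poly f (E n)) = M (to_fract f)" using fol[OF fg(1)] by blast
    obtain n2 where n2: "\<And>n. n \<ge> n2 \<Longrightarrow> N (poly g (E n)) = M (to_fract g)" using fol[OF fg(2)] by blast
    have val: "(\<exists>y. has_value_at \<phi> (E n) y \<and> N y \<le> 1) \<longleftrightarrow> M \<phi> \<le> 1" if "n \<ge> max n1 n2" for n
      using value_norm[OF fg(1-3) n1[of n] n2[of n]] that fg(4) by auto
    have "(\<exists>n0. \<forall>n\<ge>n0. \<exists>y. has_value_at \<phi> (E n) y \<and> N y \<le> 1) \<longleftrightarrow> M \<phi> \<le> 1"
    proof
      assume "\<exists>n0. \<forall>n\<ge>n0. \<exists>y. has_value_at \<phi> (E n) y \<and> N y \<le> 1"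
      then obtain n0 where "\<And>n. n \<ge> n0 \<Longrightarrow> \<exists>y. has_value_at \<phi> (E n) y \<and> N y \<le> 1" by blast
      then show "M \<phi> \<le> 1" using val[of "max n0 (max n1 n2)"] by auto
    qed (use val in blast)
    then show ?thesis using True by (simp add: W_iff Z_seq_def v_nonneg)
  qed (auto simp: W_iff Z_seq_def)
  ultimately show "pseudo_convergent v E \<and> transcendental_type v \<rat> E \<and> W = Z_seq v \<rat> E"
    using * pseudo_iff by blast
qed

lemma norm_point_value:
  assumes "norm_point \<alpha>" "\<phi> \<in> QX"
  shows "\<exists>y. has_value_at \<phi> \<alpha> y" "has_value_at \<phi> \<alpha> y \<Longrightarrow> N y = M \<phi>"
proof -
  obtain f g where fg: "f \<in> polys \<rat>" "g \<in> polys \<rat>" "g \<noteq> 0" "\<phi> = to_fract f / to_fract g"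
    using assms(2) by (rule QX_cases)
  note vn = value_norm[OF fg(1-3), of \<alpha>]
  show "\<exists>y. has_value_at \<phi> \<alpha> y" "has_value_at \<phi> \<alpha> y \<Longrightarrow> N y = M \<phi>"
    using vn assms(1) fg unfolding norm_point_def by blast+
qed

text \<open>The argument is that for sequences. From right to left, \<alpha> is transcendental
  because a nonzero rational polynomial vanishing at \<alpha> would have norm zero for
  \<open>w\<close>.\<close>

lemma at_point_iff: "\<not> algebraic \<alpha> \<and> W = Z_at v \<rat> \<alpha> \<longleftrightarrow> norm_point \<alpha>"
proof
  assume *: "\<not> algebraic \<alpha> \<and> W = Z_at v \<rat> \<alpha>"
  have "N (poly f \<alpha>) = M (to_fract f)" if f: "f \<in> polys \<rat>" for f
  proof (cases "f = 0")
    case False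
    obtain \<phi> \<psi> where pp: "\<phi> \<in> W" "\<psi> \<in> W" "\<And>a y z. has_value_at \<phi> a y \<Longrightarrow> N y \<le> 1 \<Longrightarrow> has_value_at \<psi> a z \<Longrightarrow>
      N z \<le> 1 \<Longrightarrow> N (poly f a) = M (to_fract f)" using value_from_W[OF f False] by blast
    show ?thesis using pp * unfolding Z_at_def v_nonneg by blast
  qed auto
  then show "norm_point \<alpha>" by (simp add: norm_point_def)
next
  assume *: "norm_point \<alpha>"
  have "\<not> algebraic \<alpha>"
  proof
    assume "algebraic \<alpha>"
    then obtain f where f: "f \<in> polys \<rat>" "f \<noteq> 0" "poly f \<alpha> = 0"
      unfolding algebraic_altdef polys_def by blast
    then have "M (to_fract f) = 0" using * unfolding norm_point_def by force
    then show False using w.eq_0_iff[OF to_fract_QX[OF f(1)]] f(2) by simp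
  qed
  moreover have "\<phi> \<in> W \<longleftrightarrow> \<phi> \<in> Z_at v \<rat> \<alpha>" for \<phi>
  proof (cases "\<phi> \<in> QX")
    case True
    then obtain y where "has_value_at \<phi> \<alpha> y" using norm_point_value(1)[OF *] by blast
    then show ?thesis
      using norm_point_value(2)[OF * True] True by (force simp: W_iff Z_at_def v_nonneg)
  qed (auto simp: W_iff Z_at_def)
  ultimately show "\<not> algebraic \<alpha> \<and> W = Z_at v \<rat> \<alpha>" by blast
qed

lemma limit_norm_point:
  assumes "follows E" "v_converges v E \<alpha>"
  shows "norm_point \<alpha>"
  unfolding norm_point_def
proof
  fix f :: "'c poly" assume f: "f \<in> polys \<rat>"
  obtain n1 where n1: "\<And>n. n \<ge> n1 \<Longrightarrow> N (poly f (E n)) = M (to_fract f)"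
    using assms(1) f unfolding follows_def by blast
  have conv: "v_converges v (\<lambda>n. poly f (E n)) (poly f \<alpha>)" by (rule poly_converges[OF assms(2)])
  have M0: "M (to_fract f) \<ge> 0" using w.nonneg[OF to_fract_QX[OF f]] .
  show "N (poly f \<alpha>) = M (to_fract f)"
  proof (rule ccontr)
    assume ne: "N (poly f \<alpha>) \<noteq> M (to_fract f)"
    \<comment> \<open>With \<epsilon> the larger of two different norms, values closer than
      \<epsilon> are closer than the norm of one of them, and then the isosceles principle makes the
      norms equal.\<close>
    define \<epsilon> where "\<epsilon> = max (N (poly f \<alpha>)) (M (to_fract f))"
    have "\<epsilon> > 0" using ne M0 N.nonneg[of "poly f \<alpha>"] by (auto simp: \<epsilon>_def max_def)
    then obtain n2 where n2: "\<And>n. n \<ge> n2 \<Longrightarrow> N (poly f (E n) - poly f \<alpha>) < \<epsilon>"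
      using conv unfolding v_converges_iff by blast
    define n where "n = max n1 n2"
    have n: "N (poly f (E n)) = M (to_fract f)" "N (poly f (E n) - poly f \<alpha>) < \<epsilon>"
      using n1[of n] n2[of n] by (simp_all add: n_def)
    then consider "N (poly f (E n) - poly f \<alpha>) < N (poly f (E n))"
      | "N (poly f (E n) - poly f \<alpha>) < N (poly f \<alpha>)"
      by (auto simp: \<epsilon>_def max_def split: if_splits)
    then have "N (poly f \<alpha>) = N (poly f (E n))"
      by cases (auto dest: N.close_eq[OF UNIV_I UNIV_I] N.close_eq'[OF UNIV_I UNIV_I])
    then show False using n(1) ne by simp
  qed
qed

text \<open>Once a point is known, an explicit sequence serves: \<open>\<alpha> + p ^ n\<close> is
  pseudo-convergent with limit \<alpha>, and close to \<alpha> a polynomial keeps the norm of its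
  nonzero value at \<alpha>.\<close>

lemma norm_point_sequence:
  assumes "norm_point \<alpha>"
  shows "\<exists>E. pseudo E \<and> follows E \<and> v_converges v E \<alpha>"
proof -
  define E where "E = (\<lambda>n. \<alpha> + of_nat p ^ n)"
  have pw: "N (of_nat p ^ n - of_nat p ^ m) = N (of_nat p) ^ n" if "n < m" for n m
    using N.diff_eq[of "of_nat p ^ n" "of_nat p ^ m"] that N_p_bounds power_strict_decreasing[of n m "N (of_nat p)"]
    by (simp add: N.power)
  have "pseudo E"
    unfolding pseudo_def E_def
    using pw N_p_bounds power_strict_decreasing[of _ _ "N (of_nat p)"] by auto
  moreover have lim: "v_converges v E \<alpha>"
    unfolding v_converges_iff
  proof (intro allI impI)
    fix \<epsilon> :: real assume "\<epsilon> > 0"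
    then obtain k where k: "N (of_nat p) ^ k < \<epsilon>" using N_p_power_less by blast
    have "N (E n - \<alpha>) < \<epsilon>" if "n \<ge> k" for n
    proof -
      have "N (of_nat p) ^ n \<le> N (of_nat p) ^ k"
        by (rule power_decreasing[OF that]) (use N_p_bounds in auto)
      then show ?thesis using k by (simp add: E_def N.power)
    qed
    then show "\<exists>n0. \<forall>n\<ge>n0. N (E n - \<alpha>) < \<epsilon>" by blast
  qed
  moreover have "follows E"
    unfolding follows_def
  proof
    fix f :: "'c poly" assume f: "f \<in> polys \<rat>"
    show "\<exists>n0. \<forall>n\<ge>n0. N (poly f (E n)) = M (to_fract f)"
    proof (cases "f = 0")
      case False
      have eq: "N (poly f \<alpha>) = M (to_fract f)" using assms f unfolding norm_point_def by blast
      have "M (to_fract f) > 0" using w.pos[OF to_fract_QX[OF f]] False by simp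
      then obtain n0 where n0: "\<And>n. n \<ge> n0 \<Longrightarrow> N (poly f (E n) - poly f \<alpha>) < N (poly f \<alpha>)"
        using poly_converges[OF lim, of f] eq unfolding v_converges_iff by force
      then have "N (poly f (E n)) = M (to_fract f)" if "n \<ge> n0" for n
        using N.close_eq'[of "poly f (E n)" "poly f \<alpha>"] eq that by simp
      then show ?thesis by blast
    qed auto
  qed
  ultimately show ?thesis by blast
qed

text \<open>Polynomials \<open>h\<close> with coefficients near those of \<open>g\<close> and with
  small \<open>M (to_fract h)\<close> force small values of \<open>g\<close> along \<open>E\<close>,
  hence a limit of \<open>E\<close> among the roots of \<open>g\<close>. The uniform degree bound
  \<open>d\<close> turns closeness of coefficients into closeness of values on a ball.\<close>

lemma approx_root_limit:
  assumes E: "pseudo E" "follows E" and g: "g \<in> polys Qp" "g \<noteq> 0"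
    and small: "\<And>\<epsilon>. \<epsilon> > 0 \<Longrightarrow> \<exists>h\<in>polys \<rat>. degree h \<le> d \<and> (\<forall>i. N (coeff (g - h) i) \<le> \<epsilon>) \<and> M (to_fract h) < \<epsilon>"
  shows "\<exists>\<alpha>. norm_point \<alpha> \<and> v_converges v E \<alpha>"
proof -
  obtain R where R: "R \<ge> 1" "\<And>n. N (E n) \<le> R" using pseudo_bounded[OF E(1)] by blast
  define D where "D = max (degree g) d"
  have RD: "R ^ D > 0" "R ^ D \<ge> 1" using R(1) by auto
  have "\<exists>n\<ge>n0. N (poly g (E n)) < \<epsilon>" if \<epsilon>: "\<epsilon> > 0" for \<epsilon> n0
  proof -
    define \<delta> where "\<delta> = \<epsilon> / (2 * R ^ D)"
    have \<delta>: "\<delta> > 0" "\<delta> * R ^ D < \<epsilon>" "\<delta> \<le> \<epsilon>"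
    proof -
      show "\<delta> > 0" "\<delta> * R ^ D < \<epsilon>" using \<epsilon> RD by (simp_all add: \<delta>_def)
      moreover have "\<delta> * 1 \<le> \<delta> * R ^ D"
        by (rule mult_left_mono) (use RD(2) \<open>\<delta> > 0\<close> in auto)
      ultimately show "\<delta> \<le> \<epsilon>" by linarith
    qed
    obtain h where h: "h \<in> polys \<rat>" "degree h \<le> d" "\<And>i. N (coeff (g - h) i) \<le> \<delta>" "M (to_fract h) < \<delta>"
      using small[OF \<delta>(1)] by blast
    obtain n1 where n1: "\<And>n. n \<ge> n1 \<Longrightarrow> N (poly h (E n)) = M (to_fract h)"
      using E(2) h(1) unfolding follows_def by blast
    let ?n = "max n0 n1"
    have "degree (g - h) \<le> D" using h(2) by (intro degree_diff_le) (auto simp: D_def)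
    from poly_bound[OF h(3) this R(1) R(2)[of ?n]]
    have "N (poly g (E ?n) - poly h (E ?n)) < \<epsilon>" using \<delta>(2) by simp
    then have "N (poly g (E ?n)) < \<epsilon>"
      using N.add[of "poly g (E ?n) - poly h (E ?n)" "poly h (E ?n)"] n1[of ?n] h(4) \<delta>(3) by auto
    then show ?thesis by (intro exI[of _ ?n]) auto
  qed
  from small_values_limit[OF E(1) g(2) this] obtain \<alpha> where "v_converges v E \<alpha>" by blast
  then show ?thesis using limit_norm_point[OF E(2)] by blast
qed

text \<open>Finiteness of \<open>W / p W\<close>: the elements of norm at most that of
  \<open>p\<close> are those of \<open>p W\<close>.\<close>

definition fin_quot :: bool where
  "fin_quot \<longleftrightarrow> (\<exists>T. finite T \<and> T \<subseteq> W \<and> (\<forall>z\<in>W. \<exists>t\<in>T. M (z - t) \<le> N (of_nat p)))"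

lemma norm_point_fin_quot:
  assumes \<alpha>: "norm_point \<alpha>" shows fin_quot
proof -
  obtain T0 where T0: "finite T0" "\<And>z. z \<in> Qp_poly_values \<alpha> \<Longrightarrow> N z \<le> 1 \<Longrightarrow> \<exists>t\<in>T0. N (z - t) \<le> N (of_nat p)"
    using tot_bounded_Qp_poly_values[of \<alpha>] N_p_bounds(1) unfolding tot_bounded_def by meson
  have "\<exists>y. has_value_at \<phi> \<alpha> y" if "\<phi> \<in> W" for \<phi>
    using norm_point_value(1)[OF \<alpha>] that W_iff by blast
  then obtain ev where ev: "\<And>\<phi>. \<phi> \<in> W \<Longrightarrow> has_value_at \<phi> \<alpha> (ev \<phi>)" by metis
  have evQ: "ev \<phi> \<in> Qp_poly_values \<alpha>" if \<phi>: "\<phi> \<in> W" for \<phi>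
  proof -
    obtain f g where fg: "f \<in> polys \<rat>" "g \<in> polys \<rat>" "g \<noteq> 0" "\<phi> = to_fract f / to_fract g"
      using \<phi> W_iff QX_cases by metis
    have sub: "polys \<rat> \<subseteq> polys Qp" using Rats_Qp by (auto simp: polys_def)
    have "N (poly g \<alpha>) = M (to_fract g)" using \<alpha> fg(2) unfolding norm_point_def by blast
    also have "\<dots> > 0" using w.pos[OF to_fract_QX[OF fg(2)]] fg(3) by simp
    finally have "poly g \<alpha> \<noteq> 0" by auto
    then have "ev \<phi> = poly f \<alpha> / poly g \<alpha>"
      using has_value_at_unique[OF ev[OF \<phi>]] has_value_atI fg(4) by blast
    moreover have "poly f \<alpha> \<in> Qp_poly_values \<alpha>" "poly g \<alpha> \<in> Qp_poly_values \<alpha>"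
      using fg(1,2) sub by (auto simp: Qp_poly_values_def)
    ultimately show ?thesis using is_subfieldD(8)[OF Qp_poly_values_subfield] by simp
  qed
  have evN: "N (ev \<phi>) \<le> 1" if "\<phi> \<in> W" for \<phi>
    using norm_point_value(2)[OF \<alpha> _ ev[OF that]] that W_iff by simp
  \<comment> \<open>The finitely many centres come from \<open>Q_p(\<alpha>)\<close> and need not be
    values of elements of \<open>W\<close>. Each centre with such a value nearby is replaced by one,
    at no loss of radius by the ultrametric inequality.\<close>
  define near where "near = (\<lambda>t. {\<phi> \<in> W. N (ev \<phi> - t) \<le> N (of_nat p)})"
  define T where "T = (\<lambda>t. SOME \<phi>. \<phi> \<in> near t) ` {t \<in> T0. near t \<noteq> {}}"
  have some: "(SOME \<phi>. \<phi> \<in> near t) \<in> near t" if "near t \<noteq> {}" for t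
    using that by (simp add: some_in_eq)
  have "\<exists>t\<in>T. M (z - t) \<le> N (of_nat p)" if z: "z \<in> W" for z
  proof -
    obtain t where t: "t \<in> T0" "N (ev z - t) \<le> N (of_nat p)" using T0(2)[OF evQ[OF z] evN[OF z]] by blast
    then have ne: "near t \<noteq> {}" using z by (auto simp: near_def)
    define \<phi> where "\<phi> = (SOME \<phi>. \<phi> \<in> near t)"
    have \<phi>: "\<phi> \<in> W" "N (ev \<phi> - t) \<le> N (of_nat p)" using some[OF ne] by (auto simp: \<phi>_def near_def)
    have "N ((ev z - t) - (ev \<phi> - t)) \<le> max (N (ev z - t)) (N (ev \<phi> - t))" by (rule N.diff) auto
    then have "N (ev z - ev \<phi>) \<le> N (of_nat p)" using t(2) \<phi>(2) by simp
    moreover have "N (ev z - ev \<phi>) = M (z - \<phi>)"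
    proof (rule norm_point_value(2)[OF \<alpha>])
      show "z - \<phi> \<in> QX" using z \<phi>(1) W_iff w.KD(7) by blast
      show "has_value_at (z - \<phi>) \<alpha> (ev z - ev \<phi>)"
        using has_value_at_arith(2)[OF ev[OF z] ev[OF \<phi>(1)]] .
    qed
    moreover have "\<phi> \<in> T" unfolding T_def \<phi>_def using t(1) ne by blast
    ultimately show ?thesis by auto
  qed
  moreover have "finite T" unfolding T_def using T0(1) by simp
  moreover have "T \<subseteq> W" using some by (auto simp: T_def near_def)
  ultimately show ?thesis unfolding fin_quot_def by blast
qed

end

lemma type_algebra_inverse:
  "x \<noteq> 0 \<Longrightarrow> inv\<^bsub>(ring_of_type_algebra :: 'k::field ring)\<^esub> x = inverse x"
  "\<ominus>\<^bsub>(ring_of_type_algebra :: 'k::field ring)\<^esub> x = - x"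
proof -
  interpret cring "ring_of_type_algebra :: 'k ring" by (rule cring_from_type_algebra)
  show "inv\<^bsub>(ring_of_type_algebra :: 'k::field ring)\<^esub> x = inverse x" if "x \<noteq> 0"
    using that by (intro comm_inv_char) auto
  show "\<ominus>\<^bsub>(ring_of_type_algebra :: 'k::field ring)\<^esub> x = - x"
    by (rule minus_equality) auto
qed

lemma generate_field_is_subfield:
  "is_subfield (generate_field (ring_of_type_algebra :: 'k::field ring) H)"
proof (rule is_subfieldI)
  let ?G = "generate_field (ring_of_type_algebra :: 'k ring) H"
  show 1: "1 \<in> ?G" using generate_field.one[of "ring_of_type_algebra :: 'k ring" H] by simp
  show m: "- x \<in> ?G" if "x \<in> ?G" for x
    using generate_field.a_inv[OF that] by (simp add: type_algebra_inverse)
  show a: "x + y \<in> ?G" if "x \<in> ?G" "y \<in> ?G" for x y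
    using generate_field.eng_add[OF that] by simp
  show "x * y \<in> ?G" if "x \<in> ?G" "y \<in> ?G" for x y
    using generate_field.eng_mult[OF that] by simp
  show "inverse x \<in> ?G" if "x \<in> ?G" "x \<noteq> 0" for x
    using generate_field.m_inv[OF that(1)] that(2) by (simp add: type_algebra_inverse)
  show "0 \<in> ?G" using a[OF 1 m[OF 1]] by simp
qed

lemma generate_field_minimal:
  assumes F: "is_subfield F" and H: "H \<subseteq> F"
  shows "generate_field (ring_of_type_algebra :: 'k::field ring) H \<subseteq> F"
proof
  fix x assume "x \<in> generate_field (ring_of_type_algebra :: 'k ring) H"
  then show "x \<in> F"
    by induction (use is_subfieldD[OF F] H in \<open>auto simp: type_algebra_inverse\<close>)
qed

lemma has_value_at_const: "has_value_at (const_fun c) a c"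
  using has_value_atI[of 1 a "[:c:]"] by (simp add: const_fun_to_fract)

context padic_ext
begin

subsection \<open>The valuation at a point\<close>

definition rat_values :: "'c \<Rightarrow> 'c set" where
  "rat_values \<alpha> = {y. \<exists>\<phi>\<in>QX. has_value_at \<phi> \<alpha> y}"

lemma rat_values_subfield:
  assumes \<alpha>: "norm_point \<alpha>" shows "is_subfield (rat_values \<alpha>)"
proof (rule is_subfieldI)
  have c: "c \<in> rat_values \<alpha>" if "c \<in> \<rat>" for c
    unfolding rat_values_def using has_value_at_const const_QX[OF that] by blast
  show "0 \<in> rat_values \<alpha>" "1 \<in> rat_values \<alpha>" using c by auto
  fix x assume "x \<in> rat_values \<alpha>"
  then obtain \<phi> where \<phi>: "\<phi> \<in> QX" "has_value_at \<phi> \<alpha> x" by (auto simp: rat_values_def)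
  show "- x \<in> rat_values \<alpha>"
    using has_value_at_arith(2)[OF has_value_at_const[of 0 \<alpha>] \<phi>(2)] w.KD(5)[OF \<phi>(1)]
    by (auto simp: rat_values_def)
  show "inverse x \<in> rat_values \<alpha>" if "x \<noteq> 0"
  proof -
    obtain y where y: "has_value_at (inverse \<phi>) \<alpha> y"
      using norm_point_value(1)[OF \<alpha> w.KD(6)[OF \<phi>(1)]] by blast
    have "M \<phi> = N x" using norm_point_value(2)[OF \<alpha> \<phi>] by simp
    then have "\<phi> \<noteq> 0" using N.pos[of x] that by auto
    then have "has_value_at (const_fun 1) \<alpha> (x * y)"
      using has_value_at_arith(3)[OF \<phi>(2) y] by simp
    then have "x * y = 1" using has_value_at_unique has_value_at_const by blast
    then have "inverse x = y" by (rule inverse_unique)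
    then show ?thesis using y w.KD(6)[OF \<phi>(1)] by (auto simp: rat_values_def)
  qed
  fix y assume "y \<in> rat_values \<alpha>"
  then obtain \<psi> where \<psi>: "\<psi> \<in> QX" "has_value_at \<psi> \<alpha> y" by (auto simp: rat_values_def)
  show "x + y \<in> rat_values \<alpha>" "x * y \<in> rat_values \<alpha>"
    using has_value_at_arith(1,3)[OF \<phi>(2) \<psi>(2)] w.KD(3,4)[OF \<phi>(1) \<psi>(1)] by (auto simp: rat_values_def)
qed

lemma Qp_adjoin_subfield: "is_subfield (Q_p_adjoin v \<alpha>)"
  unfolding Q_p_adjoin_def by (rule generate_field_is_subfield)

lemma Qp_adjoin_incl: "insert \<alpha> Qp \<subseteq> Q_p_adjoin v \<alpha>"
  unfolding Q_p_adjoin_def by (auto intro: generate_field.incl)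

text \<open>The closure of the field of values at \<alpha> is a field containing \<alpha> and
  \<open>Q_p v\<close>, hence it contains the field that they generate.\<close>

lemma rat_values_dense:
  assumes \<alpha>: "norm_point \<alpha>" and x: "x \<in> Q_p_adjoin v \<alpha>" and \<epsilon>: "\<epsilon> > 0"
  obtains \<phi> y where "\<phi> \<in> QX" "has_value_at \<phi> \<alpha> y" "N (x - y) < \<epsilon>"
proof -
  let ?C = "{x. \<forall>\<epsilon>>0. \<exists>q\<in>rat_values \<alpha>. N (x - q) < \<epsilon>}"
  have "\<alpha> \<in> rat_values \<alpha>"
    using has_value_atI[of 1 \<alpha> "[:0, 1:]"] to_fract_QX[of "[:0, 1 :: 'c:]"]
    by (auto simp: rat_values_def polys_def coeff_pCons split: nat.splits)
  then have "\<alpha> \<in> ?C" by (auto intro!: bexI[of _ \<alpha>])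
  moreover have "\<rat> \<subseteq> rat_values \<alpha>"
    using has_value_at_const const_QX by (auto simp: rat_values_def)
  then have "Qp \<subseteq> ?C" using mem_Qp by blast
  ultimately have "insert \<alpha> Qp \<subseteq> ?C" by blast
  then have "Q_p_adjoin v \<alpha> \<subseteq> ?C"
    unfolding Q_p_adjoin_def
    by (rule generate_field_minimal[OF closure_subfield[OF rat_values_subfield[OF \<alpha>]]])
  then obtain y where "y \<in> rat_values \<alpha>" "N (x - y) < \<epsilon>" using x \<epsilon> by blast
  then show thesis using that by (auto simp: rat_values_def)
qed

lemma rat_values_in_adjoin:
  assumes "norm_point \<alpha>" "\<phi> \<in> QX" "has_value_at \<phi> \<alpha> y"
  shows "y \<in> Q_p_adjoin v \<alpha>"
proof -
  note D = is_subfieldD[OF Qp_adjoin_subfield[of \<alpha>]]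
  obtain f g where fg: "f \<in> polys \<rat>" "g \<in> polys \<rat>" "g \<noteq> 0" "\<phi> = to_fract f / to_fract g"
    using assms(2) by (rule QX_cases)
  have sub: "polys \<rat> \<subseteq> polys (Q_p_adjoin v \<alpha>)" using Rats_Qp Qp_adjoin_incl by (fastforce simp: polys_def)
  have mem: "poly f \<alpha> \<in> Q_p_adjoin v \<alpha>" "poly g \<alpha> \<in> Q_p_adjoin v \<alpha>"
    using polys_closed(14)[OF Qp_adjoin_subfield] sub fg(1,2) Qp_adjoin_incl by blast+
  have eq: "poly f \<alpha> = y * poly g \<alpha>" using has_value_at_Fract[OF fg(3)] assms(3) fg(4) by blast
  have "N (poly g \<alpha>) = M (to_fract g)" using assms(1) fg(2) unfolding norm_point_def by blast
  also have "\<dots> > 0" using w.pos[OF to_fract_QX[OF fg(2)]] fg(3) by simp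
  finally have "poly g \<alpha> \<noteq> 0" by auto
  then have "y = poly f \<alpha> / poly g \<alpha>" using eq by simp
  then show ?thesis using D(8) mem by simp
qed

text \<open>By density, a nonzero element of \<open>Q_p(\<alpha>)\<close> has the value of a
  rational function closer to it than its own norm, and this value has the same norm.\<close>

lemma value_group_at_point:
  assumes \<alpha>: "norm_point \<alpha>"
  shows "value_group QX w = value_group (Q_p_adjoin v \<alpha>) v"
proof -
  have "r \<in> value_group (Q_p_adjoin v \<alpha>) v" if "r \<in> value_group QX w" for r
  proof -
    obtain \<phi> where \<phi>: "\<phi> \<in> QX" "w \<phi> = ereal r" using \<open>r \<in> value_group QX w\<close> by (auto simp: value_group_def)
    obtain y where y: "has_value_at \<phi> \<alpha> y" using norm_point_value(1)[OF \<alpha> \<phi>(1)] by blast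
    have "N y = exp (- r)"
      using norm_point_value(2)[OF \<alpha> \<phi>(1) y] \<phi>(2) valuation_nrm(3)[OF w_valuation \<phi>(1)] by simp
    then have "v y = ereal r" "y \<noteq> 0" using v_real by auto
    then show ?thesis using rat_values_in_adjoin[OF \<alpha> \<phi>(1) y] by (auto simp: value_group_def)
  qed
  moreover have "r \<in> value_group QX w" if "r \<in> value_group (Q_p_adjoin v \<alpha>) v" for r
  proof -
    obtain x where x: "x \<in> Q_p_adjoin v \<alpha>" "v x = ereal r"
      using \<open>r \<in> value_group (Q_p_adjoin v \<alpha>) v\<close> by (auto simp: value_group_def)
    then have Nx: "N x = exp (- r)" using v_real by simp
    then have "N x > 0" by simp
    then obtain \<phi> y where \<phi>: "\<phi> \<in> QX" "has_value_at \<phi> \<alpha> y" "N (x - y) < N x"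
      using rat_values_dense[OF \<alpha> x(1)] by metis
    then have "M \<phi> = exp (- r)"
      using norm_point_value(2)[OF \<alpha> \<phi>(1,2)] N.close_eq[OF UNIV_I UNIV_I \<phi>(3)] Nx by simp
    then have "w \<phi> = ereal r" "\<phi> \<noteq> 0" using valuation_nrm(3)[OF w_valuation \<phi>(1)] by auto
    then show ?thesis using \<phi>(1) by (auto simp: value_group_def)
  qed
  ultimately show ?thesis by blast
qed

lemma residue_field_at_point:
  assumes \<alpha>: "norm_point \<alpha>"
  shows "\<exists>h\<in>ring_iso (residue_field W) (residue_field {x \<in> Q_p_adjoin v \<alpha>. v x \<ge> 0}).
    \<forall>\<phi>\<in>W. \<forall>y. has_value_at \<phi> \<alpha> y \<longrightarrow> h (residue_class W \<phi>) = residue_class {x \<in> Q_p_adjoin v \<alpha>. v x \<ge> 0} y"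
proof -
  interpret L: ultranorm "Q_p_adjoin v \<alpha>" N
  proof
    show "is_subfield (Q_p_adjoin v \<alpha>)" by (rule Qp_adjoin_subfield)
  qed (auto simp: N.eq_0_iff N.nonneg N.mult N.add)
  have O: "{x \<in> Q_p_adjoin v \<alpha>. v x \<ge> 0} = L.vring" by (auto simp: L.mem_vring v_nonneg)
  \<comment> \<open>Evaluation at \<alpha>, which is a homomorphism on \<open>W\<close> because
    values are unique.\<close>
  define e where "e = (\<lambda>\<phi>. SOME y. has_value_at \<phi> \<alpha> y)"
  have e: "has_value_at \<phi> \<alpha> (e \<phi>)" if "\<phi> \<in> w.vring" for \<phi>
    unfolding e_def using norm_point_value(1)[OF \<alpha>] that by (auto simp: w.mem_vring intro: someI_ex)
  have eI: "e \<phi> = y" if "has_value_at \<phi> \<alpha> y" for \<phi> y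
    unfolding e_def using that has_value_at_unique by blast
  have "\<exists>h\<in>ring_iso (residue_field w.vring) (residue_field L.vring).
    \<forall>x\<in>w.vring. h (residue_class w.vring x) = residue_class L.vring (e x)"
  proof (rule residue_field_iso)
    show "ultranorm QX M" by (rule w.ultranorm_axioms)
    show "ultranorm (Q_p_adjoin v \<alpha>) N" by (rule L.ultranorm_axioms)
    show "e x \<in> Q_p_adjoin v \<alpha> \<and> N (e x) = M x" if "x \<in> w.vring" for x
      using rat_values_in_adjoin[OF \<alpha> _ e[OF that]] norm_point_value(2)[OF \<alpha> _ e[OF that]] that
      by (simp add: w.mem_vring)
    show "e 1 = 1" using eI[OF has_value_at_const[of 1]] by simp
    show "e (x + y) = e x + e y" "e (x * y) = e x * e y" if "x \<in> w.vring" "y \<in> w.vring" for x y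
      using eI[OF has_value_at_arith(1)[OF e[OF that(1)] e[OF that(2)]]]
        eI[OF has_value_at_arith(3)[OF e[OF that(1)] e[OF that(2)]]] by simp_all
    show "\<exists>x\<in>w.vring. N (y - e x) < 1" if y: "y \<in> Q_p_adjoin v \<alpha>" "N y \<le> 1" for y
    proof -
      obtain \<phi> z where \<phi>: "\<phi> \<in> QX" "has_value_at \<phi> \<alpha> z" "N (y - z) < 1"
        using rat_values_dense[OF \<alpha> y(1), of 1] by auto
      have "N z \<le> 1" using N.diff[of y "y - z"] \<phi>(3) y(2) by (auto simp: max_def split: if_splits)
      then have "\<phi> \<in> w.vring" using \<phi>(1) norm_point_value(2)[OF \<alpha> \<phi>(1,2)] by (simp add: w.mem_vring)
      then show ?thesis using \<phi>(3) eI[OF \<phi>(2)] by auto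
    qed
  qed
  then show ?thesis unfolding O W_vring using eI by metis
qed

end

subsection \<open>Sequences without limit\<close>

locale nonconvergent = padic_ext p v W w
  for p :: nat and v :: "'c::{alg_closed_field,field_char_0} \<Rightarrow> ereal" and W w +
  fixes E :: "nat \<Rightarrow> 'c"
  assumes pseudo: "pseudo E" and fol: "follows E" and nolim: "\<nexists>\<alpha>. v_converges v E \<alpha>"
begin

abbreviation L :: "'c poly fract set" where "L \<equiv> rat_funs Qp"

lemma follows_eventually: "f \<in> polys \<rat> \<Longrightarrow> eventually (\<lambda>n. N (poly f (E n)) = M (to_fract f)) sequentially"
  using fol unfolding follows_def eventually_sequentially by blast

text \<open>Values coming arbitrarily close to zero at late indices would produce a limit, by
  \<open>small_values_limit\<close>.\<close>

lemma bounded_below: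
  assumes "g \<noteq> 0" shows "\<exists>\<epsilon>>0. eventually (\<lambda>n. \<epsilon> \<le> N (poly g (E n))) sequentially"
proof (rule ccontr)
  assume c: "\<not> ?thesis"
  have "\<exists>n\<ge>n0. N (poly g (E n)) < \<epsilon>" if "\<epsilon> > 0" for \<epsilon> n0
    using c that unfolding eventually_sequentially by (meson not_le)
  then show False using small_values_limit[OF pseudo assms] nolim by blast
qed

text \<open>A rational \<open>h\<close> closer to \<open>g\<close> along \<open>E\<close> than the
  lower bound \<delta> has the norm of \<open>g\<close> there, and the norm of a rational polynomial
  is eventually the one given by \<open>w\<close>.\<close>

lemma poly_eventually:
  assumes g: "g \<in> polys Qp" "g \<noteq> 0" and \<epsilon>: "\<epsilon> > 0"
  obtains h where "h \<in> polys \<rat>" "M (to_fract h) > 0"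
    "eventually (\<lambda>n. N (poly g (E n)) = M (to_fract h)) sequentially"
    "eventually (\<lambda>n. N (poly g (E n) - poly h (E n)) < \<epsilon>) sequentially"
proof -
  obtain \<delta> where \<delta>: "\<delta> > 0" "eventually (\<lambda>n. \<delta> \<le> N (poly g (E n))) sequentially"
    using bounded_below[OF g(2)] by blast
  obtain R where R: "R \<ge> 1" "\<And>n. N (E n) \<le> R" using pseudo_bounded[OF pseudo] by blast
  obtain h where h: "h \<in> polys \<rat>" "\<And>x. N x \<le> R \<Longrightarrow> N (poly g x - poly h x) < min \<epsilon> \<delta>"
    using poly_approx_values[OF g(1) _ R(1), of "min \<epsilon> \<delta>"] \<epsilon> \<delta>(1) by auto
  have ev: "eventually (\<lambda>n. N (poly g (E n)) = M (to_fract h) \<and>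
    N (poly g (E n) - poly h (E n)) < \<epsilon> \<and> \<delta> \<le> N (poly g (E n))) sequentially"
    using \<delta>(2) follows_eventually[OF h(1)]
  proof eventually_elim
    case (elim n)
    have "N (poly g (E n) - poly h (E n)) < min \<epsilon> \<delta>" by (rule h(2)[OF R(2)])
    then show ?case using N.close_eq[of "poly g (E n)" "poly h (E n)"] elim by simp
  qed
  from eventually_happens'[OF sequentially_bot this] have "M (to_fract h) > 0" using \<delta>(1) by auto
  moreover have "eventually (\<lambda>n. N (poly g (E n)) = M (to_fract h)) sequentially"
    "eventually (\<lambda>n. N (poly g (E n) - poly h (E n)) < \<epsilon>) sequentially"
    using ev by (eventually_elim, simp)+
  ultimately show thesis using that h(1) by blast
qed

lemma transcendental_over_Qp: "transcendental_type v Qp E"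
  unfolding transcendental_type_def coeffs_subset_iff[OF QpD(1)] v_eq
proof (intro allI impI)
  fix g :: "'c poly" assume g: "g \<in> polys Qp"
  show "\<exists>n0. \<forall>n\<ge>n0. N (poly g (E n)) = N (poly g (E n0))"
  proof (cases "g = 0")
    case False
    obtain h where "eventually (\<lambda>n. N (poly g (E n)) = M (to_fract h)) sequentially"
      using poly_eventually[OF g False, of 1] zero_less_one by metis
    then obtain n0 where "\<And>n. n \<ge> n0 \<Longrightarrow> N (poly g (E n)) = M (to_fract h)"
      unfolding eventually_sequentially by blast
    then show ?thesis by (intro exI[of _ n0]) auto
  qed auto
qed

text \<open>The eventual norm along \<open>E\<close>; asking for a value at \<open>E n\<close> also
  excludes poles from some index on. As \<open>u\<close> it becomes the absolute value of
  \<open>Z_seq v (Q_p v) E\<close>. The choice in \<open>u\<close> is meaningful on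
  \<open>L\<close>, where such a norm exists and is unique.\<close>

definition has_norm :: "'c poly fract \<Rightarrow> real \<Rightarrow> bool" where
  "has_norm \<phi> r \<longleftrightarrow> eventually (\<lambda>n. \<exists>y. has_value_at \<phi> (E n) y \<and> N y = r) sequentially"

definition u :: "'c poly fract \<Rightarrow> real" where "u \<phi> = (SOME r. has_norm \<phi> r)"

lemma has_norm_unique:
  assumes "has_norm \<phi> r" "has_norm \<phi> s" shows "r = s"
proof -
  have "eventually (\<lambda>n. r = s) sequentially"
    using assms unfolding has_norm_def by eventually_elim (auto dest: has_value_at_unique)
  then show ?thesis by simp
qed

lemma u_eqI: "has_norm \<phi> r \<Longrightarrow> u \<phi> = r"
  unfolding u_def using has_norm_unique by blast

lemma has_norm_mult:
  assumes "has_norm \<phi> r" "has_norm \<psi> s" shows "has_norm (\<phi> * \<psi>) (r * s)"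
  using assms unfolding has_norm_def
proof eventually_elim
  case (elim n)
  then obtain y z where "has_value_at \<phi> (E n) y" "N y = r" "has_value_at \<psi> (E n) z" "N z = s" by blast
  then show ?case using has_value_at_arith(3)[of \<phi> "E n" y \<psi> z] by (auto simp: N.mult)
qed

lemma has_norm_0: "has_norm 0 0"
proof -
  have "\<exists>y. has_value_at 0 (E n) y \<and> N y = 0" for n
    using has_value_at_const[of 0 "E n"] by (intro exI[of _ 0]) simp
  then show ?thesis unfolding has_norm_def by simp
qed

lemma has_norm_poly:
  assumes f: "f \<in> polys Qp"
  shows "\<exists>r. has_norm (to_fract f) r \<and> (f \<noteq> 0 \<longrightarrow> r > 0 \<and> has_norm (inverse (to_fract f)) (inverse r))"
proof (cases "f = 0")
  case True
  then show ?thesis using has_norm_0 by (intro exI[of _ 0]) simp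
next
  case False
  obtain h where h: "M (to_fract h) > 0" "eventually (\<lambda>n. N (poly f (E n)) = M (to_fract h)) sequentially"
    using poly_eventually[OF f False, of 1] zero_less_one by metis
  have "has_norm (to_fract f) (M (to_fract h))"
    unfolding has_norm_def using h(2)
  proof eventually_elim
    case (elim n)
    then show ?case using has_value_atI[of 1 "E n" f] by auto
  qed
  moreover have "has_norm (inverse (to_fract f)) (inverse (M (to_fract h)))"
    unfolding has_norm_def using h(2)
  proof eventually_elim
    case (elim n)
    then have "poly f (E n) \<noteq> 0" using h(1) by auto
    then show ?case using has_value_atI[of f "E n" 1] elim
      by (auto simp: N.divide inverse_eq_divide intro!: exI[of _ "1 / poly f (E n)"])
  qed
  ultimately show ?thesis using h(1) by blast
qed

lemma has_norm_ex:
  assumes "\<phi> \<in> L" shows "\<exists>r. has_norm \<phi> r \<and> (\<phi> \<noteq> 0 \<longrightarrow> r > 0)"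
proof -
  obtain f g where fg: "f \<in> polys Qp" "g \<in> polys Qp" "g \<noteq> 0" "\<phi> = to_fract f / to_fract g"
    using assms unfolding rat_funs_iff[OF Qp_subfield] by blast
  obtain r where r: "has_norm (to_fract f) r" "f \<noteq> 0 \<Longrightarrow> r > 0" using has_norm_poly[OF fg(1)] by blast
  obtain s where s: "has_norm (inverse (to_fract g)) (inverse s)" "s > 0" using has_norm_poly[OF fg(2)] fg(3) by blast
  have "has_norm \<phi> (r * inverse s)"
    unfolding fg(4) divide_inverse by (rule has_norm_mult[OF r(1) s(1)])
  moreover have "\<phi> \<noteq> 0 \<Longrightarrow> r * inverse s > 0" using r(2) s(2) fg(4) by auto
  ultimately show ?thesis by blast
qed

lemma u_has_norm: "\<phi> \<in> L \<Longrightarrow> has_norm \<phi> (u \<phi>)"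
  using has_norm_ex u_eqI by metis

sublocale u: ultranorm L u
proof
  show L: "is_subfield L" by (rule rat_funs_subfield[OF Qp_subfield])
  note z = has_norm_0
  fix x assume x: "x \<in> L"
  show "u x = 0 \<longleftrightarrow> x = 0"
    using has_norm_ex[OF x] u_eqI z by fastforce
  show "0 \<le> u x"
    using has_norm_ex[OF x] u_eqI z by (cases "x = 0") force+
  fix y assume y: "y \<in> L"
  show "u (x * y) = u x * u y"
    by (intro u_eqI has_norm_mult u_has_norm x y)
  have "eventually (\<lambda>n. u (x + y) \<le> max (u x) (u y)) sequentially"
    using u_has_norm[OF x, unfolded has_norm_def] u_has_norm[OF y, unfolded has_norm_def]
      u_has_norm[OF is_subfieldD(3)[OF L x y], unfolded has_norm_def]
  proof eventually_elim
    case (elim n)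
    then obtain a b c where abc: "has_value_at x (E n) a" "N a = u x" "has_value_at y (E n) b" "N b = u y"
      "has_value_at (x + y) (E n) c" "N c = u (x + y)" by blast
    then have "c = a + b" using has_value_at_arith(1) has_value_at_unique by blast
    then show ?case using N.add[of a b] abc by simp
  qed
  then show "u (x + y) \<le> max (u x) (u y)" by simp
qed

lemma Z_seq_Qp: "Z_seq v Qp E = u.vring"
proof -
  have key: "(\<exists>n0. \<forall>n\<ge>n0. \<exists>y. has_value_at \<phi> (E n) y \<and> N y \<le> 1) \<longleftrightarrow> u \<phi> \<le> 1" if \<phi>: "\<phi> \<in> L" for \<phi>
  proof -
    have "eventually (\<lambda>n. (\<exists>y. has_value_at \<phi> (E n) y \<and> N y \<le> 1) \<longleftrightarrow> u \<phi> \<le> 1) sequentially"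
      using u_has_norm[OF \<phi>] unfolding has_norm_def
    proof eventually_elim
      case (elim n)
      then obtain y where y: "has_value_at \<phi> (E n) y" "N y = u \<phi>" by blast
      then have "(\<exists>z. has_value_at \<phi> (E n) z \<and> N z \<le> 1) \<longleftrightarrow> N y \<le> 1"
        using has_value_at_unique[OF y(1)] by blast
      then show ?case using y(2) by simp
    qed
    then have "eventually (\<lambda>n. \<exists>y. has_value_at \<phi> (E n) y \<and> N y \<le> 1) sequentially
      \<longleftrightarrow> eventually (\<lambda>n. u \<phi> \<le> 1) (sequentially :: nat filter)"
      by (rule eventually_subst)
    then show ?thesis unfolding eventually_sequentially by auto
  qed
  show ?thesis unfolding Z_seq_def v_nonneg u.vring_def
    by (rule Collect_cong, rule conj_cong, rule refl, rule key)
qed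

lemma QX_sub_L: "QX \<subseteq> L"
proof
  fix \<phi> assume "\<phi> \<in> QX"
  then obtain f g where fg: "f \<in> polys \<rat>" "g \<in> polys \<rat>" "g \<noteq> 0" "\<phi> = to_fract f / to_fract g"
    by (rule QX_cases)
  moreover have "polys \<rat> \<subseteq> polys Qp" using Rats_Qp by (auto simp: polys_def)
  ultimately show "\<phi> \<in> L" unfolding rat_funs_iff[OF Qp_subfield] by blast
qed

lemma u_QX: assumes "\<phi> \<in> QX" shows "u \<phi> = M \<phi>"
proof -
  obtain f g where fg: "f \<in> polys \<rat>" "g \<in> polys \<rat>" "g \<noteq> 0" "\<phi> = to_fract f / to_fract g"
    using assms by (rule QX_cases)
  have "has_norm \<phi> (M \<phi>)"
    unfolding has_norm_def using follows_eventually[OF fg(1)] follows_eventually[OF fg(2)]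
  proof eventually_elim
    case (elim n)
    then show ?case using value_norm[OF fg(1-3), of "E n"] fg(4) by blast
  qed
  then show ?thesis by (rule u_eqI)
qed

text \<open>Density relative to the size of \<open>y\<close> contains both halves of immediacy:
  \<open>x\<close> has the norm of \<open>y\<close>, and also its residue if that norm is one.
  Numerator and denominator are approximated separately.\<close>

lemma QX_dense:
  assumes y: "y \<in> L" "y \<noteq> 0" shows "\<exists>x\<in>QX. u (y - x) < u y"
proof -
  obtain f g where fg: "f \<in> polys Qp" "g \<in> polys Qp" "g \<noteq> 0" "y = to_fract f / to_fract g"
    using y(1) unfolding rat_funs_iff[OF Qp_subfield] by blast
  have f0: "f \<noteq> 0" using y(2) fg(4) by auto
  have inL: "to_fract f \<in> L" "to_fract g \<in> L"
    using to_fract_in_rat_funs[OF Qp_subfield] fg(1,2) by auto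
  have close: "\<exists>h\<in>polys \<rat>. u (to_fract g - to_fract h) < u (to_fract g)"
    if g: "g \<in> polys Qp" "g \<noteq> 0" for g
  proof -
    have gL: "to_fract g \<in> L" using to_fract_in_rat_funs[OF Qp_subfield g(1)] .
    have "u (to_fract g) > 0" using u.pos[OF gL] g(2) by simp
    then obtain h where h: "h \<in> polys \<rat>"
      "eventually (\<lambda>n. N (poly g (E n) - poly h (E n)) < u (to_fract g)) sequentially"
      using poly_eventually[OF g] by metis
    have hL: "to_fract (g - h) \<in> L"
      using u.KD(7)[OF gL] QX_sub_L to_fract_QX[OF h(1)] by auto
    have "eventually (\<lambda>n. u (to_fract (g - h)) < u (to_fract g)) sequentially"
      using h(2) u_has_norm[OF hL, unfolded has_norm_def]
    proof eventually_elim
      case (elim n)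
      then obtain z where z: "has_value_at (to_fract (g - h) / to_fract 1) (E n) z" "N z = u (to_fract (g - h))"
        by auto
      then have "z = poly (g - h) (E n)" using has_value_at_Fract[OF _ z(1)] by simp
      then show ?case using elim(1) z(2) by simp
    qed
    then show ?thesis using h(1) by auto
  qed
  obtain f' where f': "f' \<in> polys \<rat>" "u (to_fract f - to_fract f') < u (to_fract f)" using close[OF fg(1) f0] by blast
  obtain g' where g': "g' \<in> polys \<rat>" "u (to_fract g - to_fract g') < u (to_fract g)" using close[OF fg(2,3)] by blast
  have inL': "to_fract f' \<in> L" "to_fract g' \<in> L" using QX_sub_L to_fract_QX f'(1) g'(1) by blast+
  have ug: "u (to_fract g') = u (to_fract g)" using u.close_eq[OF inL(2) inL'(2) g'(2)] .
  have pos: "u (to_fract g) > 0" "u (to_fract f) > 0" using u.pos inL fg(3) f0 by auto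
  then have g'0: "to_fract g' \<noteq> 0" using ug by auto
  have g0: "to_fract g \<noteq> 0" using fg(3) by simp
  let ?x = "to_fract f' / to_fract g'"
  \<comment> \<open>The numerator of \<open>y - ?x\<close> over the product of the denominators,
    split so that each summand contains one of the two small differences.\<close>
  let ?D = "to_fract f * (to_fract g' - to_fract g) + to_fract g * (to_fract f - to_fract f')"
  have eq: "y - ?x = ?D / (to_fract g * to_fract g')"
    unfolding fg(4) using g0 g'0 by (simp add: field_simps)
  have small: "u ?D < u (to_fract f) * u (to_fract g)"
  proof -
    have 1: "u (to_fract f * (to_fract g' - to_fract g)) < u (to_fract f) * u (to_fract g)"
      using u.mult[OF inL(1) u.KD(7)[OF inL'(2) inL(2)]] u.diff_commute[OF inL'(2) inL(2)] g'(2) pos by simp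
    have 2: "u (to_fract g * (to_fract f - to_fract f')) < u (to_fract f) * u (to_fract g)"
      using u.mult[OF inL(2) u.KD(7)[OF inL(1) inL'(1)]] f'(2) pos by simp
    have "to_fract f * (to_fract g' - to_fract g) \<in> L" "to_fract g * (to_fract f - to_fract f') \<in> L"
      using inL inL' u.KD(4,7) by blast+
    then show ?thesis using u.add 1 2 by fastforce
  qed
  have DL: "?D \<in> L" by (intro u.KD(3) u.KD(4) u.KD(7) inL inL')
  have gg: "u (to_fract g * to_fract g') = u (to_fract g) * u (to_fract g)"
    unfolding u.mult[OF inL(2) inL'(2)] ug ..
  have "u (y - ?x) = u (?D / (to_fract g * to_fract g'))" by (rule arg_cong[OF eq])
  also have "\<dots> = u ?D / (u (to_fract g) * u (to_fract g))"
    unfolding gg[symmetric] by (rule u.divide[OF DL u.KD(4)[OF inL(2) inL'(2)]])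
  also have "\<dots> < u (to_fract f) * u (to_fract g) / (u (to_fract g) * u (to_fract g))"
    by (rule divide_strict_right_mono[OF small mult_pos_pos[OF pos(1) pos(1)]])
  also have "\<dots> = u y" unfolding fg(4) using u.divide[OF inL] pos by simp
  finally show ?thesis using w.KD(8)[OF to_fract_QX[OF f'(1)] to_fract_QX[OF g'(1)]] by blast
qed

lemma immediate: "immediate_extension QX W L (Z_seq v Qp E)"
  unfolding immediate_extension_def Z_seq_Qp W_vring
proof (intro conjI)
  show "valuation_domain QX w.vring" "valuation_domain L u.vring"
    by (rule w.vring_valuation_domain u.vring_valuation_domain)+
  show "QX \<subseteq> L" by (rule QX_sub_L)
  show "w.vring = u.vring \<inter> QX"
    using QX_sub_L u_QX by (auto simp: w.mem_vring u.mem_vring)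
  show "\<exists>h\<in>iso (abstract_value_group QX w.vring) (abstract_value_group L u.vring).
      \<forall>x\<in>QX - {0}. h (abstract_value QX w.vring x) = abstract_value L u.vring x"
  proof (rule abstract_value_group_iso[OF w.ultranorm_axioms u.ultranorm_axioms QX_sub_L u_QX])
    fix y assume y: "y \<in> L" "y \<noteq> 0"
    then obtain x where x: "x \<in> QX" "u (y - x) < u y" using QX_dense by blast
    then show "\<exists>x\<in>QX. u x = u y" using u.close_eq[OF y(1)] QX_sub_L by blast
  qed
  have "\<exists>h\<in>ring_iso (residue_field w.vring) (residue_field u.vring).
      \<forall>x\<in>w.vring. h (residue_class w.vring x) = residue_class u.vring (id x)"
  proof (rule residue_field_iso[OF w.ultranorm_axioms u.ultranorm_axioms])
    show "id x \<in> L \<and> u (id x) = M x" if "x \<in> w.vring" for x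
      using that QX_sub_L u_QX by (auto simp: w.mem_vring)
    show "\<exists>x\<in>w.vring. u (y - id x) < 1" if y: "y \<in> L" "u y \<le> 1" for y
    proof (cases "y = 0")
      case True
      then show ?thesis using w.vring_closed(1) by (intro bexI[of _ 0]) auto
    next
      case False
      then obtain x where x: "x \<in> QX" "u (y - x) < u y" using QX_dense y(1) by blast
      then have "u x = u y" using u.close_eq[OF y(1)] QX_sub_L by blast
      then have "x \<in> w.vring" using x(1) u_QX y(2) by (simp add: w.mem_vring)
      then show ?thesis using x(2) y(2) by (intro bexI[of _ x]) auto
    qed
  qed auto
  then show "\<exists>h\<in>ring_iso (residue_field w.vring) (residue_field u.vring).
      \<forall>x\<in>w.vring. h (residue_class w.vring x) = residue_class u.vring x" by simp
qed

end

section \<open>The completion\<close>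

context padic_ext
begin

definition M_cauchy :: "(nat \<Rightarrow> 'c poly fract) \<Rightarrow> bool" where
  "M_cauchy s \<longleftrightarrow> range s \<subseteq> QX \<and> (\<forall>\<epsilon>>0. \<exists>n0. \<forall>m\<ge>n0. \<forall>n\<ge>n0. M (s m - s n) < \<epsilon>)"

definition M_null :: "(nat \<Rightarrow> 'c poly fract) \<Rightarrow> bool" where
  "M_null s \<longleftrightarrow> range s \<subseteq> QX \<and> (\<forall>\<epsilon>>0. \<exists>n0. \<forall>n\<ge>n0. M (s n) < \<epsilon>)"

lemma ball_iff:
  assumes "a \<in> QX - {0}" "x \<in> QX" shows "x \<in> (\<lambda>x. a * x) ` W \<longleftrightarrow> M x \<le> M a"
proof
  have Ma: "M a > 0" using w.pos assms(1) by simp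
  show "M x \<le> M a" if "x \<in> (\<lambda>x. a * x) ` W"
    using that Ma assms(1) by (auto simp: W_iff w.mult mult_left_le)
  assume "M x \<le> M a"
  then have "x / a \<in> W" using Ma assms by (auto simp: W_iff w.divide w.KD(8))
  then show "x \<in> (\<lambda>x. a * x) ` W" using assms(1) by (intro image_eqI[of _ _ "x / a"]) auto
qed

lemma small_elem: assumes "\<epsilon> > 0" obtains a where "a \<in> QX - {0}" "M a < \<epsilon>"
proof -
  obtain k where k: "N (of_nat p) ^ k < \<epsilon>" using N_p_power_less[OF assms] by blast
  have "(of_nat p :: 'c) ^ k \<in> \<rat>" by simp
  then have "M (const_fun (of_nat p ^ k)) < \<epsilon>" "const_fun (of_nat p ^ k) \<in> QX - {0}"
    using w_Rats k const_QX[where 'a='c] p_nonzero by (auto simp: N.power)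
  then show thesis using that by blast
qed

lemma adic_cauchy_iff: "s \<in> adic_cauchy QX W \<longleftrightarrow> M_cauchy s"
proof (cases "range s \<subseteq> QX")
  case True
  then have d: "s m - s n \<in> QX" for m n using w.KD(7) by blast
  have "s \<in> adic_cauchy QX W \<longleftrightarrow> (\<forall>a\<in>QX - {0}. \<exists>n0. \<forall>m\<ge>n0. \<forall>n\<ge>n0. M (s m - s n) \<le> M a)"
    unfolding adic_cauchy_def using True ball_iff[OF _ d] by auto
  also have "\<dots> \<longleftrightarrow> (\<forall>\<epsilon>>0. \<exists>n0. \<forall>m\<ge>n0. \<forall>n\<ge>n0. M (s m - s n) < \<epsilon>)"
  proof (intro iffI allI impI ballI)
    fix \<epsilon> :: real assume *: "\<forall>a\<in>QX - {0}. \<exists>n0. \<forall>m\<ge>n0. \<forall>n\<ge>n0. M (s m - s n) \<le> M a" "\<epsilon> > 0"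
    obtain a where a: "a \<in> QX - {0}" "M a < \<epsilon>" using small_elem[OF *(2)] by blast
    then show "\<exists>n0. \<forall>m\<ge>n0. \<forall>n\<ge>n0. M (s m - s n) < \<epsilon>" using * by (meson le_less_trans)
  next
    fix a assume *: "\<forall>\<epsilon>>0. \<exists>n0. \<forall>m\<ge>n0. \<forall>n\<ge>n0. M (s m - s n) < \<epsilon>" "a \<in> QX - {0}"
    then have "M a > 0" using w.pos by blast
    then show "\<exists>n0. \<forall>m\<ge>n0. \<forall>n\<ge>n0. M (s m - s n) \<le> M a" using * by (meson less_imp_le)
  qed
  finally show ?thesis using True by (simp add: M_cauchy_def)
qed (auto simp: adic_cauchy_def M_cauchy_def)

lemma adic_null_iff: "s \<in> adic_null QX W \<longleftrightarrow> M_null s"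
proof (cases "range s \<subseteq> QX")
  case True
  then have d: "s n \<in> QX" for n by blast
  have "s \<in> adic_null QX W \<longleftrightarrow> (\<forall>a\<in>QX - {0}. \<exists>n0. \<forall>n\<ge>n0. M (s n) \<le> M a)"
    unfolding adic_null_def using True ball_iff[OF _ d] by auto
  also have "\<dots> \<longleftrightarrow> (\<forall>\<epsilon>>0. \<exists>n0. \<forall>n\<ge>n0. M (s n) < \<epsilon>)"
  proof (intro iffI allI impI ballI)
    fix \<epsilon> :: real assume *: "\<forall>a\<in>QX - {0}. \<exists>n0. \<forall>n\<ge>n0. M (s n) \<le> M a" "\<epsilon> > 0"
    obtain a where a: "a \<in> QX - {0}" "M a < \<epsilon>" using small_elem[OF *(2)] by blast
    then show "\<exists>n0. \<forall>n\<ge>n0. M (s n) < \<epsilon>" using * by (meson le_less_trans)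
  next
    fix a assume *: "\<forall>\<epsilon>>0. \<exists>n0. \<forall>n\<ge>n0. M (s n) < \<epsilon>" "a \<in> QX - {0}"
    then have "M a > 0" using w.pos by blast
    then show "\<exists>n0. \<forall>n\<ge>n0. M (s n) \<le> M a" using * by (meson less_imp_le)
  qed
  finally show ?thesis using True by (simp add: M_null_def)
qed (auto simp: adic_null_def M_null_def)

lemma M_cauchyI:
  "(\<And>n. s n \<in> QX) \<Longrightarrow> (\<And>\<epsilon>. \<epsilon> > 0 \<Longrightarrow> \<exists>n0. \<forall>m\<ge>n0. \<forall>n\<ge>n0. M (s m - s n) < \<epsilon>) \<Longrightarrow> M_cauchy s"
  by (auto simp: M_cauchy_def)

lemma M_nullI: "(\<And>n. s n \<in> QX) \<Longrightarrow> (\<And>\<epsilon>. \<epsilon> > 0 \<Longrightarrow> \<exists>n0. \<forall>n\<ge>n0. M (s n) < \<epsilon>) \<Longrightarrow> M_null s"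
  by (auto simp: M_null_def)

lemma M_cauchyD: assumes "M_cauchy s"
  shows "s n \<in> QX" "\<epsilon> > 0 \<Longrightarrow> \<exists>n0. \<forall>m\<ge>n0. \<forall>n\<ge>n0. M (s m - s n) < \<epsilon>"
  using assms by (auto simp: M_cauchy_def)

lemma M_nullD: assumes "M_null s"
  shows "s n \<in> QX" "\<epsilon> > 0 \<Longrightarrow> \<exists>n0. \<forall>n\<ge>n0. M (s n) < \<epsilon>"
  using assms by (auto simp: M_null_def)

lemma M_cauchy_const: "x \<in> QX \<Longrightarrow> M_cauchy (\<lambda>_. x)"
  by (rule M_cauchyI) auto

lemma M_cauchy_add:
  assumes "M_cauchy s" "M_cauchy t" shows "M_cauchy (\<lambda>n. s n + t n)"
proof (rule M_cauchyI)
  note S = M_cauchyD[OF assms(1)] and T = M_cauchyD[OF assms(2)]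
  show "s n + t n \<in> QX" for n using S(1) T(1) w.KD(3) by blast
  fix \<epsilon> :: real assume \<epsilon>: "\<epsilon> > 0"
  obtain n1 where n1: "\<And>m n. m \<ge> n1 \<Longrightarrow> n \<ge> n1 \<Longrightarrow> M (s m - s n) < \<epsilon>" using S(2)[OF \<epsilon>] by blast
  obtain n2 where n2: "\<And>m n. m \<ge> n2 \<Longrightarrow> n \<ge> n2 \<Longrightarrow> M (t m - t n) < \<epsilon>" using T(2)[OF \<epsilon>] by blast
  have "M (s m + t m - (s n + t n)) < \<epsilon>" if "m \<ge> max n1 n2" "n \<ge> max n1 n2" for m n
  proof -
    have "M ((s m - s n) + (t m - t n)) \<le> max (M (s m - s n)) (M (t m - t n))"
      using S(1) T(1) by (intro w.add w.KD(7))
    then show ?thesis using n1[of m n] n2[of m n] that by (simp add: algebra_simps)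
  qed
  then show "\<exists>n0. \<forall>m\<ge>n0. \<forall>n\<ge>n0. M (s m + t m - (s n + t n)) < \<epsilon>" by blast
qed

lemma M_cauchy_bounded:
  assumes "M_cauchy s" obtains B where "B > 0" "\<And>n. M (s n) \<le> B"
proof -
  obtain n0 where n0: "\<And>m n. m \<ge> n0 \<Longrightarrow> n \<ge> n0 \<Longrightarrow> M (s m - s n) < 1"
    using M_cauchyD(2)[OF assms zero_less_one] by blast
  define B where "B = Max (insert 1 ((\<lambda>n. M (s n)) ` {..n0}))"
  have Bn: "M (s n) \<le> B" if "n \<le> n0" for n
    unfolding B_def using that by (intro Max_ge) auto
  have B1: "1 \<le> B" unfolding B_def by (intro Max_ge) auto
  have "M (s n) \<le> B" for n
  proof (cases "n \<le> n0")
    case False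
    have "M ((s n - s n0) + s n0) \<le> max (M (s n - s n0)) (M (s n0))"
      using M_cauchyD(1)[OF assms] by (intro w.add w.KD(7))
    then show ?thesis using n0[of n n0] False Bn[of n0] B1 by auto
  qed (use Bn in auto)
  then show thesis using that[of B] B1 by auto
qed

lemma M_null_mult:
  assumes "M_cauchy s" "M_null t" shows "M_null (\<lambda>n. s n * t n)"
proof (rule M_nullI)
  obtain B where B: "B > 0" "\<And>n. M (s n) \<le> B" using M_cauchy_bounded[OF assms(1)] by blast
  note S = M_cauchyD[OF assms(1)] and T = M_nullD[OF assms(2)]
  show "s n * t n \<in> QX" for n using S(1) T(1) w.KD(4) by blast
  fix \<epsilon> :: real assume \<epsilon>: "\<epsilon> > 0"
  then obtain n0 where n0: "\<And>n. n \<ge> n0 \<Longrightarrow> M (t n) < \<epsilon> / B" using T(2)[of "\<epsilon> / B"] B(1) by auto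
  have "M (s n * t n) < \<epsilon>" if "n \<ge> n0" for n
  proof -
    have "M (s n * t n) \<le> B * M (t n)"
      unfolding w.mult[OF S(1) T(1)] using B(2) w.nonneg[OF T(1)] by (intro mult_right_mono)
    also have "\<dots> < \<epsilon>" using n0[OF that] B(1) by (simp add: pos_less_divide_eq mult.commute)
    finally show ?thesis .
  qed
  then show "\<exists>n0. \<forall>n\<ge>n0. M (s n * t n) < \<epsilon>" by blast
qed

lemma M_cauchy_mult:
  assumes "M_cauchy s" "M_cauchy t" shows "M_cauchy (\<lambda>n. s n * t n)"
proof (rule M_cauchyI)
  note S = M_cauchyD[OF assms(1)] and T = M_cauchyD[OF assms(2)]
  obtain A where A: "A > 0" "\<And>n. M (s n) \<le> A" using M_cauchy_bounded[OF assms(1)] by blast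
  obtain B where B: "B > 0" "\<And>n. M (t n) \<le> B" using M_cauchy_bounded[OF assms(2)] by blast
  show "s n * t n \<in> QX" for n using S(1) T(1) w.KD(4) by blast
  fix \<epsilon> :: real assume \<epsilon>: "\<epsilon> > 0"
  obtain n1 where n1: "\<And>m n. m \<ge> n1 \<Longrightarrow> n \<ge> n1 \<Longrightarrow> M (s m - s n) < \<epsilon> / B"
    using S(2)[of "\<epsilon> / B"] \<epsilon> B(1) by auto
  obtain n2 where n2: "\<And>m n. m \<ge> n2 \<Longrightarrow> n \<ge> n2 \<Longrightarrow> M (t m - t n) < \<epsilon> / A"
    using T(2)[of "\<epsilon> / A"] \<epsilon> A(1) by auto
  have "M (s m * t m - s n * t n) < \<epsilon>" if "m \<ge> max n1 n2" "n \<ge> max n1 n2" for m n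
  proof -
    have d: "s m - s n \<in> QX" "t m - t n \<in> QX" using S(1) T(1) w.KD(7) by blast+
    have "M ((s m - s n) * t m) \<le> M (s m - s n) * B"
      unfolding w.mult[OF d(1) T(1)] using B(2) w.nonneg[OF d(1)] by (intro mult_left_mono)
    also have "\<dots> < \<epsilon>" using n1[of m n] that B(1) by (simp add: pos_less_divide_eq)
    finally have 1: "M ((s m - s n) * t m) < \<epsilon>" .
    have "M (s n * (t m - t n)) \<le> A * M (t m - t n)"
      unfolding w.mult[OF S(1) d(2)] using A(2) w.nonneg[OF d(2)] by (intro mult_right_mono)
    also have "\<dots> < \<epsilon>" using n2[of m n] that A(1) by (simp add: pos_less_divide_eq mult.commute)
    finally have 2: "M (s n * (t m - t n)) < \<epsilon>" .
    have "M ((s m - s n) * t m + s n * (t m - t n)) \<le> max (M ((s m - s n) * t m)) (M (s n * (t m - t n)))"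
      by (intro w.add w.KD(4) d S(1) T(1))
    then show ?thesis using 1 2 by (simp add: algebra_simps)
  qed
  then show "\<exists>n0. \<forall>m\<ge>n0. \<forall>n\<ge>n0. M (s m * t m - s n * t n) < \<epsilon>" by blast
qed

lemma M_cauchy_uminus: "M_cauchy s \<Longrightarrow> M_cauchy (\<lambda>n. - s n)"
  using M_cauchy_mult[OF M_cauchy_const[of "-1"], of s] w.KD(2,5) by simp

lemma M_null_cauchy: assumes "M_null s" shows "M_cauchy s"
proof (rule M_cauchyI)
  note S = M_nullD[OF assms]
  show "s n \<in> QX" for n by (rule S(1))
  fix \<epsilon> :: real assume "\<epsilon> > 0"
  then obtain n0 where n0: "\<And>n. n \<ge> n0 \<Longrightarrow> M (s n) < \<epsilon>" using S(2) by blast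
  have "M (s m - s n) < \<epsilon>" if "m \<ge> n0" "n \<ge> n0" for m n
    using w.diff[OF S(1) S(1), of m n] n0[OF that(1)] n0[OF that(2)] by simp
  then show "\<exists>n0. \<forall>m\<ge>n0. \<forall>n\<ge>n0. M (s m - s n) < \<epsilon>" by blast
qed

lemma M_null_add:
  assumes "M_null s" "M_null t" shows "M_null (\<lambda>n. s n + t n)"
proof (rule M_nullI)
  note S = M_nullD[OF assms(1)] and T = M_nullD[OF assms(2)]
  show "s n + t n \<in> QX" for n using S(1) T(1) w.KD(3) by blast
  fix \<epsilon> :: real assume \<epsilon>: "\<epsilon> > 0"
  obtain n1 where n1: "\<And>n. n \<ge> n1 \<Longrightarrow> M (s n) < \<epsilon>" using S(2)[OF \<epsilon>] by blast
  obtain n2 where n2: "\<And>n. n \<ge> n2 \<Longrightarrow> M (t n) < \<epsilon>" using T(2)[OF \<epsilon>] by blast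
  have "M (s n + t n) < \<epsilon>" if "n \<ge> max n1 n2" for n
    using w.add[OF S(1) T(1), of n n] n1[of n] n2[of n] that by simp
  then show "\<exists>n0. \<forall>n\<ge>n0. M (s n + t n) < \<epsilon>" by blast
qed

lemma M_null_uminus: "M_null s \<Longrightarrow> M_null (\<lambda>n. - s n)"
  using M_null_mult[OF M_cauchy_const[of "-1"], of s] w.KD(2,5) by simp

text \<open>A Cauchy sequence that is not null is bounded away from zero from some index on. The
  finitely many earlier terms may be zero, with inverse 0, so the product with the inverse sequence
  is 1 only up to a null sequence.\<close>

lemma M_cauchy_inverse:
  assumes "M_cauchy s" "\<not> M_null s"
  shows "M_cauchy (\<lambda>n. inverse (s n))" "M_null (\<lambda>n. s n * inverse (s n) - 1)"
proof -
  note S = M_cauchyD[OF assms(1)]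
  obtain \<delta> where \<delta>: "\<delta> > 0" "\<And>n0. \<exists>n\<ge>n0. \<delta> \<le> M (s n)"
    using assms(2) S(1) unfolding M_null_def by (force simp: not_less)
  obtain n0 where n0: "\<And>m n. m \<ge> n0 \<Longrightarrow> n \<ge> n0 \<Longrightarrow> M (s m - s n) < \<delta>" using S(2)[OF \<delta>(1)] by blast
  have low: "\<delta> \<le> M (s n)" if "n \<ge> n0" for n
  proof -
    obtain m where m: "m \<ge> n0" "\<delta> \<le> M (s m)" using \<delta>(2) by blast
    then have "M (s m - s n) < M (s m)" using n0[OF m(1) that] by simp
    then show ?thesis using w.close_eq[OF S(1) S(1)] m(2) by metis
  qed
  have nz: "s n \<noteq> 0" if "n \<ge> n0" for n using low[OF that] \<delta>(1) by auto
  show "M_cauchy (\<lambda>n. inverse (s n))"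
  proof (rule M_cauchyI)
    show "inverse (s n) \<in> QX" for n by (rule w.KD(6)[OF S(1)])
    fix \<epsilon> :: real assume "\<epsilon> > 0"
    then have "\<epsilon> * (\<delta> * \<delta>) > 0" using \<delta>(1) by simp
    then obtain n1 where n1: "\<And>m n. m \<ge> n1 \<Longrightarrow> n \<ge> n1 \<Longrightarrow> M (s m - s n) < \<epsilon> * (\<delta> * \<delta>)" using S(2) by blast
    have "M (inverse (s m) - inverse (s n)) < \<epsilon>" if mn: "m \<ge> max n0 n1" "n \<ge> max n0 n1" for m n
    proof -
      have ge: "m \<ge> n0" "n \<ge> n0" using mn by auto
      have "inverse (s m) - inverse (s n) = (s n - s m) / (s m * s n)"
        using nz[OF ge(1)] nz[OF ge(2)] by (simp add: field_simps)
      then have "M (inverse (s m) - inverse (s n)) = M (s n - s m) / (M (s m) * M (s n))"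
        using w.divide[OF w.KD(7)[OF S(1) S(1)] w.KD(4)[OF S(1) S(1)]] w.mult[OF S(1) S(1)] by simp
      also have "\<dots> \<le> M (s n - s m) / (\<delta> * \<delta>)"
        using low[OF ge(1)] low[OF ge(2)] \<delta>(1) w.nonneg[OF w.KD(7)[OF S(1) S(1)]]
        by (intro divide_left_mono mult_mono) (auto intro!: mult_pos_pos)
      also have "\<dots> < \<epsilon>" using n1[of n m] mn \<delta>(1) by (simp add: pos_divide_less_eq)
      finally show ?thesis .
    qed
    then show "\<exists>n0. \<forall>m\<ge>n0. \<forall>n\<ge>n0. M (inverse (s m) - inverse (s n)) < \<epsilon>" by blast
  qed
  show "M_null (\<lambda>n. s n * inverse (s n) - 1)"
  proof (rule M_nullI)
    show "s n * inverse (s n) - 1 \<in> QX" for n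
      using w.KD(7)[OF w.KD(4)[OF S(1) w.KD(6)[OF S(1)]] w.KD(2)] .
    fix \<epsilon> :: real assume "\<epsilon> > 0"
    then show "\<exists>n0. \<forall>n\<ge>n0. M (s n * inverse (s n) - 1) < \<epsilon>"
      using nz by (intro exI[of _ n0]) auto
  qed
qed

section \<open>The completion as a field over the closure of the rationals\<close>

abbreviation CR :: "(nat \<Rightarrow> 'c poly fract) ring" where "CR \<equiv> cauchy_ring QX W"
abbreviation QXhat :: "(nat \<Rightarrow> 'c poly fract) set ring" where "QXhat \<equiv> completion QX W"
abbreviation Qphat :: "(nat \<Rightarrow> 'c poly fract) set set" where
  "Qphat \<equiv> completion_closure QX W (const_fun ` \<rat>)"
abbreviation climit :: "(nat \<Rightarrow> 'c poly fract) \<Rightarrow> (nat \<Rightarrow> 'c poly fract) set" where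
  "climit \<equiv> completion_lim QX W"

lemma CR_simps [simp]:
  "carrier CR = {s. M_cauchy s}" "monoid.mult CR = (\<lambda>s t n. s n * t n)" "one CR = (\<lambda>_. 1)"
  "ring.zero CR = (\<lambda>_. 0)" "add CR = (\<lambda>s t n. s n + t n)"
  using adic_cauchy_iff by (auto simp: cauchy_ring_def)

sublocale CR: cring CR
proof (rule cringI)
  show "abelian_group CR"
  proof (rule abelian_groupI)
    fix s assume "s \<in> carrier CR"
    then show "\<exists>t\<in>carrier CR. t \<oplus>\<^bsub>CR\<^esub> s = \<zero>\<^bsub>CR\<^esub>"
      using M_cauchy_uminus by (intro bexI[of _ "\<lambda>n. - s n"]) auto
  qed (use M_cauchy_add M_cauchy_const[OF w.KD(1)] in \<open>auto simp: add_ac\<close>)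
  show "Group.comm_monoid CR"
    by (rule comm_monoidI) (use M_cauchy_mult M_cauchy_const[OF w.KD(2)] in \<open>auto simp: mult_ac\<close>)
qed (auto simp: distrib_right)

lemma CR_a_inv: "M_cauchy s \<Longrightarrow> \<ominus>\<^bsub>CR\<^esub> s = (\<lambda>n. - s n)"
  using M_cauchy_uminus by (intro CR.minus_equality) auto

lemma CR_pow: "s [^]\<^bsub>CR\<^esub> (k::nat) = (\<lambda>n. s n ^ k)"
  by (induction k) (simp_all add: nat_pow_def mult.commute)

lemma adic_null_ideal: "ideal (adic_null QX W) CR"
proof (rule idealI)
  show "ring CR" by (rule CR.ring_axioms)
  show "subgroup (adic_null QX W) (add_monoid CR)"
  proof (rule CR.add.subgroupI)
    show "adic_null QX W \<subseteq> carrier CR" using M_null_cauchy by (auto simp: adic_null_iff)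
    have "M_null (\<lambda>_. 0)" by (rule M_nullI) (auto simp: w.KD)
    then show "adic_null QX W \<noteq> {}" using adic_null_iff by blast
    show "\<ominus>\<^bsub>CR\<^esub> s \<in> adic_null QX W" if "s \<in> adic_null QX W" for s
      using that M_null_uminus M_null_cauchy by (simp add: adic_null_iff CR_a_inv)
    show "s \<oplus>\<^bsub>CR\<^esub> t \<in> adic_null QX W" if "s \<in> adic_null QX W" "t \<in> adic_null QX W" for s t
      using that M_null_add by (simp add: adic_null_iff)
  qed
  show "s \<otimes>\<^bsub>CR\<^esub> t \<in> adic_null QX W" "t \<otimes>\<^bsub>CR\<^esub> s \<in> adic_null QX W"
    if "t \<in> adic_null QX W" "s \<in> carrier CR" for s t
    using that M_null_mult by (auto simp: adic_null_iff mult.commute)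
qed

lemma climit_hom: "ring_hom_ring CR QXhat climit"
  using ideal.rcos_ring_hom_ring[OF adic_null_ideal]
  unfolding completion_def completion_lim_def[abs_def] .

lemma climit_eq_iff:
  assumes "M_cauchy s" "M_cauchy t"
  shows "climit s = climit t \<longleftrightarrow> M_null (\<lambda>n. s n - t n)"
proof -
  have mem: "x \<in> climit t \<longleftrightarrow> M_null (\<lambda>n. x n - t n)" if "M_cauchy x" "M_cauchy t" for x t
  proof -
    have "x \<in> climit t \<longleftrightarrow> (\<exists>y. M_null y \<and> x = (\<lambda>n. y n + t n))"
      unfolding completion_lim_def a_r_coset_def' by (auto simp: adic_null_iff)
    also have "\<dots> \<longleftrightarrow> M_null (\<lambda>n. x n - t n)"
      by (auto intro!: exI[of _ "\<lambda>n. x n - t n"])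
    finally show ?thesis .
  qed
  have cauchy: "M_cauchy x" if "x \<in> climit t" "M_cauchy t" for x t
    using that M_cauchy_add M_null_cauchy unfolding completion_lim_def a_r_coset_def' by (auto simp: adic_null_iff)
  show ?thesis
  proof
    assume "climit s = climit t"
    moreover have "M_null (\<lambda>_. 0)" by (rule M_nullI) (auto simp: w.KD)
    then have "s \<in> climit s" using mem[OF assms(1,1)] by simp
    ultimately show "M_null (\<lambda>n. s n - t n)" using mem[OF assms] by simp
  next
    assume d: "M_null (\<lambda>n. s n - t n)"
    have "x \<in> climit s \<longleftrightarrow> x \<in> climit t" if x: "M_cauchy x" for x
      using M_null_add[OF _ d, of "\<lambda>n. x n - s n"] M_null_add[OF _ M_null_uminus[OF d], of "\<lambda>n. x n - t n"]
        mem[OF x assms(1)] mem[OF x assms(2)] by auto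
    then show "climit s = climit t" using cauchy assms by blast
  qed
qed

lemma carrier_QXhat: "carrier QXhat = climit ` {s. M_cauchy s}"
  unfolding completion_def FactRing_def A_RCOSETS_def' completion_lim_def by auto

lemma QXhat_cring: "cring QXhat"
  unfolding completion_def by (rule ideal.quotient_is_cring[OF adic_null_ideal CR.cring_axioms])

sublocale C: cring QXhat by (rule QXhat_cring)

sublocale h: ring_hom_ring CR QXhat climit by (rule climit_hom)

lemma climit_zero_iff: "M_cauchy s \<Longrightarrow> climit s = \<zero>\<^bsub>QXhat\<^esub> \<longleftrightarrow> M_null s"
  using climit_eq_iff[OF _ M_cauchy_const[OF w.KD(1)], of s] h.hom_zero by simp

lemma climit_inverse:
  assumes "M_cauchy s" "\<not> M_null s"
  shows "climit s \<otimes>\<^bsub>QXhat\<^esub> climit (\<lambda>n. inverse (s n)) = \<one>\<^bsub>QXhat\<^esub>"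
proof -
  note I = M_cauchy_inverse[OF assms]
  have "climit s \<otimes>\<^bsub>QXhat\<^esub> climit (\<lambda>n. inverse (s n)) = climit (\<lambda>n. s n * inverse (s n))"
    using h.hom_mult[of s "\<lambda>n. inverse (s n)"] assms(1) I(1) by simp
  also have "\<dots> = climit (\<lambda>_. 1)"
    using climit_eq_iff[OF M_cauchy_mult[OF assms(1) I(1)] M_cauchy_const[OF w.KD(2)]] I(2) by simp
  finally show ?thesis using h.hom_one by simp
qed

lemma QXhat_field: "field QXhat"
proof (rule cring.cring_fieldI2[OF QXhat_cring])
  have "\<not> M_null (\<lambda>_. 1)"
  proof
    assume "M_null (\<lambda>_. 1)"
    from M_nullD(2)[OF this, of 1] show False by auto
  qed
  then show "\<zero>\<^bsub>QXhat\<^esub> \<noteq> \<one>\<^bsub>QXhat\<^esub>"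
    using climit_zero_iff[OF M_cauchy_const[OF w.KD(2)]] h.hom_one by auto
  fix a assume a: "a \<in> carrier QXhat" "a \<noteq> \<zero>\<^bsub>QXhat\<^esub>"
  then obtain s where s: "M_cauchy s" "a = climit s" by (auto simp: carrier_QXhat)
  then have "\<not> M_null s" using a(2) climit_zero_iff by blast
  then show "\<exists>b\<in>carrier QXhat. a \<otimes>\<^bsub>QXhat\<^esub> b = \<one>\<^bsub>QXhat\<^esub>"
    using climit_inverse[OF s(1)] M_cauchy_inverse[OF s(1)] s(2) by (auto simp: carrier_QXhat)
qed

sublocale C: field QXhat by (rule QXhat_field)

lemma Qphat_eq: "Qphat = climit ` {s. M_cauchy s \<and> range s \<subseteq> const_fun ` \<rat>}"
  unfolding completion_closure_def using adic_cauchy_iff by auto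

lemma Qphat_subfield: "subfield Qphat QXhat"
proof (rule C.subfieldI')
  have mem: "climit s \<in> Qphat" if "M_cauchy s" "\<And>n. s n \<in> const_fun ` \<rat>" for s
    unfolding Qphat_eq using that by blast
  have cl: "x + y \<in> const_fun ` \<rat>" "x * y \<in> const_fun ` \<rat>" "- x \<in> const_fun ` \<rat>" "inverse x \<in> const_fun ` \<rat>"
    if xy: "x \<in> const_fun ` \<rat>" "y \<in> const_fun ` \<rat>" for x y :: "'c poly fract"
  proof -
    obtain a b :: 'c where ab: "a \<in> \<rat>" "b \<in> \<rat>" "x = const_fun a" "y = const_fun b" using xy by blast
    show "x + y \<in> const_fun ` \<rat>" using ab by (intro image_eqI[of _ _ "a + b"]) auto
    show "x * y \<in> const_fun ` \<rat>" using ab by (intro image_eqI[of _ _ "a * b"]) auto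
    show "- x \<in> const_fun ` \<rat>" using ab by (intro image_eqI[of _ _ "- a"]) auto
    show "inverse x \<in> const_fun ` \<rat>"
      using ab by (intro image_eqI[of _ _ "inverse a"]) (auto simp: const_fun_inverse)
  qed
  show "subring Qphat QXhat"
  proof (rule C.subringI)
    show "Qphat \<subseteq> carrier QXhat" unfolding Qphat_eq carrier_QXhat by blast
    have "climit (\<lambda>_. 1) \<in> Qphat"
      by (rule mem[OF M_cauchy_const[OF w.KD(2)]]) (auto intro!: image_eqI[of _ _ 1])
    then show "\<one>\<^bsub>QXhat\<^esub> \<in> Qphat" using h.hom_one by simp
    fix a assume "a \<in> Qphat"
    then obtain s where s: "M_cauchy s" "\<And>n. s n \<in> const_fun ` \<rat>" "a = climit s" unfolding Qphat_eq by blast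
    have "\<ominus>\<^bsub>QXhat\<^esub> a = climit (\<lambda>n. - s n)"
      using h.hom_a_inv[of s] s(1,3) CR_a_inv by simp
    then show "\<ominus>\<^bsub>QXhat\<^esub> a \<in> Qphat" using mem[OF M_cauchy_uminus[OF s(1)]] cl(3)[OF s(2) s(2)] by simp
    fix b assume "b \<in> Qphat"
    then obtain t where t: "M_cauchy t" "\<And>n. t n \<in> const_fun ` \<rat>" "b = climit t" unfolding Qphat_eq by blast
    show "a \<otimes>\<^bsub>QXhat\<^esub> b \<in> Qphat"
      using mem[OF M_cauchy_mult[OF s(1) t(1)] cl(2)[OF s(2) t(2)]] h.hom_mult[of s t] s(1,3) t(1,3) by simp
    show "a \<oplus>\<^bsub>QXhat\<^esub> b \<in> Qphat"
      using mem[OF M_cauchy_add[OF s(1) t(1)] cl(1)[OF s(2) t(2)]] h.hom_add[of s t] s(1,3) t(1,3) by simp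
  qed
  fix a assume a: "a \<in> Qphat - {\<zero>\<^bsub>QXhat\<^esub>}"
  then obtain s where s: "M_cauchy s" "\<And>n. s n \<in> const_fun ` \<rat>" "a = climit s" unfolding Qphat_eq by blast
  have nn: "\<not> M_null s" using a s climit_zero_iff by blast
  have "inv\<^bsub>QXhat\<^esub> a = climit (\<lambda>n. inverse (s n))"
    unfolding s(3) using climit_inverse[OF s(1) nn] s(1) M_cauchy_inverse(1)[OF s(1) nn]
    by (intro C.comm_inv_char) (auto simp: carrier_QXhat)
  then show "inv\<^bsub>QXhat\<^esub> a \<in> Qphat"
    using mem[OF M_cauchy_inverse(1)[OF s(1) nn] cl(4)[OF s(2) s(2)]] by simp
qed

lemma X_fun_QX: "X_fun \<in> QX"
  using to_fract_QX[of "[:0, 1 :: 'c:]"] by (auto simp: X_fun_def to_fract_def polys_def coeff_pCons split: nat.splits)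

lemma finite_imp_algebraic:
  assumes "C.finite_dimension Qphat (carrier QXhat)"
  shows "C.algebraic Qphat (climit (\<lambda>_. X_fun))"
proof -
  have "climit (\<lambda>_. X_fun) \<in> carrier QXhat"
    using M_cauchy_const[OF X_fun_QX] by (auto simp: carrier_QXhat)
  from C.finite_dimension_imp_algebraic[OF Qphat_subfield C.carrier_is_subring assms this]
  show ?thesis by (simp add: over_def)
qed

text \<open>Evaluation in the ring of sequences is termwise; the reversal is due to coefficient
  lists that start with the leading coefficient.\<close>

lemma CR_eval:
  "CR.eval (map (\<lambda>s n. const_fun (q s n)) P) (\<lambda>_. X_fun) = (\<lambda>n. to_fract (Poly (rev (map (\<lambda>s. q s n) P))))"
proof (induction P)
  case (Cons s P)
  have X_pow: "X_fun ^ k = to_fract (monom 1 k :: 'c poly)" for k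
    by (simp add: X_fun_def monom_altdef to_fract_power flip: to_fract_def)
  show ?case
    by (rule HOL.ext) (simp add: Cons Poly_append CR_pow X_pow to_fract_smult add.commute)
qed auto

text \<open>The coefficients of an equation of \<open>X\<close> over \<open>Qphat\<close> are limits
  of rational sequences, which also converge in \<open>Q_p v\<close>. The equation thus becomes a
  polynomial \<open>g\<close> over \<open>Q_p v\<close>, whose rational approximations
  \<open>h n\<close> tend to zero for \<open>w\<close>; this is the situation of
  \<open>approx_root_limit\<close>.\<close>

lemma algebraic_limit:
  assumes alg: "C.algebraic Qphat (climit (\<lambda>_. X_fun))" and E: "pseudo E" "follows E"
  shows "\<exists>\<alpha>. norm_point \<alpha> \<and> v_converges v E \<alpha>"
proof -
  have Xc: "M_cauchy (\<lambda>_. X_fun)" by (rule M_cauchy_const[OF X_fun_QX])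
  have alg': "(C.algebraic over Qphat) (climit (\<lambda>_. X_fun))" using alg by (simp add: over_def)
  have Xcar: "climit (\<lambda>_. X_fun) \<in> carrier QXhat" using Xc by (auto simp: carrier_QXhat)
  obtain P where P: "P \<in> carrier (Qphat[X]\<^bsub>QXhat\<^esub>)" "P \<noteq> []" "C.eval P (climit (\<lambda>_. X_fun)) = \<zero>\<^bsub>QXhat\<^esub>"
    by (rule C.algebraicE[OF subfieldE(1)[OF Qphat_subfield] Xcar alg'])
  have PF: "set P \<subseteq> Qphat" "hd P \<noteq> \<zero>\<^bsub>QXhat\<^esub>"
    using P(1,2) unfolding univ_poly_carrier[symmetric] polynomial_def by auto
  have "\<exists>q. (\<forall>n. q n \<in> \<rat>) \<and> M_cauchy (\<lambda>n. const_fun (q n)) \<and> a = climit (\<lambda>n. const_fun (q n))"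
    if "a \<in> Qphat" for a
  proof -
    obtain s where s: "M_cauchy s" "range s \<subseteq> const_fun ` \<rat>" "a = climit s"
      using \<open>a \<in> Qphat\<close> unfolding Qphat_eq by blast
    have "\<exists>x. x \<in> \<rat> \<and> s n = const_fun x" for n using s(2) by blast
    then obtain q where q: "\<And>n. q n \<in> \<rat>" "\<And>n. s n = const_fun (q n)" by metis
    have "s = (\<lambda>n. const_fun (q n))" using q(2) by blast
    then show ?thesis using s q by blast
  qed
  then obtain q where q: "\<And>a n. a \<in> Qphat \<Longrightarrow> q a n \<in> \<rat>" "\<And>a. a \<in> Qphat \<Longrightarrow> M_cauchy (\<lambda>n. const_fun (q a n))"
    "\<And>a. a \<in> Qphat \<Longrightarrow> a = climit (\<lambda>n. const_fun (q a n))" by metis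
  have "\<exists>c\<in>Qp. v_converges v (q a) c" if a: "a \<in> Qphat" for a
  proof -
    have eq: "M (const_fun (q a m) - const_fun (q a n)) = N (q a m - q a n)" for m n
      using w_Rats[of "q a m - q a n"] q(1)[OF a] by simp
    have "N_cauchy (q a)" using M_cauchyD(2)[OF q(2)[OF a]] unfolding N_cauchy_def eq by blast
    moreover have "range (q a) \<subseteq> Qp" using q(1)[OF a] Rats_Qp by blast
    ultimately show ?thesis using complete_Qp unfolding complete_set_def by blast
  qed
  then obtain c where c: "\<And>a. a \<in> Qphat \<Longrightarrow> c a \<in> Qp" "\<And>a. a \<in> Qphat \<Longrightarrow> v_converges v (q a) (c a)" by metis
  define h where "h = (\<lambda>n. Poly (rev (map (\<lambda>a. q a n) P)))"
  define g where "g = Poly (rev (map c P))"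
  have null: "M_null (\<lambda>n. to_fract (h n))"
  proof -
    have Pq: "map climit (map (\<lambda>a n. const_fun (q a n)) P) = P"
    proof -
      have "map (\<lambda>a. climit (\<lambda>n. const_fun (q a n))) P = map (\<lambda>a. a) P"
        using PF(1) q(3) by (intro map_cong) auto
      then show ?thesis by (simp add: o_def)
    qed
    have car: "set (map (\<lambda>a n. const_fun (q a n)) P) \<subseteq> carrier CR" using q(2) PF(1) by auto
    have "climit (CR.eval (map (\<lambda>a n. const_fun (q a n)) P) (\<lambda>_. X_fun)) = \<zero>\<^bsub>QXhat\<^esub>"
      using h.eval_hom'[of "\<lambda>_. X_fun" "map (\<lambda>a n. const_fun (q a n)) P"] Xc car P(3) unfolding Pq by simp
    moreover have "CR.eval (map (\<lambda>a n. const_fun (q a n)) P) (\<lambda>_. X_fun) \<in> carrier CR"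
      using CR.eval_in_carrier[OF car, of "\<lambda>_. X_fun"] Xc by simp
    ultimately show ?thesis unfolding CR_eval h_def using climit_zero_iff by auto
  qed
  have PQ: "a \<in> set P \<Longrightarrow> a \<in> Qphat" for a using PF(1) by blast
  have coeff_g: "coeff g i = (if i < length P then c (rev P ! i) else 0)"
    and coeff_h: "coeff (h n) i = (if i < length P then q (rev P ! i) n else 0)" for i n
    unfolding g_def h_def rev_map by (auto simp: nth_default_def)
  have rP: "rev P ! i \<in> set P" if "i < length P" for i
    using nth_mem[of i "rev P"] that by simp
  have gQ: "g \<in> polys Qp" using c(1) PQ rP QpD(1) by (auto simp: polys_def coeff_g)
  have hR: "h n \<in> polys \<rat>" for n using q(1) PQ rP by (auto simp: polys_def coeff_h)
  \<comment> \<open>If the leading coefficient became zero in \<open>Q_p v\<close>, its rational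
    sequence would be null for \<open>w\<close> too, since both norms agree on the
    rationals.\<close>
  have "g \<noteq> 0"
  proof
    assume "g = 0"
    then have "coeff g (length P - 1) = 0" by simp
    moreover have "rev P ! (length P - 1) = hd P" using P(2) by (simp add: rev_nth hd_conv_nth)
    ultimately have c0: "c (hd P) = 0" using P(2) by (simp add: coeff_g)
    have hd: "hd P \<in> Qphat" using PQ P(2) by simp
    have "M_null (\<lambda>n. const_fun (q (hd P) n))"
    proof (rule M_nullI)
      show "const_fun (q (hd P) n) \<in> QX" for n using const_QX q(1)[OF hd] by blast
      show "\<exists>n0. \<forall>n\<ge>n0. M (const_fun (q (hd P) n)) < \<epsilon>" if "\<epsilon> > 0" for \<epsilon>
        using c(2)[OF hd] that w_Rats[OF q(1)[OF hd]] unfolding v_converges_iff c0 by simp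
    qed
    then show False using climit_zero_iff[OF q(2)[OF hd]] q(3)[OF hd] PF(2) by simp
  qed
  moreover have "\<exists>h\<in>polys \<rat>. degree h \<le> length P \<and> (\<forall>i. N (coeff (g - h) i) \<le> \<epsilon>) \<and> M (to_fract h) < \<epsilon>"
    if \<epsilon>: "\<epsilon> > 0" for \<epsilon>
  proof -
    have "\<exists>n0. \<forall>n\<ge>n0. N (q a n - c a) < \<epsilon>" if "a \<in> set P" for a
      using c(2)[OF PQ[OF that]] \<epsilon> unfolding v_converges_iff by blast
    then obtain f where f: "\<And>a n. a \<in> set P \<Longrightarrow> n \<ge> f a \<Longrightarrow> N (q a n - c a) < \<epsilon>" by metis
    obtain n1 where n1: "\<And>n. n \<ge> n1 \<Longrightarrow> M (to_fract (h n)) < \<epsilon>" using M_nullD(2)[OF null \<epsilon>] by blast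
    \<comment> \<open>There are finitely many coefficients, so one index serves for all of them and
      for the smallness of \<open>h n\<close>.\<close>
    define n where "n = Max (insert n1 (f ` set P))"
    have n: "n \<ge> n1" "\<And>a. a \<in> set P \<Longrightarrow> n \<ge> f a" unfolding n_def by (auto intro!: Max_ge)
    have "N (coeff (g - h n) i) \<le> \<epsilon>" for i
      using f[OF rP n(2)[OF rP], of i] \<epsilon> N.diff_commute[of "q (rev P ! i) n" "c (rev P ! i)"]
      by (auto simp: coeff_g coeff_h less_imp_le)
    moreover have "degree (h n) \<le> length P" by (rule degree_le) (auto simp: coeff_h)
    ultimately show ?thesis using hR n1[OF n(1)] by blast
  qed
  ultimately show ?thesis using approx_root_limit[OF E gQ] by blast
qed

lemma N_cauchy_M_cauchy:
  assumes "\<And>n. c n \<in> \<rat>" "N_cauchy c" shows "M_cauchy (\<lambda>n. const_fun (c n))"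
proof (rule M_cauchyI)
  show "const_fun (c n) \<in> QX" for n using const_QX assms(1) by blast
  have eq: "M (const_fun (c m) - const_fun (c n)) = N (c m - c n)" for m n
    using w_Rats[of "c m - c n"] assms(1) by simp
  show "\<exists>n0. \<forall>m\<ge>n0. \<forall>n\<ge>n0. M (const_fun (c m) - const_fun (c n)) < \<epsilon>" if "\<epsilon> > 0" for \<epsilon>
    using assms(2) that unfolding eq N_cauchy_def by blast
qed

text \<open>The coefficients come from a p-adic expansion of \<open>z\<close> with digits in \<open>T\<close>.\<close>

lemma expansion:
  assumes T: "finite T" "T \<subseteq> W" "\<And>z. z \<in> W \<Longrightarrow> \<exists>t\<in>T. M (z - t) \<le> N (of_nat p)"
    and z: "M_cauchy z"
  shows "\<exists>c. (\<forall>t n. c t n \<in> \<rat>) \<and> (\<forall>t. N_cauchy (c t)) \<and> M_null (\<lambda>n. z n - (\<Sum>t\<in>T. const_fun (c t n) * t))"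
proof -
  let ?P = "N (of_nat p)"
  have TQ: "t \<in> QX" if "t \<in> T" for t using T(2) that W_iff by blast
  obtain B where B: "B > 0" "\<And>n. M (z n) \<le> B" using M_cauchy_bounded[OF z] by blast
  obtain m where m: "?P ^ m < inverse B" using N_p_power_less[of "inverse B"] B(1) by auto
  define r where "r = const_fun ((of_nat p :: 'c) ^ m)"
  have r: "r \<in> QX" "r \<noteq> 0" "M r = ?P ^ m"
    using const_QX[of "of_nat p ^ m"] w_Rats[of "of_nat p ^ m"] p_nonzero by (auto simp: r_def N.power)
  \<comment> \<open>A power of \<open>p\<close> brings the whole sequence into \<open>W\<close>,
    where the digits live; it is divided out again in \<open>d\<close>.\<close>
  define y where "y = (\<lambda>n. r * z n)"
  have yc: "M_cauchy y" unfolding y_def by (rule M_cauchy_mult[OF M_cauchy_const[OF r(1)] z])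
  note Y = M_cauchyD[OF yc]
  have y1: "M (y n) \<le> 1" for n
  proof -
    have "M (y n) \<le> ?P ^ m * B"
      unfolding y_def w.mult[OF r(1) M_cauchyD(1)[OF z]] r(3) using B(2) N_p_bounds by (intro mult_left_mono) auto
    also have "\<dots> \<le> 1" using m B(1) by (simp add: field_simps)
    finally show ?thesis .
  qed
  have Pk: "?P ^ k > 0" for k using N_p_bounds by simp
  have "\<exists>n0. \<forall>m\<ge>n0. \<forall>n\<ge>n0. M (y m - y n) < ?P ^ k" for k using Y(2)[OF Pk] .
  then obtain f where f: "\<And>k m n. m \<ge> f k \<Longrightarrow> n \<ge> f k \<Longrightarrow> M (y m - y n) < ?P ^ k" by metis
  \<comment> \<open>From index \<open>f k\<close> on, the terms of \<open>y\<close> agree up to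
    \<open>p ^ k\<close>; summing the \<open>f j\<close> makes the chosen indices monotone in
    \<open>k\<close>.\<close>
  define \<nu> where "\<nu> = (\<lambda>k. \<Sum>j\<le>k. f j)"
  have \<nu>f: "f k \<le> \<nu> k" for k unfolding \<nu>_def by (rule member_le_sum) auto
  have \<nu>mono: "\<nu> k \<le> \<nu> l" if "k \<le> l" for k l unfolding \<nu>_def using that by (intro sum_mono2) auto
  define S where "S = (\<lambda>c :: 'c poly fract \<Rightarrow> 'c. \<Sum>t\<in>T. const_fun (c t) * t)"
  have SQ: "S c \<in> QX" if "\<And>t. c t \<in> \<rat>" for c
    unfolding S_def using const_QX[OF that] TQ by (intro w.KD(10) w.KD(4)) auto
  have "\<exists>c. \<forall>k. ((\<forall>t. c k t \<in> \<rat>) \<and> M (y (\<nu> k) - S (c k)) \<le> ?P ^ k) \<and>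
      (\<forall>t. N (c (Suc k) t - c k t) \<le> ?P ^ k)"
  proof (rule dependent_nat_choice)
    show "\<exists>c. (\<forall>t. c t \<in> \<rat>) \<and> M (y (\<nu> 0) - S c) \<le> ?P ^ 0"
      using y1 by (intro exI[of _ "\<lambda>_. 0"]) (simp add: S_def)
    fix c k assume c: "(\<forall>t. c t \<in> \<rat>) \<and> M (y (\<nu> k) - S c) \<le> ?P ^ k"
    let ?y = "y (\<nu> (Suc k))"
    have ScQ: "S c \<in> QX" using SQ c by blast
    have "M ((?y - y (\<nu> k)) + (y (\<nu> k) - S c)) \<le> max (M (?y - y (\<nu> k))) (M (y (\<nu> k) - S c))"
      by (intro w.add w.KD(7) Y(1) ScQ)
    moreover have "M (?y - y (\<nu> k)) < ?P ^ k"
      using f[of k "\<nu> (Suc k)" "\<nu> k"] \<nu>f[of k] \<nu>mono[of k "Suc k"] by simp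
    ultimately have small: "M (?y - S c) \<le> ?P ^ k" using c by (auto simp: max_def split: if_splits)
    define pk where "pk = const_fun ((of_nat p :: 'c) ^ k)"
    have pk: "pk \<in> QX" "pk \<noteq> 0" "M pk = ?P ^ k"
      using const_QX[of "of_nat p ^ k"] w_Rats[of "of_nat p ^ k"] p_nonzero by (auto simp: pk_def N.power)
    have dQ: "?y - S c \<in> QX" using w.KD(7)[OF Y(1) ScQ] .
    have "(?y - S c) / pk \<in> W"
      using w.KD(8)[OF dQ pk(1)] w.divide[OF dQ pk(1)] small pk(3) Pk[of k] by (simp add: W_iff)
    then obtain t0 where t0: "t0 \<in> T" "M ((?y - S c) / pk - t0) \<le> ?P" using T(3) by blast
    \<comment> \<open>The next digit: the remainder divided by \<open>p ^ k\<close> lies in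
      \<open>W\<close> and has a representative \<open>t0\<close> modulo \<open>p W\<close>, so
      \<open>p ^ k\<close> is added to the coefficient of \<open>t0\<close>.\<close>
    define c' where "c' = c(t0 := c t0 + of_nat p ^ k)"
    have "S c' = S c + pk * t0"
    proof -
      have "S c' = const_fun (c' t0) * t0 + (\<Sum>t\<in>T - {t0}. const_fun (c' t) * t)"
        unfolding S_def using T(1) t0(1) by (rule sum.remove)
      also have "(\<Sum>t\<in>T - {t0}. const_fun (c' t) * t) = (\<Sum>t\<in>T - {t0}. const_fun (c t) * t)"
        by (intro sum.cong) (auto simp: c'_def)
      also have "const_fun (c' t0) * t0 = pk * t0 + const_fun (c t0) * t0"
        by (simp add: c'_def pk_def algebra_simps)
      finally have "S c' = pk * t0 + (const_fun (c t0) * t0 + (\<Sum>t\<in>T - {t0}. const_fun (c t) * t))" by simp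
      also have "const_fun (c t0) * t0 + (\<Sum>t\<in>T - {t0}. const_fun (c t) * t) = S c"
        unfolding S_def using T(1) t0(1) by (rule sum.remove[symmetric])
      finally show ?thesis by simp
    qed
    then have "?y - S c' = pk * ((?y - S c) / pk - t0)" using pk(2) by (simp add: field_simps)
    then have "M (?y - S c') = ?P ^ k * M ((?y - S c) / pk - t0)"
      using w.mult[OF pk(1) w.KD(7)[OF w.KD(8)[OF dQ pk(1)] TQ[OF t0(1)]]] pk(3) by simp
    also have "\<dots> \<le> ?P ^ k * ?P" using t0(2) Pk[of k] by (intro mult_left_mono) auto
    finally have "M (?y - S c') \<le> ?P ^ Suc k" by (simp add: mult.commute)
    moreover have "c' t \<in> \<rat>" for t using c by (simp add: c'_def)
    moreover have "N (c' t - c t) \<le> ?P ^ k" for t using Pk[of k] by (simp add: c'_def N.power)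
    ultimately show "\<exists>c'. ((\<forall>t. c' t \<in> \<rat>) \<and> M (?y - S c') \<le> ?P ^ Suc k) \<and> (\<forall>t. N (c' t - c t) \<le> ?P ^ k)"
      by blast
  qed
  then obtain c where c: "\<And>k t. c k t \<in> \<rat>" "\<And>k. M (y (\<nu> k) - S (c k)) \<le> ?P ^ k"
    "\<And>k t. N (c (Suc k) t - c k t) \<le> ?P ^ k" by blast
  have cN: "N (c n t - c k t) \<le> ?P ^ k" if "k \<le> n" for n k t
    using that
  proof (induction n rule: dec_induct)
    case base
    then show ?case using Pk[of k] by simp
  next
    case (step n)
    have "?P ^ n \<le> ?P ^ k" using step(1) N_p_bounds by (intro power_decreasing) auto
    then have "N (c (Suc n) t - c n t) \<le> ?P ^ k" using c(3)[of n t] by linarith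
    then show ?case using N.add[of "c (Suc n) t - c n t" "c n t - c k t"] step.IH by simp
  qed
  define d where "d = (\<lambda>t n. c n t / of_nat p ^ m)"
  have dR: "d t n \<in> \<rat>" for t n using c(1) by (simp add: d_def)
  have "N_cauchy (d t)" for t
    unfolding N_cauchy_def
  proof (intro allI impI)
    fix \<epsilon> :: real assume "\<epsilon> > 0"
    then obtain k where k: "?P ^ k < \<epsilon> * ?P ^ m" using N_p_power_less[of "\<epsilon> * ?P ^ m"] Pk by auto
    have "N (d t a - d t b) < \<epsilon>" if "a \<ge> k" "b \<ge> k" for a b
    proof -
      have "N (c a t - c b t) \<le> ?P ^ k"
        using N.diff[of "c a t - c k t" "c b t - c k t"] cN[OF that(1), of t] cN[OF that(2), of t] by simp
      moreover have "d t a - d t b = (c a t - c b t) / of_nat p ^ m" by (simp add: d_def diff_divide_distrib)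
      ultimately have "N (d t a - d t b) \<le> ?P ^ k / ?P ^ m"
        using Pk[of m] by (simp add: N.divide N.power divide_right_mono)
      also have "\<dots> < \<epsilon>" using k Pk[of m] by (simp add: pos_divide_less_eq)
      finally show ?thesis .
    qed
    then show "\<exists>n0. \<forall>a\<ge>n0. \<forall>b\<ge>n0. N (d t a - d t b) < \<epsilon>" by blast
  qed
  moreover have "M_null (\<lambda>n. z n - (\<Sum>t\<in>T. const_fun (d t n) * t))"
  proof (rule M_nullI)
    have SdQ: "(\<Sum>t\<in>T. const_fun (d t n) * t) \<in> QX" for n
      using const_QX[OF dR] TQ by (intro w.KD(10) w.KD(4)) auto
    show dQ: "z n - (\<Sum>t\<in>T. const_fun (d t n) * t) \<in> QX" for n
      by (rule w.KD(7)[OF M_cauchyD(1)[OF z] SdQ])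
    fix \<epsilon> :: real assume "\<epsilon> > 0"
    then obtain k where k: "?P ^ k < \<epsilon> * ?P ^ m" using N_p_power_less[of "\<epsilon> * ?P ^ m"] Pk by auto
    have "M (z n - (\<Sum>t\<in>T. const_fun (d t n) * t)) < \<epsilon>" if n: "n \<ge> max k (\<nu> k)" for n
    proof -
      have "r * const_fun (d t n) = const_fun (c n t)" for t
        using p_nonzero by (simp add: r_def d_def flip: const_fun_simps(6))
      then have "r * (\<Sum>t\<in>T. const_fun (d t n) * t) = S (c n)"
        unfolding S_def by (simp add: sum_distrib_left mult.assoc[symmetric])
      then have eq: "r * (z n - (\<Sum>t\<in>T. const_fun (d t n) * t)) = (y n - y (\<nu> n)) + (y (\<nu> n) - S (c n))"
        by (simp add: y_def right_diff_distrib)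
      have "M (y n - y (\<nu> n)) < ?P ^ k"
        using f[of k n "\<nu> n"] n \<nu>f[of k] \<nu>mono[of k n] by simp
      moreover have "M (y (\<nu> n) - S (c n)) \<le> ?P ^ k"
      proof -
        have "?P ^ n \<le> ?P ^ k" using n N_p_bounds by (intro power_decreasing) auto
        then show ?thesis using c(2)[of n] by linarith
      qed
      moreover have "M ((y n - y (\<nu> n)) + (y (\<nu> n) - S (c n))) \<le> max (M (y n - y (\<nu> n))) (M (y (\<nu> n) - S (c n)))"
        by (intro w.add w.KD(7) Y(1) SQ c(1))
      ultimately have "?P ^ m * M (z n - (\<Sum>t\<in>T. const_fun (d t n) * t)) \<le> ?P ^ k"
        using w.mult[OF r(1) dQ, of n] unfolding eq r(3) by simp
      also have "\<dots> < ?P ^ m * \<epsilon>" using k by (simp add: mult.commute)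
      finally show ?thesis using Pk[of m] by simp
    qed
    then show "\<exists>n0. \<forall>n\<ge>n0. M (z n - (\<Sum>t\<in>T. const_fun (d t n) * t)) < \<epsilon>" by blast
  qed
  ultimately show ?thesis using dR by blast
qed

text \<open>By \<open>expansion\<close> the representatives of \<open>W / p W\<close> span the
  completion, with the limits of the Cauchy sequences of rational coefficients as scalars from
  \<open>Qphat\<close>.\<close>

lemma fin_quot_finite_dimension:
  assumes fin_quot shows "C.finite_dimension Qphat (carrier QXhat)"
proof -
  obtain T where T: "finite T" "T \<subseteq> W" "\<And>z. z \<in> W \<Longrightarrow> \<exists>t\<in>T. M (z - t) \<le> N (of_nat p)"
    using assms unfolding fin_quot_def by blast
  obtain Ts where Ts: "set Ts = T" "distinct Ts" using finite_distinct_list[OF T(1)] by blast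
  have TQ: "t \<in> QX" if "t \<in> T" for t using T(2) that W_iff by blast
  let ?Us = "map (\<lambda>t. climit (\<lambda>_. t)) Ts"
  have Us: "set ?Us \<subseteq> carrier QXhat" using Ts(1) TQ M_cauchy_const by (auto simp: carrier_QXhat)
  have "a \<in> C.Span Qphat ?Us" if "a \<in> carrier QXhat" for a
  proof -
    obtain z where z: "M_cauchy z" "a = climit z" using \<open>a \<in> carrier QXhat\<close> by (auto simp: carrier_QXhat)
    obtain c where c: "\<And>t n. c t n \<in> \<rat>" "\<And>t. N_cauchy (c t)"
      "M_null (\<lambda>n. z n - (\<Sum>t\<in>T. const_fun (c t n) * t))" using expansion[OF T z(1)] by blast
    have cc: "M_cauchy (\<lambda>n. const_fun (c t n))" for t using N_cauchy_M_cauchy[OF c(1) c(2)] .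
    let ?Ks = "map (\<lambda>t. climit (\<lambda>n. const_fun (c t n))) Ts"
    have comb: "C.combine (map (\<lambda>t. climit (\<lambda>n. const_fun (c t n))) ts) (map (\<lambda>t. climit (\<lambda>_. t)) ts)
        = climit (\<lambda>n. \<Sum>t\<leftarrow>ts. const_fun (c t n) * t) \<and> M_cauchy (\<lambda>n. \<Sum>t\<leftarrow>ts. const_fun (c t n) * t)"
      if "set ts \<subseteq> T" for ts
      using that
    proof (induction ts)
      case Nil
      then show ?case using h.hom_zero M_cauchy_const[OF w.KD(1)] by simp
    next
      case (Cons t ts)
      have t: "M_cauchy (\<lambda>_. t)" using Cons.prems TQ M_cauchy_const by simp
      have ct: "M_cauchy (\<lambda>n. const_fun (c t n) * t)" by (rule M_cauchy_mult[OF cc t])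
      have IH: "C.combine (map (\<lambda>t. climit (\<lambda>n. const_fun (c t n))) ts) (map (\<lambda>t. climit (\<lambda>_. t)) ts)
        = climit (\<lambda>n. \<Sum>t\<leftarrow>ts. const_fun (c t n) * t)" "M_cauchy (\<lambda>n. \<Sum>t\<leftarrow>ts. const_fun (c t n) * t)"
        using Cons by auto
      have "climit (\<lambda>n. const_fun (c t n)) \<otimes>\<^bsub>QXhat\<^esub> climit (\<lambda>_. t) = climit (\<lambda>n. const_fun (c t n) * t)"
        using h.hom_mult[of "\<lambda>n. const_fun (c t n)" "\<lambda>_. t"] cc t by simp
      moreover have "climit (\<lambda>n. const_fun (c t n) * t) \<oplus>\<^bsub>QXhat\<^esub> climit (\<lambda>n. \<Sum>t\<leftarrow>ts. const_fun (c t n) * t)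
          = climit (\<lambda>n. const_fun (c t n) * t + (\<Sum>t\<leftarrow>ts. const_fun (c t n) * t))"
        using h.hom_add[of "\<lambda>n. const_fun (c t n) * t" "\<lambda>n. \<Sum>t\<leftarrow>ts. const_fun (c t n) * t"] ct IH(2) by simp
      ultimately show ?case using IH M_cauchy_add[OF ct IH(2)] by simp
    qed
    have sl: "(\<Sum>t\<leftarrow>Ts. const_fun (c t n) * t) = (\<Sum>t\<in>T. const_fun (c t n) * t)" for n
      by (simp only: sum_list_distinct_conv_sum_set[OF Ts(2)] Ts(1))
    have "C.combine ?Ks ?Us = climit z"
      using comb[of Ts] Ts(1) c(3) climit_eq_iff[OF z(1), of "\<lambda>n. \<Sum>t\<in>T. const_fun (c t n) * t"]
      unfolding sl by simp
    moreover have "set ?Ks \<subseteq> Qphat" using cc c(1) unfolding Qphat_eq by auto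
    ultimately have "\<exists>Ks. set Ks \<subseteq> Qphat \<and> a = C.combine Ks ?Us" using z(2) by metis
    then show ?thesis using C.Span_eq_combine_set[OF Qphat_subfield Us] by blast
  qed
  then have "C.Span Qphat ?Us = carrier QXhat"
    using C.Span_in_carrier[OF subringE(1)[OF subfieldE(1)[OF Qphat_subfield]] Us] by blast
  then show ?thesis using C.Span_finite_dimension[OF Qphat_subfield Us] by simp
qed

end

section \<open>Ramification index and residue degree\<close>

context padic_ext
begin

lemma residue_class_eq: "x \<in> w.vring \<Longrightarrow> y \<in> w.vring \<Longrightarrow>
    residue_class W x = residue_class W y \<longleftrightarrow> M (x - y) < 1"
  unfolding W_vring by (rule w.residue_class_eq_iff)

lemma residue_prime_field_eq:
  "residue_prime_field p W = {residue_class W (const_fun c) | c. c \<in> \<rat> \<and> N c \<le> 1}"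
  unfolding residue_prime_field_def Z_loc_funs_eq by blast

lemma residue_prime_field_subfield: "subfield (residue_prime_field p W) (residue_field W)"
  unfolding W_vring
proof (rule w.k.subfieldI')
  show "subring (residue_prime_field p w.vring) (residue_field w.vring)"
    using residue_prime_field_subring unfolding W_vring .
  fix x assume x: "x \<in> residue_prime_field p w.vring - {\<zero>\<^bsub>residue_field w.vring\<^esub>}"
  then obtain c where c: "c \<in> \<rat>" "N c \<le> 1" "x = residue_class w.vring (const_fun c)"
    using residue_prime_field_eq unfolding W_vring by blast
  have "\<not> M (const_fun c) < 1" using x c w.residue_zero_iff[OF const_vring[OF c(1,2)]] by auto
  then have Nc: "N c = 1" using c(2) w_Rats[OF c(1)] by simp
  then have c0: "c \<noteq> 0" by auto
  have ic: "inverse c \<in> \<rat>" "N (inverse c) \<le> 1" using c(1) Nc by (auto simp: N.inverse)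
  have "residue_class w.vring (const_fun c) \<otimes>\<^bsub>residue_field w.vring\<^esub>
      residue_class w.vring (const_fun (inverse c)) = residue_class w.vring (const_fun c * const_fun (inverse c))"
    using w.k.hom_mult[of "const_fun c" "const_fun (inverse c)"] const_vring[OF c(1,2)] const_vring[OF ic] by simp
  also have "const_fun c * const_fun (inverse c) = 1" using c0 by (simp flip: const_fun_simps(6))
  finally have "inv\<^bsub>residue_field w.vring\<^esub> x = residue_class w.vring (const_fun (inverse c))"
    unfolding c(3) using w.k.hom_one const_vring[OF c(1,2)] const_vring[OF ic]
    by (intro w.k.comm_inv_char) (auto simp: w.carrier_residue_field)
  then show "inv\<^bsub>residue_field w.vring\<^esub> x \<in> residue_prime_field p w.vring"
    using residue_prime_field_eq ic unfolding W_vring by blast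
qed

lemma finite_residue_prime_field: "finite (residue_prime_field p W)"
proof -
  have "x \<in> (\<lambda>n. residue_class W (const_fun (of_nat n))) ` {..<p}" if "x \<in> residue_prime_field p W" for x
  proof -
    obtain c where c: "c \<in> \<rat>" "N c \<le> 1" "x = residue_class W (const_fun c)"
      using \<open>x \<in> residue_prime_field p W\<close> unfolding residue_prime_field_eq by blast
    obtain q where q: "c = of_rat q" using c(1) by (rule Rats_cases)
    obtain n where n: "n < p" "N (c - of_nat n) \<le> N (of_nat p)"
      using rat_le_1_approx[of q 1] c(2) q by auto
    have nN: "N (of_nat n) \<le> 1" using N.of_int_le_1[of "int n"] by simp
    have "M (const_fun c - const_fun (of_nat n)) < 1"
      using w_Rats[of "c - of_nat n"] c(1) n(2) N_p_bounds(2) by simp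
    then have "x = residue_class W (const_fun (of_nat n))"
      using residue_class_eq[OF const_vring[OF c(1,2)] const_vring[OF _ nN]] c(3) by simp
    then show ?thesis using n(1) by blast
  qed
  then show ?thesis by (meson finite_imageI finite_lessThan finite_subset subsetI)
qed

text \<open>Over a finite field, finite dimension is the same as finiteness; the residue degree can
  then be handled by counting residues.\<close>

lemma finite_dimension_residue:
  "ring.finite_dimension (residue_field W) (residue_prime_field p W) (carrier (residue_field W)) \<longleftrightarrow>
    finite (carrier (residue_field W))"
proof -
  let ?k = "residue_field w.vring" and ?F = "residue_prime_field p w.vring"
  have sub: "subfield ?F ?k" using residue_prime_field_subfield unfolding W_vring .
  have finF: "finite ?F" using finite_residue_prime_field unfolding W_vring .
  have "finite (carrier ?k)" if "w.k.finite_dimension ?F (carrier ?k)"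
  proof -
    have "finite E" if "w.k.dimension n K E" "finite K" for n K E
      using that
    proof induction
      case (Suc_dim v E n K)
      have "w.k.line_extension K v E \<subseteq> (\<lambda>(k, e). k \<otimes>\<^bsub>?k\<^esub> v \<oplus>\<^bsub>?k\<^esub> e) ` (K \<times> E)"
        by (auto simp: w.k.line_extension_mem_iff)
      moreover have "finite ((\<lambda>(k, e). k \<otimes>\<^bsub>?k\<^esub> v \<oplus>\<^bsub>?k\<^esub> e) ` (K \<times> E))"
        using Suc_dim by (intro finite_imageI finite_SigmaI)
      ultimately show ?case by (rule finite_subset)
    qed simp
    then show ?thesis using that finF unfolding w.k.finite_dimension_def by blast
  qed
  moreover have "w.k.finite_dimension ?F (carrier ?k)" if fin: "finite (carrier ?k)"
  proof -
    obtain Us where Us: "set Us = carrier ?k" using finite_list[OF fin] by blast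
    have "w.k.Span ?F Us = carrier ?k"
      using w.k.Span_base_incl[OF sub, of Us] Us
        w.k.Span_in_carrier[OF subringE(1)[OF subfieldE(1)[OF sub]], of Us] by auto
    then show ?thesis using w.k.Span_finite_dimension[OF sub, of Us] Us by simp
  qed
  ultimately show ?thesis unfolding W_vring by blast
qed

text \<open>Together with \<open>ramification_index_nonzero\<close> this guards against
  \<open>0 * \<infinity> = 0\<close> in \<open>enat\<close>: a finite product then means two finite
  factors.\<close>

lemma residue_degree_nonzero: "residue_degree p W \<noteq> 0"
proof
  let ?k = "residue_field w.vring" and ?F = "residue_prime_field p w.vring"
  have sub: "subfield ?F ?k" using residue_prime_field_subfield unfolding W_vring .
  assume "residue_degree p W = 0"
  then have "w.k.finite_dimension ?F (carrier ?k)" "w.k.dim ?F (carrier ?k) = 0"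
    unfolding residue_degree_def W_vring Let_def by (auto simp: zero_enat_def split: if_splits)
  then have "w.k.dimension 0 ?F (carrier ?k)"
    using w.k.finite_dimensionE[OF sub, of "carrier ?k"] unfolding over_def by metis
  then have "carrier ?k = {\<zero>\<^bsub>?k\<^esub>}" using w.k.dimension_zero[OF sub] by blast
  then show False using w.k.one_closed w.k.one_not_zero by blast
qed

lemma value_group_eq: "value_group QX w = {- ln (M \<phi>) | \<phi>. \<phi> \<in> QX - {0}}"
proof -
  have "w \<phi> = ereal r \<longleftrightarrow> r = - ln (M \<phi>)" if "\<phi> \<in> QX - {0}" for \<phi> r
  proof -
    have "M \<phi> > 0" using w.pos that by blast
    then show ?thesis using valuation_nrm(3)[OF w_valuation, of \<phi> r] that
      by (metis DiffD1 exp_ln ln_exp minus_minus)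
  qed
  then show ?thesis unfolding value_group_def by blast
qed

definition cosets :: "real set set" where
  "cosets = (\<lambda>r. {i + r | i. i \<in> \<int>}) ` value_group QX w"

lemma ramification_index_eq: "ramification_index w = enat_card cosets"
proof -
  have "a_rcosets\<^bsub>ring_on (value_group QX w)\<^esub> \<int> = cosets"
    unfolding A_RCOSETS_def' cosets_def a_r_coset_def' by auto
  then show ?thesis by (simp add: ramification_index_def)
qed

lemma ramification_index_nonzero: "ramification_index w \<noteq> 0"
proof -
  have "0 \<in> value_group QX w"
    unfolding value_group_eq using w.KD(2) by (auto intro!: exI[of _ 1])
  then have "cosets \<noteq> {}" by (auto simp: cosets_def)
  then show ?thesis unfolding ramification_index_eq enat_card_def
    by (auto simp: zero_enat_def card_eq_0_iff)
qed

lemma ef_finite_iff: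
  "ramification_index w * residue_degree p W < \<infinity> \<longleftrightarrow> finite cosets \<and> finite (carrier (residue_field W))"
proof -
  have "ramification_index w * residue_degree p W < \<infinity> \<longleftrightarrow> ramification_index w \<noteq> \<infinity> \<and> residue_degree p W \<noteq> \<infinity>"
    using imult_is_infinity ramification_index_nonzero residue_degree_nonzero by auto
  also have "ramification_index w \<noteq> \<infinity> \<longleftrightarrow> finite cosets"
    by (simp add: ramification_index_eq enat_card_def)
  also have "residue_degree p W \<noteq> \<infinity> \<longleftrightarrow> finite (carrier (residue_field W))"
    unfolding residue_degree_def Let_def using finite_dimension_residue by auto
  finally show ?thesis .
qed

lemma coset_eq_iff: "{i + r | i. i \<in> \<int>} = {i + s | i. i \<in> \<int>} \<longleftrightarrow> r - s \<in> \<int>" for r s :: real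
proof
  assume "{i + r | i. i \<in> \<int>} = {i + s | i. i \<in> \<int>}"
  moreover have "r \<in> {i + r | i. i \<in> \<int>}" by (auto intro!: exI[of _ 0])
  ultimately obtain i where "i \<in> \<int>" "r = i + s" by auto
  then show "r - s \<in> \<int>" by simp
next
  assume d: "r - s \<in> \<int>"
  have "x \<in> {i + t | i. i \<in> \<int>} \<longleftrightarrow> x - t \<in> \<int>" for x t :: real
    by (auto intro: exI[of _ "x - t"])
  moreover have "x - r \<in> \<int> \<longleftrightarrow> x - s \<in> \<int>" for x
    using Ints_add[OF _ d, of "x - r"] Ints_diff[OF _ d, of "x - s"] by auto
  ultimately show "{i + r | i. i \<in> \<int>} = {i + s | i. i \<in> \<int>}" by blast
qed

lemma ln_N_p: "ln (N (of_nat p)) = -1"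
  by (simp add: N_p)

text \<open>Residues are already determined modulo \<open>p W\<close>. As to values, every coset of
  \<int> contains the value of some \<psi> in \<open>W\<close> with norm larger than that of
  \<open>p\<close>, and such a norm does not change modulo \<open>p W\<close>. So the
  representatives exhaust both residues and cosets.\<close>

lemma fin_quot_imp_ef:
  assumes fin_quot shows "finite cosets" "finite (carrier (residue_field W))"
proof -
  obtain T where T: "finite T" "T \<subseteq> W" "\<And>z. z \<in> W \<Longrightarrow> \<exists>t\<in>T. M (z - t) \<le> N (of_nat p)"
    using assms unfolding fin_quot_def by blast
  have "residue_class W z \<in> residue_class W ` T" if "z \<in> W" for z
  proof -
    obtain t where t: "t \<in> T" "M (z - t) \<le> N (of_nat p)" using T(3)[OF \<open>z \<in> W\<close>] by blast
    then have "M (z - t) < 1" using N_p_bounds(2) by simp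
    then have "residue_class W z = residue_class W t"
      using residue_class_eq[of z t] \<open>z \<in> W\<close> t(1) T(2) W_vring by blast
    then show ?thesis using t(1) by blast
  qed
  then have "carrier (residue_field W) \<subseteq> residue_class W ` T"
    unfolding W_vring w.carrier_residue_field by blast
  then show "finite (carrier (residue_field W))" using T(1) finite_subset by blast
  have "C \<in> (\<lambda>t. {i + (- ln (M t)) | i. i \<in> \<int>}) ` T" if C: "C \<in> cosets" for C
  proof -
    obtain \<phi> where \<phi>: "\<phi> \<in> QX - {0}" "C = {i + (- ln (M \<phi>)) | i. i \<in> \<int>}"
      using C unfolding cosets_def value_group_eq by blast
    \<comment> \<open>The floor puts the value of \<psi> at least at 0 and below 1, which makes its
      norm larger than that of \<open>p\<close>.\<close>
    define k where "k = \<lfloor>- ln (M \<phi>)\<rfloor>"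
    define r where "r = (of_nat p :: 'c) powi k"
    have rR: "r \<in> \<rat>" unfolding r_def by (auto simp: power_int_def)
    have r0: "r \<noteq> 0" unfolding r_def using p_nonzero by simp
    have "N r = N (of_nat p) powi k" unfolding r_def by (auto simp: power_int_def N.power N.inverse)
    then have Nr: "N r = exp (- of_int k)" unfolding N_p exp_powi by simp
    define \<psi> where "\<psi> = \<phi> / const_fun r"
    have M\<phi>: "M \<phi> > 0" using w.pos \<phi>(1) by blast
    have \<psi>: "\<psi> \<in> QX" "M \<psi> = M \<phi> / exp (- of_int k)"
      using w.KD(8) w.divide const_QX[OF rR] w_Rats[OF rR] \<phi>(1) Nr by (auto simp: \<psi>_def)
    have ln\<psi>: "- ln (M \<psi>) = - ln (M \<phi>) - of_int k" unfolding \<psi>(2) using M\<phi> by (simp add: ln_div)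
    have M\<psi>0: "M \<psi> > 0" unfolding \<psi>(2) using M\<phi> by simp
    have range: "0 \<le> - ln (M \<psi>)" "- ln (M \<psi>) < 1" unfolding ln\<psi> k_def by linarith+
    then have "M \<psi> \<le> 1" using M\<psi>0 by simp
    then have \<psi>W: "\<psi> \<in> W" using \<psi>(1) W_iff by blast
    obtain t where t: "t \<in> T" "M (\<psi> - t) \<le> N (of_nat p)" using T(3)[OF \<psi>W] by blast
    have "exp (-1) < exp (ln (M \<psi>))" using range(2) by simp
    then have "N (of_nat p) < M \<psi>" using M\<psi>0 by (simp add: N_p)
    then have "M t = M \<psi>" using w.close_eq[OF \<psi>(1), of t] t T(2) W_iff by auto
    then have "- ln (M \<phi>) - (- ln (M t)) \<in> \<int>" using ln\<psi> by simp
    then have "C = {i + (- ln (M t)) | i. i \<in> \<int>}" unfolding \<phi>(2) coset_eq_iff .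
    then show ?thesis using t(1) by blast
  qed
  then show "finite cosets" using T(1) by (meson finite_imageI finite_subset subsetI)
qed

text \<open>Above the norm of \<open>p\<close> and up to 1 only finitely many norms occur, at most
  one for each coset. An element of the largest such norm is brought to a smaller norm by
  subtracting a residue representative times a fixed \<phi> of that norm; after finitely many such
  reductions it lies in \<open>p W\<close>.\<close>

lemma ef_imp_fin_quot:
  assumes "finite cosets" "finite (carrier (residue_field W))" shows fin_quot
proof -
  let ?P = "N (of_nat p)"
  define G where "G = {g. ?P < g \<and> g \<le> 1 \<and> (\<exists>\<phi>\<in>QX. M \<phi> = g)}"
  have finG: "finite G"
  proof (rule inj_on_finite)
    show "(\<lambda>g. {i + (- ln g) | i. i \<in> \<int>}) ` G \<subseteq> cosets"
      unfolding cosets_def value_group_eq G_def using N_p_bounds(1) by fastforce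
    show "inj_on (\<lambda>g. {i + (- ln g) | i. i \<in> \<int>}) G"
    proof (rule inj_onI)
      fix a b assume ab: "a \<in> G" "b \<in> G" "{i + (- ln a) | i. i \<in> \<int>} = {i + (- ln b) | i. i \<in> \<int>}"
      have r: "-1 < ln x \<and> ln x \<le> 0 \<and> x > 0" if "x \<in> G" for x
      proof -
        have x: "?P < x" "x \<le> 1" using that by (auto simp: G_def)
        then have x0: "x > 0" using N_p_bounds(1) by linarith
        have "ln ?P < ln x" using x(1) x0 N_p_bounds(1) by simp
        then show ?thesis using x(2) x0 by (simp add: ln_N_p)
      qed
      have "- ln a - (- ln b) \<in> \<int>" using ab(3) unfolding coset_eq_iff .
      then obtain i :: int where i: "ln b - ln a = of_int i" by (auto elim: Ints_cases)
      then have "i = 0" using r[OF ab(1)] r[OF ab(2)] by linarith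
      then have "ln a = ln b" using i by simp
      then show "a = b" using r[OF ab(1)] r[OF ab(2)] by simp
    qed
    show "finite cosets" by fact
  qed
  have "\<exists>d. d \<in> W \<and> residue_class W d = c" if "c \<in> carrier (residue_field W)" for c
    using that unfolding W_vring w.carrier_residue_field by blast
  then obtain rep where rep: "\<And>c. c \<in> carrier (residue_field W) \<Longrightarrow> rep c \<in> W \<and> residue_class W (rep c) = c"
    by metis
  define D where "D = rep ` carrier (residue_field W)"
  have D: "finite D" "D \<subseteq> W" using assms(2) rep by (auto simp: D_def)
  have near: "\<exists>d\<in>D. M (y - d) < 1" if y: "y \<in> W" for y
  proof -
    let ?c = "residue_class W y"
    have c: "?c \<in> carrier (residue_field W)" using y unfolding W_vring w.carrier_residue_field by blast
    then have "M (y - rep ?c) < 1" using rep[OF c] residue_class_eq[of y "rep ?c"] y W_vring by simp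
    then show ?thesis using c by (auto simp: D_def)
  qed
  have "\<exists>T. finite T \<and> T \<subseteq> W \<and> (\<forall>z\<in>W. M z < g \<longrightarrow> (\<exists>t\<in>T. M (z - t) \<le> ?P))" for g
  proof (induction "card {x\<in>G. x < g}" arbitrary: g rule: less_induct)
    case less
    have fin: "finite {x\<in>G. x < g}" using finG by simp
    show ?case
    proof (cases "{x\<in>G. x < g} = {}")
      case True
      have "M (z - 0) \<le> ?P" if "z \<in> W" "M z < g" for z
        using True that W_iff[of z] by (auto simp: G_def not_less)
      then show ?thesis using w.vring_closed(1) W_vring by (intro exI[of _ "{0}"]) auto
    next
      case False
      define m where "m = Max {x\<in>G. x < g}"
      have m: "m \<in> G" "m < g" "\<And>x. x \<in> G \<Longrightarrow> x < g \<Longrightarrow> x \<le> m"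
        using Max_in[OF fin False] Max_ge[OF fin] by (auto simp: m_def)
      have "{x\<in>G. x < m} \<subset> {x\<in>G. x < g}" using m by auto
      then have "card {x\<in>G. x < m} < card {x\<in>G. x < g}" using fin by (rule psubset_card_mono[rotated])
      from less[OF this] obtain T where T: "finite T" "T \<subseteq> W"
        "\<And>z. z \<in> W \<Longrightarrow> M z < m \<Longrightarrow> \<exists>t\<in>T. M (z - t) \<le> ?P" by blast
      obtain \<phi> where \<phi>: "\<phi> \<in> QX" "M \<phi> = m" using m(1) by (auto simp: G_def)
      have m01: "m > 0" "m \<le> 1" "?P < m" using m(1) N_p_bounds(1) by (auto simp: G_def)
      then have \<phi>0: "\<phi> \<noteq> 0" "\<phi> \<in> W" using \<phi> W_iff by auto
      let ?T = "(\<lambda>(t, d). t + d * \<phi>) ` (T \<times> D)"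
      have ring: "x + y \<in> W" "x * y \<in> W" if "x \<in> W" "y \<in> W" for x y
        using that w.vring_closed(3,4) unfolding W_vring by blast+
      have "\<exists>t\<in>?T. M (z - t) \<le> ?P" if z: "z \<in> W" "M z < g" for z
      proof -
        have zQ: "z \<in> QX" "M z \<le> 1" using z(1) W_iff by auto
        have "M z \<le> m"
        proof (cases "?P < M z")
          case True
          then have "M z \<in> G" using zQ by (auto simp: G_def)
          then show ?thesis using m(3) z(2) by blast
        qed (use m01 in auto)
        then have "z / \<phi> \<in> W"
          using w.KD(8)[OF zQ(1) \<phi>(1)] w.divide[OF zQ(1) \<phi>(1)] \<phi>(2) m01(1) by (simp add: W_iff)
        then obtain d where d: "d \<in> D" "M (z / \<phi> - d) < 1" using near by blast
        have dQ: "d \<in> QX" "d \<in> W" using d(1) D(2) W_iff by auto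
        have "z - d * \<phi> = (z / \<phi> - d) * \<phi>" using \<phi>0(1) by (simp add: field_simps)
        then have "M (z - d * \<phi>) = M (z / \<phi> - d) * m"
          using w.mult[OF w.KD(7)[OF w.KD(8)[OF zQ(1) \<phi>(1)] dQ(1)] \<phi>(1)] \<phi>(2) by simp
        then have small: "M (z - d * \<phi>) < m" using d(2) m01(1) by simp
        moreover have "z - d * \<phi> \<in> QX" using w.KD(7)[OF zQ(1) w.KD(4)[OF dQ(1) \<phi>(1)]] .
        ultimately have "z - d * \<phi> \<in> W" using m01(2) W_iff by simp
        from T(3)[OF this small] obtain t where t: "t \<in> T" "M (z - d * \<phi> - t) \<le> ?P" by blast
        then have "M (z - (t + d * \<phi>)) \<le> ?P" by (simp add: algebra_simps)
        then show ?thesis using t(1) d(1) by force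
      qed
      moreover have "finite ?T" using T(1) D(1) by simp
      moreover have "?T \<subseteq> W"
      proof
        fix x assume "x \<in> ?T"
        then obtain t d where "t \<in> T" "d \<in> D" "x = t + d * \<phi>" by auto
        then show "x \<in> W" using ring T(2) D(2) \<phi>0(2) by blast
      qed
      ultimately show ?thesis by (intro exI[of _ ?T] conjI ballI impI)
    qed
  qed
  \<comment> \<open>The bound 2 exceeds every norm on \<open>W\<close>.\<close>
  from this[of 2] obtain T where "finite T" "T \<subseteq> W" "\<forall>z\<in>W. M z < 2 \<longrightarrow> (\<exists>t\<in>T. M (z - t) \<le> ?P)" by blast
  then show ?thesis unfolding fin_quot_def using W_iff by (intro exI[of _ T]) force
qed

text \<open>Each condition is compared with the existence of a point computing \<open>w\<close>.
  Such a point makes \<open>W / p W\<close> finite, hence the completion finite, hence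
  \<open>X\<close> algebraic, which gives back a point. The last claim returns its own \<alpha>,
  since the limit of the given sequence may be another point defining the same \<open>W\<close>,
  such as a conjugate over \<open>Q_p v\<close>.\<close>

lemma conditions_equivalent:
  shows "C.finite_dimension Qphat (carrier QXhat) \<longleftrightarrow> (\<exists>\<alpha>. norm_point \<alpha>)"
    and "C.algebraic Qphat (climit (\<lambda>_. X_fun)) \<longleftrightarrow> (\<exists>\<alpha>. norm_point \<alpha>)"
    and "ramification_index w * residue_degree p W < \<infinity> \<longleftrightarrow> (\<exists>\<alpha>. norm_point \<alpha>)"
    and "\<exists>\<alpha>. norm_point \<alpha> \<Longrightarrow> pseudo E \<Longrightarrow> follows E \<Longrightarrow> \<exists>\<alpha>. norm_point \<alpha> \<and> v_converges v E \<alpha>"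
proof -
  have fq: fin_quot if "\<exists>\<alpha>. norm_point \<alpha>" using that norm_point_fin_quot by blast
  have 21: "C.algebraic Qphat (climit (\<lambda>_. X_fun))" if "C.finite_dimension Qphat (carrier QXhat)"
    using finite_imp_algebraic that .
  have 32: "\<exists>\<alpha>. norm_point \<alpha>" if "C.algebraic Qphat (climit (\<lambda>_. X_fun))"
    using algebraic_limit[OF that] exists_following by blast
  show 1: "C.finite_dimension Qphat (carrier QXhat) \<longleftrightarrow> (\<exists>\<alpha>. norm_point \<alpha>)"
    using fq fin_quot_finite_dimension 21 32 by blast
  show 2: "C.algebraic Qphat (climit (\<lambda>_. X_fun)) \<longleftrightarrow> (\<exists>\<alpha>. norm_point \<alpha>)"
    using 1 21 32 by blast
  show "ramification_index w * residue_degree p W < \<infinity> \<longleftrightarrow> (\<exists>\<alpha>. norm_point \<alpha>)"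
    unfolding ef_finite_iff
    using fq fin_quot_imp_ef ef_imp_fin_quot fin_quot_finite_dimension 1 by blast
  show "\<exists>\<alpha>. norm_point \<alpha> \<and> v_converges v E \<alpha>" if "\<exists>\<alpha>. norm_point \<alpha>" "pseudo E" "follows E"
    using algebraic_limit[OF _ that(2,3)] 2 that(1) by blast
qed

end

theorem proposition2p24:
  fixes p :: nat
    and v :: "'c::{alg_closed_field,field_char_0} \<Rightarrow> ereal"
    and W :: "'c poly fract set"
    and w :: "'c poly fract \<Rightarrow> ereal"
  assumes "prime p"
    and "padic_algebraic_closure p v"
    and "valuation_domain_extension p W"
    and "residually_algebraic p W"
    and "normalized_valuation p W w"
    and torsion: "value_group (rat_funs \<rat>) w \<subseteq> \<rat>"
  shows
    "let QX = rat_funs (\<rat> :: 'c set);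
         QpX = rat_funs (Q_p v);
         QXhat = completion QX W;
         Qphat = completion_closure QX W (const_fun ` \<rat>);
         along_seq = (\<lambda>E. pseudo_convergent v E \<and> transcendental_type v \<rat> E \<and> W = Z_seq v \<rat> E);
         at_point = (\<lambda>\<alpha>. \<not> algebraic \<alpha> \<and> W = Z_at v \<rat> \<alpha>);
         ef = ramification_index w * residue_degree p W;
         cond1 = ring.finite_dimension QXhat Qphat (carrier QXhat);
         cond2 = ring.algebraic QXhat Qphat (completion_const QX W X_fun);
         cond3 = (\<exists>\<alpha>. at_point \<alpha>);
         cond4 = (ef < \<infinity>)
     in
       (\<exists>E. along_seq E) \<and>
       (cond1 \<longleftrightarrow> cond2) \<and> (cond2 \<longleftrightarrow> cond3) \<and> (cond3 \<longleftrightarrow> cond4) \<and>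
       (cond1 \<or> cond2 \<or> cond3 \<or> cond4 \<longrightarrow>
          (\<forall>E. along_seq E \<longrightarrow>
             v_cauchy v E \<and> (\<exists>\<alpha>. at_point \<alpha> \<and> v_converges v E \<alpha>) \<and> algebraic_type v (Q_p v) E) \<and>
          (\<forall>\<alpha>. at_point \<alpha> \<longrightarrow>
             (let O\<alpha> = {x \<in> Q_p_adjoin v \<alpha>. v x \<ge> 0} in
                (\<exists>E. along_seq E \<and> v_converges v E \<alpha>) \<and>
                value_group QX w = value_group (Q_p_adjoin v \<alpha>) v \<and>
                (\<exists>h\<in>ring_iso (residue_field W) (residue_field O\<alpha>).
                   \<forall>\<phi>\<in>W. \<forall>y. has_value_at \<phi> \<alpha> y \<longrightarrow>
                     h (residue_class W \<phi>) = residue_class O\<alpha> y)))) \<and>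
       (ef = \<infinity> \<longrightarrow>
          (\<forall>E. along_seq E \<longrightarrow>
             transcendental_type v (Q_p v) E \<and>
             immediate_extension QX (Z_seq v \<rat> E) QpX (Z_seq v (Q_p v) E)))"
proof -
  interpret padic_ext p v W w
    using assms by unfold_locales
  let ?along = "\<lambda>E. pseudo_convergent v E \<and> transcendental_type v \<rat> E \<and> W = Z_seq v \<rat> E"
  let ?ef = "ramification_index w * residue_degree p W"
  have conv: "v_cauchy v E \<and> (\<exists>\<alpha>. (\<not> algebraic \<alpha> \<and> W = Z_at v \<rat> \<alpha>) \<and> v_converges v E \<alpha>) \<and> algebraic_type v (Q_p v) E"
    if ex: "\<exists>\<alpha>. norm_point \<alpha>" and along: "?along E" for E
  proof -
    have E: "pseudo E" "follows E" using along along_iff by blast+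
    obtain \<alpha> where \<alpha>: "norm_point \<alpha>" "v_converges v E \<alpha>" using conditions_equivalent(4)[OF ex E] by blast
    then show ?thesis
      using converges_cauchy converges_algebraic_type[OF E(1)] at_point_iff by blast
  qed
  have point: "(\<exists>E. ?along E \<and> v_converges v E \<alpha>) \<and>
      value_group (rat_funs \<rat>) w = value_group (Q_p_adjoin v \<alpha>) v \<and>
      (\<exists>h\<in>ring_iso (residue_field W) (residue_field {x \<in> Q_p_adjoin v \<alpha>. v x \<ge> 0}).
        \<forall>\<phi>\<in>W. \<forall>y. has_value_at \<phi> \<alpha> y \<longrightarrow>
          h (residue_class W \<phi>) = residue_class {x \<in> Q_p_adjoin v \<alpha>. v x \<ge> 0} y)"
    if "\<not> algebraic \<alpha> \<and> W = Z_at v \<rat> \<alpha>" for \<alpha>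
  proof -
    have \<alpha>: "norm_point \<alpha>" using that at_point_iff by blast
    show ?thesis
      using norm_point_sequence[OF \<alpha>] along_iff value_group_at_point[OF \<alpha>] residue_field_at_point[OF \<alpha>] by blast
  qed
  have inf: "transcendental_type v (Q_p v) E \<and>
      immediate_extension (rat_funs \<rat>) (Z_seq v \<rat> E) (rat_funs (Q_p v)) (Z_seq v (Q_p v) E)"
    if "?ef = \<infinity>" "?along E" for E
  proof -
    have E: "pseudo E" "follows E" using that(2) along_iff by blast+
    \<comment> \<open>A limit of the sequence would be a point computing \<open>w\<close>, which
      would make \<open>ef\<close> finite.\<close>
    have "\<nexists>\<alpha>. norm_point \<alpha>" using conditions_equivalent(3) that(1) by simp
    then have "\<nexists>\<alpha>. v_converges v E \<alpha>" using limit_norm_point[OF E(2)] by blast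
    then interpret nonconvergent p v W w E using E by unfold_locales
    show ?thesis using transcendental_over_Qp immediate that(2) by simp
  qed
  have "\<exists>E. ?along E" using exists_following along_iff by blast
  then show ?thesis
    unfolding Let_def at_point_iff
    using conditions_equivalent(1-3) conv point inf unfolding at_point_iff by blast
qed

end
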